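(* Let $W$ be one of $W_H$, $W_L$, $W_J$, with $W=T\widetilde WT^*$ as in the context, and let $D=T(x)\big(\partial^2\rho(x)+\partial\,(\widetilde W(x)\rho(x))'\widetilde W(x)^{-1}+\widetilde K\big)T(x)^{-1}$, where $K=\sum_{j=1}^{\lfloor N/2\rfloor}E_{2j,2j}$ and $\widetilde K=2K$, $K$, $(\alpha_1+\beta_1)K$ in the Hermite, Laguerre, Jacobi case respectively. Then $D$ is a second-order operator in $\mathcal D(W)$ and $\mathcal D(W)=\mathbb C[D]$, i.e. every operator in $\mathcal D(W)$ is a polynomial in $D$.
   Context: Classical scalar weights: Hermite $w_b(x)=e^{-x^2+2bx}$ on $\mathbb R$; Laguerre $w_\alpha(x)=e^{-x}x^\alpha$ on $(0,\infty)$, $\alpha>-1$; Jacobi $w_{\alpha,\beta}(x)=(1-x)^\alpha(1+x)^\beta$ on $(-1,1)$, $\alpha,\beta>-1$; $\rho(x)=1$, $x$, $1-x^2$ in the Hermite, Laguerre, Jacobi cases. Let $N\ge2$, $A=\sum_{j=1}^{\lfloor N/2\rfloor}a_{2j-1}E_{2j-1,2j}+\sum_{j=1}^{\lfloor (N-1)/2\rfloor}a_{2j}E_{2j+1,2j}$ ($E_{s,t}$ matrix units, all $a_j\in\mathbb R\setminus\{0\}$), $T(x)=I+Ax$. $W_H=T\widetilde W_HT^*$ with $\widetilde W_H=\mathrm{diag}(w_{b_1},\dots,w_{b_N})$, $b_i$ pairwise distinct reals; $W_L=T\widetilde W_LT^*$ with $\widetilde W_L=\mathrm{diag}(w_{\alpha_1},\dots,w_{\alpha_N})$,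 $\alpha_i-\alpha_j\notin\mathbb Z$ for $i\ne j$; $W_J=T\widetilde W_JT^*$ with $\widetilde W_J=\mathrm{diag}(w_{\alpha_1,\beta_1},\dots,w_{\alpha_N,\beta_N})$, where for $i\ne j$, $\alpha_i-\alpha_j\notin\mathbb Z$ or $\beta_i-\beta_j\notin\mathbb Z$, and $\alpha_1+\beta_1=\alpha_j+\beta_j+1+(-1)^j$ for all $j$. Differential operators act on the right: $P\cdot\sum_j\partial^jF_j=\sum_j\partial^j(P)F_j$; $T\mathcal BT^{-1}$ denotes composition with multiplication operators. For a weight matrix $W$ with monic orthogonal polynomials $P_n$ (w.r.t. $\langle P,Q\rangle=\int PWQ^*dx$), $\mathcal D(W)$ is the algebra of differential operators with matrix polynomial coefficients such that $P_n\cdot D=\Lambda_n(D)P_n$ for all $n\ge0$ with constant matrices $\Lambda_n(D)$. *)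

theory Defs
  imports "HOL-Analysis.Analysis" "HOL-Computational_Algebra.Polynomial"
    "Jordan_Normal_Form.Schur_Decomposition" "Jordan_Normal_Form.Gauss_Jordan_Elimination"
begin

(* Matrix indices in JNF are 0-based; the paper's index i corresponds to i-1. *)

type_synonym pmat = "complex poly mat"

definition eval_pmat :: "pmat \<Rightarrow> real \<Rightarrow> complex mat" where
  "eval_pmat P x = map_mat (\<lambda>p. poly p (complex_of_real x)) P"

definition pderiv_mat :: "nat \<Rightarrow> pmat \<Rightarrow> pmat" where
  "pderiv_mat j P = map_mat (pderiv ^^ j) P"

definition coeff_mat :: "pmat \<Rightarrow> nat \<Rightarrow> complex mat" where
  "coeff_mat P k = mat (dim_row P) (dim_col P) (\<lambda>(i,j). coeff (P $$ (i,j)) k)"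

definition const_pmat :: "complex mat \<Rightarrow> pmat" where
  "const_pmat C = map_mat (\<lambda>c. [:c:]) C"

definition monic_deg :: "nat \<Rightarrow> nat \<Rightarrow> pmat \<Rightarrow> bool" where
  "monic_deg N n P \<longleftrightarrow> P \<in> carrier_mat N N \<and>
     (\<forall>i<N. \<forall>j<N. degree (P $$ (i,j)) \<le> n) \<and> coeff_mat P n = 1\<^sub>m N"

definition mip :: "nat \<Rightarrow> (real \<Rightarrow> complex mat) \<Rightarrow> real set \<Rightarrow> pmat \<Rightarrow> pmat \<Rightarrow> complex mat" where
  "mip N W S P Q = mat N N (\<lambda>(i,j).
     integral S (\<lambda>x. (eval_pmat P x * W x * mat_adjoint (eval_pmat Q x)) $$ (i,j)))"

definition monic_OPS :: "nat \<Rightarrow> (real \<Rightarrow> complex mat) \<Rightarrow> real set \<Rightarrow> (nat \<Rightarrow> pmat) \<Rightarrow> bool" where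
  "monic_OPS N W S Ps \<longleftrightarrow> (\<forall>n. monic_deg N n (Ps n)) \<and>
     (\<forall>n m. n \<noteq> m \<longrightarrow> mip N W S (Ps n) (Ps m) = 0\<^sub>m N N)"

(* Differential operators  D = sum_j d^j F_j  with matrix polynomial          *)
(* coefficients, represented by the list [F_0, F_1, ..., F_k], acting on the  *)
(* right:  P . D = sum_j P^(j) F_j.                                            *)

type_synonym dop = "pmat list"

definition wf_dop :: "nat \<Rightarrow> dop \<Rightarrow> bool" where
  "wf_dop N D \<longleftrightarrow> (\<forall>F\<in>set D. F \<in> carrier_mat N N)"

definition dop_act :: "dop \<Rightarrow> pmat \<Rightarrow> pmat" where
  "dop_act D P = foldr (\<lambda>j acc. pderiv_mat j P * D ! j + acc) [0..<length D]
                    (0\<^sub>m (dim_row P) (dim_col P))"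

definition poly_dop_act :: "complex poly \<Rightarrow> dop \<Rightarrow> pmat \<Rightarrow> pmat" where
  "poly_dop_act q D P = foldr (\<lambda>k acc. [:coeff q k:] \<cdot>\<^sub>m ((dop_act D ^^ k) P) + acc)
                          [0..<Suc (degree q)] (0\<^sub>m (dim_row P) (dim_col P))"

definition DW :: "nat \<Rightarrow> (real \<Rightarrow> complex mat) \<Rightarrow> real set \<Rightarrow> dop set" where
  "DW N W S = {D. wf_dop N D \<and> (\<forall>Ps. monic_OPS N W S Ps \<longrightarrow>
      (\<forall>n. \<exists>\<Lambda>\<in>carrier_mat N N. dop_act D (Ps n) = const_pmat \<Lambda> * Ps n))}"

definition poly_algebra :: "nat \<Rightarrow> dop \<Rightarrow> dop set" where
  "poly_algebra N D = {E. wf_dop N E \<and>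
      (\<exists>q. \<forall>P\<in>carrier_mat N N. dop_act E P = poly_dop_act q D P)}"

(* The classical families.  Parameters are 1-based functions: p i, q i for   *)
(* i = 1..N  (Hermite: p = b; Laguerre: p = alpha; Jacobi: p = alpha,q = beta)*)

datatype family = Hermite | Laguerre | Jacobi

fun scalar_weight :: "family \<Rightarrow> real \<Rightarrow> real \<Rightarrow> real \<Rightarrow> real" where
  "scalar_weight Hermite b _ x = exp (- x\<^sup>2 + 2 * b * x)"
| "scalar_weight Laguerre \<alpha> _ x = exp (- x) * x powr \<alpha>"
| "scalar_weight Jacobi \<alpha> \<beta> x = (1 - x) powr \<alpha> * (1 + x) powr \<beta>"

fun support :: "family \<Rightarrow> real set" where
  "support Hermite = UNIV"
| "support Laguerre = {0<..}"
| "support Jacobi = {-1<..<1}"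

fun rho :: "family \<Rightarrow> real \<Rightarrow> real" where
  "rho Hermite x = 1"
| "rho Laguerre x = x"
| "rho Jacobi x = 1 - x\<^sup>2"

fun admissible :: "family \<Rightarrow> nat \<Rightarrow> (nat \<Rightarrow> real) \<Rightarrow> (nat \<Rightarrow> real) \<Rightarrow> bool" where
  "admissible Hermite N b _ \<longleftrightarrow> (\<forall>i\<in>{1..N}. \<forall>j\<in>{1..N}. i \<noteq> j \<longrightarrow> b i \<noteq> b j)"
| "admissible Laguerre N \<alpha> _ \<longleftrightarrow> (\<forall>i\<in>{1..N}. \<alpha> i > -1) \<and>
     (\<forall>i\<in>{1..N}. \<forall>j\<in>{1..N}. i \<noteq> j \<longrightarrow> \<alpha> i - \<alpha> j \<notin> \<int>)"
| "admissible Jacobi N \<alpha> \<beta> \<longleftrightarrow> (\<forall>i\<in>{1..N}. \<alpha> i > -1 \<and> \<beta> i > -1) \<and>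
     (\<forall>i\<in>{1..N}. \<forall>j\<in>{1..N}. i \<noteq> j \<longrightarrow> \<alpha> i - \<alpha> j \<notin> \<int> \<or> \<beta> i - \<beta> j \<notin> \<int>) \<and>
     (\<forall>j\<in>{1..N}. \<alpha> 1 + \<beta> 1 = \<alpha> j + \<beta> j + 1 + (-1) ^ j)"

definition Wtilde :: "family \<Rightarrow> nat \<Rightarrow> (nat \<Rightarrow> real) \<Rightarrow> (nat \<Rightarrow> real) \<Rightarrow> real \<Rightarrow> complex mat" where
  "Wtilde fam N p q x = mat N N (\<lambda>(i,j). if i = j
       then complex_of_real (scalar_weight fam (p (i+1)) (q (i+1)) x) else 0)"

text \<open>A = sum_j a_(2j-1) E_(2j-1,2j) + sum_j a_(2j) E_(2j+1,2j) (1-based), written entrywise: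
  the (r,c) entry (1-based) is a_r if r odd and c = r+1, a_c if c even and r = c+1, else 0.\<close>
definition Amat :: "nat \<Rightarrow> (nat \<Rightarrow> real) \<Rightarrow> complex mat" where
  "Amat N a = mat N N (\<lambda>(i,j). let r = i + 1; c = j + 1 in
      if odd r \<and> c = r + 1 then complex_of_real (a r)
      else if even c \<and> r = c + 1 then complex_of_real (a c) else 0)"

definition Tpoly :: "nat \<Rightarrow> (nat \<Rightarrow> real) \<Rightarrow> pmat" where
  "Tpoly N a = 1\<^sub>m N + map_mat (\<lambda>c. [:0, c:]) (Amat N a)"

definition Kmat :: "nat \<Rightarrow> complex mat" where
  "Kmat N = mat N N (\<lambda>(i,j). if i = j \<and> even (i + 1) then 1 else 0)"

fun Ktilde :: "family \<Rightarrow> nat \<Rightarrow> (nat \<Rightarrow> real) \<Rightarrow> (nat \<Rightarrow> real) \<Rightarrow> complex mat" where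
  "Ktilde Hermite N _ _ = 2 \<cdot>\<^sub>m Kmat N"
| "Ktilde Laguerre N _ _ = Kmat N"
| "Ktilde Jacobi N \<alpha> \<beta> = complex_of_real (\<alpha> 1 + \<beta> 1) \<cdot>\<^sub>m Kmat N"

definition Wmat :: "family \<Rightarrow> nat \<Rightarrow> (nat \<Rightarrow> real) \<Rightarrow> (nat \<Rightarrow> real) \<Rightarrow> (nat \<Rightarrow> real) \<Rightarrow> real \<Rightarrow> complex mat" where
  "Wmat fam N a p q x = eval_pmat (Tpoly N a) x * Wtilde fam N p q x * mat_adjoint (eval_pmat (Tpoly N a) x)"

definition minv :: "complex mat \<Rightarrow> complex mat" where
  "minv M = the (mat_inverse M)"

definition mat_vderiv :: "nat \<Rightarrow> (real \<Rightarrow> complex mat) \<Rightarrow> real \<Rightarrow> complex mat" where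
  "mat_vderiv N F x = mat N N (\<lambda>(i,j). vector_derivative (\<lambda>t. F t $$ (i,j)) (at x))"

text \<open>Value at x of P . (T B T^-1), where B = d^2 rho + d (Wtilde rho)' Wtilde^-1 + Ktilde and
  operators act on the right, so P . (T B T^-1) = ((P T) . B) T^-1.\<close>
definition paper_D_action :: "family \<Rightarrow> nat \<Rightarrow> (nat \<Rightarrow> real) \<Rightarrow> (nat \<Rightarrow> real) \<Rightarrow> (nat \<Rightarrow> real)
    \<Rightarrow> pmat \<Rightarrow> real \<Rightarrow> complex mat" where
  "paper_D_action fam N a p q P x =
     (let PT = P * Tpoly N a;
          Phi = mat_vderiv N (\<lambda>t. complex_of_real (rho fam t) \<cdot>\<^sub>m Wtilde fam N p q t) x
                * minv (Wtilde fam N p q x)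
      in (complex_of_real (rho fam x) \<cdot>\<^sub>m eval_pmat (pderiv_mat 2 PT) x
          + eval_pmat (pderiv_mat 1 PT) x * Phi
          + eval_pmat PT x * Ktilde fam N p q)
         * minv (eval_pmat (Tpoly N a) x))"

end

theory Submission
  imports Defs "HOL-Probability.Distributions"
begin

text \<open>
  Write \<open>u\<^sub>k\<close> for integration against the \<open>k\<close>-th scalar weight. If \<open>E\<close> lies in \<open>D(W)\<close>, it preserves
  the orthogonal decomposition of the row polynomials, so it has an adjoint with polynomial values;
  as \<open>T\<close> is unimodular, so does \<open>B = T\<inverse> E T\<close>, now with respect to the diagonal weight. For \<open>i \<noteq> j\<close> the
  adjoint relation for the entry \<open>B\<^sub>i\<^sub>j\<close>, together with the Pearson equation \<open>(\<rho> u)' = v u\<close>, makes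
  polynomial multiples of \<open>u\<^sub>i\<close> and \<open>u\<^sub>j\<close> coincide, so that a rational function would have the
  logarithmic derivative of \<open>w\<^sub>j / w\<^sub>i\<close>; the hypotheses on the parameters exclude this, and \<open>B\<close> is diagonal.

  A diagonal entry preserves degrees and has a degree preserving adjoint, so it is determined by its
  eigenvalues, which are polynomial in \<open>n\<close>. That \<open>E\<close> itself preserves degrees makes the eigenvalues
  of neighbouring entries shifts of each other by one, exactly as for \<open>D\<close>. It remains to see that the first
  eigenvalue sequence is a polynomial in that of the classical operator \<open>\<delta>\<close>. For Hermite and
  Laguerre the latter is linear in \<open>n\<close>. For Jacobi, subtracting a polynomial in \<open>\<delta>\<close> leaves an
  operator whose eigenvalues are odd under the reflection fixing those of \<open>\<delta>\<close>; its square is a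
  polynomial of odd degree in \<open>\<delta>\<close>, so its principal symbol would be a square root of a constant times an odd
  power of \<open>1 - x\<^sup>2\<close>.
\<close>

hide_const (open) Module.smult Module.module LinearCombinations.module_hom

section \<open>Operators with a triangular adjoint\<close>

text \<open>Integration enters only through positivity and the Pearson identity, and the latter is
  proved from moment recursions, so no boundary terms occur. Counted from 0, \<open>A\<close> leads
  from even rows to odd columns; hence A^2 = 0 and T^-1 = I - A x. The obstacle is that T and T^-1
  raise degrees: B = T^-1 E T is not known to preserve them, and only the parity of \<open>A\<close>
  recovers this for its diagonal entries. For an off-diagonal entry, the adjoint is known only to
  have polynomial values; moving derivatives onto the weight would produce denominators
  \<open>\<rho>\<close>, which are avoided by precomposing with a power of \<open>\<rho>\<close>.
  The constants in \<open>Ktilde\<close> are those for which the scalar operator in position c has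
  at degree n + 1 the same eigenvalue as that in position r at degree n whenever A_rc is nonzero:
  the top-degree terms that T creates then cancel in D. In the Jacobi case the condition on
  \<alpha>_j + \<beta>_j makes this possible for all n at once.\<close>

lemma module_smult: "module (smult :: 'a::comm_ring_1 \<Rightarrow> 'a poly \<Rightarrow> 'a poly)"
  by unfold_locales (auto simp: smult_add_right smult_add_left)

lemma module_times: "module ((*) :: 'a::comm_ring_1 \<Rightarrow> 'a \<Rightarrow> 'a)"
  by unfold_locales (auto simp: algebra_simps)

abbreviation poly_linear :: "('a::comm_ring_1 poly \<Rightarrow> 'a poly) \<Rightarrow> bool" where
  "poly_linear \<equiv> module_hom smult smult"

abbreviation poly_functional :: "('a::comm_ring_1 poly \<Rightarrow> 'a) \<Rightarrow> bool" where
  "poly_functional \<equiv> module_hom smult (*)"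

lemma poly_linearI:
  "(\<And>f g. L (f + g) = L f + L g) \<Longrightarrow> (\<And>c f. L (smult c f) = smult c (L f)) \<Longrightarrow> poly_linear L"
  by (simp add: module_hom_iff module_smult)

lemma poly_functionalI:
  "(\<And>f g. u (f + g) = u f + u g) \<Longrightarrow> (\<And>c f. u (smult c f) = c * u f) \<Longrightarrow> poly_functional u"
  by (simp add: module_hom_iff module_smult module_times)

text \<open>A strict degree bound: \<open>below 0\<close> is {0}, which a bound on
  \<open>degree\<close> cannot express since the zero polynomial has degree 0. Inductions on degree
  can thus start from nothing.\<close>

definition below :: "nat \<Rightarrow> 'a::zero poly set" where
  "below n = {f. \<forall>i\<ge>n. coeff f i = 0}"

lemma below_0 [simp]: "below 0 = {0}"
  by (auto simp: below_def poly_eq_iff)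

lemma zero_below [simp]: "0 \<in> below n"
  by (simp add: below_def)

lemma below_Suc_iff: "f \<in> below (Suc n) \<longleftrightarrow> degree f \<le> n"
  by (auto simp: below_def Suc_le_eq coeff_eq_0 intro!: degree_le)

lemma below_SucD: "f \<in> below (Suc n) \<Longrightarrow> coeff f n = 0 \<Longrightarrow> f \<in> below n"
  by (auto simp: below_def) (metis Suc_leI le_neq_implies_less)

lemma below_mono: "m \<le> n \<Longrightarrow> below m \<subseteq> below n"
  by (auto simp: below_def)

lemma ex_below: "\<exists>n. f \<in> below n"
  using below_Suc_iff[of f "degree f"] by blast

lemma below_add: "f \<in> below n \<Longrightarrow> g \<in> below n \<Longrightarrow> f + g \<in> below n"
  for f :: "'a::comm_ring_1 poly" by (simp add: below_def)

lemma below_diff: "f \<in> below n \<Longrightarrow> g \<in> below n \<Longrightarrow> f - g \<in> below n"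
  for f :: "'a::comm_ring_1 poly" by (simp add: below_def)

lemma below_smult: "f \<in> below n \<Longrightarrow> smult c f \<in> below n"
  for f :: "'a::comm_ring_1 poly" by (simp add: below_def)

lemma below_sum: "(\<And>i. i \<in> I \<Longrightarrow> f i \<in> below n) \<Longrightarrow> (\<Sum>i\<in>I. f i) \<in> below n"
  for f :: "'b \<Rightarrow> 'a::comm_ring_1 poly" by (simp add: below_def coeff_sum)

lemma monom_below: "n < m \<Longrightarrow> monom c n \<in> below m"
  by (auto simp: below_def)

lemma below_mult_linear: "f \<in> below n \<Longrightarrow> [:0, c:] * f \<in> below (Suc n)"
  for f :: "'a::comm_ring_1 poly"
  by (auto simp: below_def coeff_pCons split: nat.split)

lemma below_eq_sum: "f \<in> below n \<Longrightarrow> f = (\<Sum>m<n. smult (coeff f m) (monom 1 m))"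
  for f :: "'a::comm_ring_1 poly"
  by (rule poly_eqI) (auto simp: below_def coeff_sum smult_monom if_distrib cong: if_cong)

text \<open>For a definite \<open>u\<close> this says that the orthogonal polynomials of
  \<open>u\<close> are eigenvectors of \<open>L\<close>, without mentioning them: both
  \<open>L\<close> and its adjoint respect the degree filtration.\<close>

definition good_op :: "('a::comm_ring_1 poly \<Rightarrow> 'a) \<Rightarrow> ('a poly \<Rightarrow> 'a poly) \<Rightarrow> bool" where
  "good_op u L \<longleftrightarrow> poly_linear L \<and> (\<forall>n. \<forall>f\<in>below n. L f \<in> below n) \<and>
     (\<forall>n. \<forall>g\<in>below n. \<exists>s\<in>below n. \<forall>f. u (L f * g) = u (f * s))"

text \<open>The diagonal of \<open>L\<close> in the monomial basis; if \<open>L\<close> preserves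
  degree bounds, these are its eigenvalues.\<close>

definition diag_coeff :: "('a::comm_ring_1 poly \<Rightarrow> 'a poly) \<Rightarrow> nat \<Rightarrow> 'a" where
  "diag_coeff L n = coeff (L (monom 1 n)) n"

lemma good_opI:
  assumes "poly_linear L" "\<And>n f. f \<in> below n \<Longrightarrow> L f \<in> below n"
    "\<And>n g. g \<in> below n \<Longrightarrow> \<exists>s\<in>below n. \<forall>f. u (L f * g) = u (f * s)"
  shows "good_op u L"
  using assms by (simp add: good_op_def)

lemma good_op_linear: "good_op u L \<Longrightarrow> poly_linear L"
  and good_op_below: "good_op u L \<Longrightarrow> f \<in> below n \<Longrightarrow> L f \<in> below n"
  and good_op_adjoint: "good_op u L \<Longrightarrow> g \<in> below n \<Longrightarrow> \<exists>s\<in>below n. \<forall>f. u (L f * g) = u (f * s)"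
  by (auto simp: good_op_def)

lemma coeff_linear_below:
  fixes L :: "'a::comm_ring_1 poly \<Rightarrow> 'a poly"
  assumes L: "poly_linear L" and pres: "\<And>f n. f \<in> below n \<Longrightarrow> L f \<in> below n"
    and f: "f \<in> below (Suc n)"
  shows "coeff (L f) n = diag_coeff L n * coeff f n"
proof -
  interpret L: module_hom smult smult L by (rule L)
  define g where "g = f - smult (coeff f n) (monom 1 n)"
  have "g \<in> below n"
    unfolding g_def using f
    by (intro below_SucD[OF below_diff] below_smult monom_below) simp_all
  then have "coeff (L g) n = 0" using pres by (auto simp: below_def)
  moreover have "L f = L g + smult (coeff f n) (L (monom 1 n))"
    by (simp add: g_def L.diff L.scale del: smult_monom)
  ultimately show ?thesis by (simp add: diag_coeff_def)
qed

lemma good_op_coeff: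
  "good_op u L \<Longrightarrow> f \<in> below (Suc n) \<Longrightarrow> coeff (L f) n = diag_coeff L n * coeff f n"
  by (rule coeff_linear_below) (auto simp: good_op_def)

lemma good_op_id: "good_op u (\<lambda>f. f)"
  by (rule good_opI) (auto intro: poly_linearI)

lemma good_op_smult:
  assumes u: "poly_functional u" and L: "good_op u L"
  shows "good_op u (\<lambda>f. smult c (L f))"
proof (rule good_opI)
  interpret u: module_hom smult "(*)" u by (rule u)
  interpret L: module_hom smult smult L using L by (rule good_op_linear)
  show "poly_linear (\<lambda>f. smult c (L f))"
    by (rule poly_linearI) (auto simp: L.add L.scale smult_add_right mult.commute)
  show "smult c (L f) \<in> below n" if "f \<in> below n" for n f
    using that L by (auto intro: below_smult good_op_below)
  show "\<exists>s\<in>below n. \<forall>f. u (smult c (L f) * g) = u (f * s)" if g: "g \<in> below n" for n g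
  proof -
    obtain s where "s \<in> below n" "\<forall>f. u (L f * g) = u (f * s)"
      using good_op_adjoint[OF L g] by blast
    then show ?thesis
      by (intro bexI[of _ "smult c s"]) (auto simp: u.scale below_smult)
  qed
qed

lemma good_op_add:
  assumes u: "poly_functional u" and L: "good_op u L" and M: "good_op u M"
  shows "good_op u (\<lambda>f. L f + M f)"
proof (rule good_opI)
  interpret u: module_hom smult "(*)" u by (rule u)
  interpret L: module_hom smult smult L using L by (rule good_op_linear)
  interpret M: module_hom smult smult M using M by (rule good_op_linear)
  show "poly_linear (\<lambda>f. L f + M f)"
    by (rule poly_linearI) (auto simp: L.add L.scale M.add M.scale smult_add_right)
  show "L f + M f \<in> below n" if "f \<in> below n" for n f
    using that L M by (auto intro: below_add good_op_below)
  show "\<exists>s\<in>below n. \<forall>f. u ((L f + M f) * g) = u (f * s)" if g: "g \<in> below n" for n g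
  proof -
    obtain s where s: "s \<in> below n" "\<forall>f. u (L f * g) = u (f * s)"
      using good_op_adjoint[OF L g] by blast
    obtain t where "t \<in> below n" "\<forall>f. u (M f * g) = u (f * t)"
      using good_op_adjoint[OF M g] by blast
    with s show ?thesis
      by (intro bexI[of _ "s + t"]) (auto simp: u.add algebra_simps below_add)
  qed
qed

lemma good_op_comp:
  assumes L: "good_op u L" and M: "good_op u M"
  shows "good_op u (\<lambda>f. L (M f))"
proof (rule good_opI)
  interpret L: module_hom smult smult L using L by (rule good_op_linear)
  interpret M: module_hom smult smult M using M by (rule good_op_linear)
  show "poly_linear (\<lambda>f. L (M f))"
    by (rule poly_linearI) (auto simp: L.add L.scale M.add M.scale)
  show "L (M f) \<in> below n" if "f \<in> below n" for n f
    using that L M by (auto intro: good_op_below)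
  show "\<exists>s\<in>below n. \<forall>f. u (L (M f) * g) = u (f * s)" if g: "g \<in> below n" for n g
  proof -
    obtain s where s: "s \<in> below n" "\<And>f. u (L f * g) = u (f * s)"
      using good_op_adjoint[OF L g] by blast
    show ?thesis using good_op_adjoint[OF M s(1)] by (simp add: s(2))
  qed
qed

lemma good_op_funpow: "good_op u L \<Longrightarrow> good_op u (L ^^ k)"
proof (induction k)
  case 0
  then show ?case using good_op_id by (simp add: id_def)
next
  case (Suc k)
  then show ?case using good_op_comp[of u L "L ^^ k"] by (simp add: o_def)
qed

lemma good_op_sum:
  assumes u: "poly_functional u" and L: "\<And>i. i \<in> I \<Longrightarrow> good_op u (L i)"
  shows "good_op u (\<lambda>f. \<Sum>i\<in>I. L i f)"
proof -
  have z: "good_op u (\<lambda>f. 0)"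
    using good_op_smult[OF u good_op_id, of 0] by simp
  show ?thesis
    using L
  proof (induction I rule: infinite_finite_induct)
    case (insert x F)
    then show ?case using good_op_add[OF u, of "L x" "\<lambda>f. \<Sum>i\<in>F. L i f"] by simp
  qed (use z in auto)
qed

lemma diag_coeff_comp:
  assumes "good_op u L" "good_op u M"
  shows "diag_coeff (\<lambda>f. L (M f)) n = diag_coeff L n * diag_coeff M n"
  using good_op_coeff[OF assms(1) good_op_below[OF assms(2) monom_below]]
  by (simp add: diag_coeff_def)

lemma diag_coeff_funpow:
  assumes L: "good_op u L"
  shows "diag_coeff (L ^^ k) n = diag_coeff L n ^ k"
proof (induction k)
  case 0
  then show ?case by (simp add: diag_coeff_def)
next
  case (Suc k)
  then show ?case
    using diag_coeff_comp[OF L good_op_funpow[OF L], of k n] by (simp add: o_def)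
qed

definition polyop :: "'a::comm_ring_1 poly \<Rightarrow> ('a poly \<Rightarrow> 'a poly) \<Rightarrow> 'a poly \<Rightarrow> 'a poly" where
  "polyop Q L f = (\<Sum>k\<le>degree Q. smult (coeff Q k) ((L ^^ k) f))"

lemma good_op_polyop: "poly_functional u \<Longrightarrow> good_op u L \<Longrightarrow> good_op u (polyop Q L)"
  using good_op_sum[of u "{..degree Q}" "\<lambda>k f. smult (coeff Q k) ((L ^^ k) f)"]
  by (simp add: polyop_def[abs_def] good_op_smult good_op_funpow)

lemma diag_coeff_polyop:
  assumes "good_op u L"
  shows "diag_coeff (polyop Q L) n = poly Q (diag_coeff L n)"
  using diag_coeff_funpow[OF assms]
  by (simp add: polyop_def poly_altdef diag_coeff_def coeff_sum)

section \<open>Conjugation of coefficients and definite functionals\<close>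

definition pcnj :: "complex poly \<Rightarrow> complex poly" where
  "pcnj = map_poly cnj"

lemma coeff_pcnj [simp]: "coeff (pcnj f) n = cnj (coeff f n)"
  by (simp add: pcnj_def coeff_map_poly)

lemma pcnj_pcnj [simp]: "pcnj (pcnj f) = f"
  by (simp add: poly_eq_iff)

lemma pcnj_0 [simp]: "pcnj 0 = 0"
  by (simp add: poly_eq_iff)

lemma pcnj_add: "pcnj (f + g) = pcnj f + pcnj g"
  by (simp add: poly_eq_iff)

lemma pcnj_mult: "pcnj (f * g) = pcnj f * pcnj g"
  by (simp add: poly_eq_iff coeff_mult)

lemma pcnj_sum: "pcnj (\<Sum>i\<in>I. f i) = (\<Sum>i\<in>I. pcnj (f i))"
  by (simp add: poly_eq_iff coeff_sum)

lemma pcnj_pCons: "pcnj (pCons a f) = pCons (cnj a) (pcnj f)"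
  by (simp add: poly_eq_iff coeff_pCons split: nat.split)

lemma poly_pcnj: "poly (pcnj f) (complex_of_real x) = cnj (poly f (complex_of_real x))"
  by (induction f) (auto simp: pcnj_pCons)

lemma pcnj_below: "pcnj f \<in> below n \<longleftrightarrow> f \<in> below n"
  by (simp add: below_def)

definition definite :: "(complex poly \<Rightarrow> complex) \<Rightarrow> bool" where
  "definite u \<longleftrightarrow> (\<forall>f. u (f * pcnj f) = 0 \<longrightarrow> f = 0)"

lemma definiteD: "definite u \<Longrightarrow> (\<And>f. u (f * g) = 0) \<Longrightarrow> g = 0"
  by (metis definite_def mult.commute)

text \<open>Induction on the degree. With zero eigenvalue \<open>L f\<close> has lower degree, hence
  so has the adjoint image \<open>s\<close> of its conjugate; on lower degrees \<open>L\<close>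
  already vanishes, so testing with the conjugate of \<open>s\<close> gives \<open>s = 0\<close>,
  and definiteness finishes.\<close>

lemma good_op_eq_zero:
  assumes u: "poly_functional u" and pos: "definite u"
    and L: "good_op u L" and diag: "\<And>n. diag_coeff L n = 0"
  shows "L f = 0"
proof -
  interpret L: module_hom smult smult L using L by (rule good_op_linear)
  have "\<forall>f\<in>below n. L f = 0" for n
  proof (induction n)
    case 0
    then show ?case by (simp add: L.zero)
  next
    case (Suc n)
    show ?case
    proof
      fix f :: "complex poly" assume f: "f \<in> below (Suc n)"
      have "coeff (L f) n = 0" using good_op_coeff[OF L f] diag by simp
      then have Lf: "L f \<in> below n" using good_op_below[OF L f] by (rule below_SucD[rotated])
      then obtain s where s: "s \<in> below n" "\<And>g. u (L g * pcnj (L f)) = u (g * s)"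
        using good_op_adjoint[OF L, of "pcnj (L f)" n] by (auto simp: pcnj_below)
      have "u (pcnj s * s) = u (L (pcnj s) * pcnj (L f))" using s by simp
      also have "L (pcnj s) = 0" using Suc s by (simp add: pcnj_below)
      finally have "s = 0"
        using pos module_hom.zero[OF u] by (simp add: definite_def mult.commute)
      then have "u (L f * pcnj (L f)) = 0" using s module_hom.zero[OF u] by simp
      then show "L f = 0" using pos by (simp add: definite_def)
    qed
  qed
  then show ?thesis using ex_below by blast
qed

lemma good_op_eqI:
  assumes u: "poly_functional u" and pos: "definite u"
    and L: "good_op u L" and M: "good_op u M" and diag: "\<And>n. diag_coeff L n = diag_coeff M n"
  shows "L f = M f"
proof -
  have "good_op u (\<lambda>f. L f + smult (- 1) (M f))"
    by (intro good_op_add good_op_smult u L M)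
  then have "L f + smult (- 1) (M f) = 0"
    by (rule good_op_eq_zero[OF u pos]) (use diag in \<open>simp add: diag_coeff_def\<close>)
  then show ?thesis by simp
qed

section \<open>Differential operators and principal symbols\<close>

definition diffop :: "('a::field_char_0 poly \<Rightarrow> 'a poly) \<Rightarrow> bool" where
  "diffop L \<longleftrightarrow> (\<exists>k b. \<forall>f. L f = (\<Sum>j<k. b j * (pderiv ^^ j) f))"

lemma diffopI: "(\<And>f. L f = (\<Sum>j<k. b j * (pderiv ^^ j) f)) \<Longrightarrow> diffop L"
  unfolding diffop_def by blast

lemma diffop_mult_const: "diffop (\<lambda>f. c * f)"
  by (rule diffopI[of _ "\<lambda>_. c" 1]) simp

lemma diffop_zero: "diffop (\<lambda>f. 0)"
  using diffop_mult_const[of 0] by simp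

lemma diffop_add:
  assumes "diffop L" "diffop M"
  shows "diffop (\<lambda>f. L f + M f)"
proof -
  obtain k b where L: "\<And>f. L f = (\<Sum>j<k. b j * (pderiv ^^ j) f)"
    using assms(1) unfolding diffop_def by blast
  obtain l c where M: "\<And>f. M f = (\<Sum>j<l. c j * (pderiv ^^ j) f)"
    using assms(2) unfolding diffop_def by blast
  define m where "m = max k l"
  have "L f = (\<Sum>j<m. (if j < k then b j else 0) * (pderiv ^^ j) f)" for f
    unfolding L by (rule sum.mono_neutral_cong_left) (auto simp: m_def)
  moreover have "M f = (\<Sum>j<m. (if j < l then c j else 0) * (pderiv ^^ j) f)" for f
    unfolding M by (rule sum.mono_neutral_cong_left) (auto simp: m_def)
  ultimately have "L f + M f = (\<Sum>j<m. ((if j < k then b j else 0) + (if j < l then c j else 0)) * (pderiv ^^ j) f)" for f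
    by (simp only: sum.distrib distrib_right)
  then show ?thesis by (rule diffopI)
qed

lemma diffop_sum: "(\<And>i. i \<in> I \<Longrightarrow> diffop (L i)) \<Longrightarrow> diffop (\<lambda>f. \<Sum>i\<in>I. L i f)"
  by (induction I rule: infinite_finite_induct) (auto intro: diffop_zero diffop_add)

lemma diffop_mult:
  assumes "diffop L"
  shows "diffop (\<lambda>f. c * L f)"
proof -
  obtain k b where L: "\<And>f. L f = (\<Sum>j<k. b j * (pderiv ^^ j) f)"
    using assms unfolding diffop_def by blast
  show ?thesis
    by (rule diffopI[of _ "\<lambda>j. c * b j" k]) (simp add: L sum_distrib_left mult.assoc)
qed

lemma pderiv_sum: "pderiv (\<Sum>i\<in>I. f i) = (\<Sum>i\<in>I. pderiv (f i))"
  by (induction I rule: infinite_finite_induct) (auto simp: pderiv_add)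

lemma diffop_pderiv_funpow: "diffop (pderiv ^^ j)"
  by (rule diffopI[of _ "\<lambda>i. if i = j then 1 else 0" "Suc j"]) (simp add: if_distrib[of "\<lambda>x. x * _"] cong: if_cong)

lemma diffop_pderiv:
  assumes "diffop L"
  shows "diffop (\<lambda>f. pderiv (L f))"
proof -
  obtain k b where L: "\<And>f. L f = (\<Sum>j<k. b j * (pderiv ^^ j) f)"
    using assms unfolding diffop_def by blast
  have "pderiv (L f) = (\<Sum>j<k. pderiv (b j) * (pderiv ^^ j) f + b j * (pderiv ^^ Suc j) f)" for f
    unfolding L pderiv_sum by (rule sum.cong) (auto simp: pderiv_mult algebra_simps)
  then show ?thesis
    by (simp only:) (intro diffop_sum diffop_add diffop_mult diffop_pderiv_funpow)
qed

lemma diffop_comp: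
  assumes "diffop L" "diffop M"
  shows "diffop (\<lambda>f. L (M f))"
proof -
  obtain k b where L: "\<And>f. L f = (\<Sum>j<k. b j * (pderiv ^^ j) f)"
    using assms(1) unfolding diffop_def by blast
  have "diffop (\<lambda>f. (pderiv ^^ j) (M f))" for j
    by (induction j) (auto intro: assms diffop_pderiv)
  then show ?thesis unfolding L by (intro diffop_sum diffop_mult)
qed

lemma diffop_funpow: "diffop L \<Longrightarrow> diffop (L ^^ k)"
proof (induction k)
  case 0
  then show ?case using diffop_mult_const[of 1] by (simp add: id_def)
next
  case (Suc k)
  then show ?case using diffop_comp[of L "L ^^ k"] by (simp add: o_def)
qed

lemma diffop_smult: "diffop L \<Longrightarrow> diffop (\<lambda>f. smult c (L f))"
  using diffop_mult[of L "[:c:]"] by simp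

lemma diffop_polyop: "diffop L \<Longrightarrow> diffop (polyop Q L)"
  unfolding polyop_def[abs_def] by (intro diffop_sum diffop_smult diffop_funpow)

lemma pderiv_funpow_add: "(pderiv ^^ j) (f + g) = (pderiv ^^ j) f + (pderiv ^^ j) g"
  by (induction j) (auto simp: pderiv_add)

lemma pderiv_funpow_smult: "(pderiv ^^ j) (smult c f) = smult c ((pderiv ^^ j) f)"
  by (induction j) (auto simp: pderiv_smult)

lemma diffop_linear: "diffop L \<Longrightarrow> poly_linear L"
  unfolding diffop_def
  by (elim exE, intro poly_linearI)
    (auto simp: pderiv_funpow_add pderiv_funpow_smult distrib_left sum.distrib smult_sum2)

section \<open>Eigenvalue sequences of differential operators\<close>

definition falling :: "nat \<Rightarrow> 'a::comm_ring_1 poly" where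
  "falling j = (\<Prod>i<j. [:- of_nat i, 1:])"

lemma pderiv_funpow_monom:
  "(pderiv ^^ j) (monom (1::'a::field_char_0) n) = monom (poly (falling j) (of_nat n)) (n - j)"
proof (induction j)
  case 0
  then show ?case by (simp add: falling_def)
next
  case (Suc j)
  have *: "poly (falling (Suc j)) (of_nat n :: 'a) = poly (falling j) (of_nat n) * (of_nat n - of_nat j)"
    by (simp add: falling_def algebra_simps)
  have "poly (falling j) (of_nat n :: 'a) = 0" if "n < j"
    using that by (auto simp: falling_def poly_prod)
  then show ?case
    unfolding * by (cases "j \<le> n") (auto simp: Suc pderiv_monom mult.commute of_nat_diff)
qed

text \<open>Coefficient \<open>n\<close> of b_j times the j-th derivative of x^n sees only
  coefficient \<open>j\<close> of b_j, times a falling factorial. The latter vanishes for n < j, so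
  one polynomial in \<open>n\<close> covers all degrees.\<close>

lemma diffop_diag_coeff:
  assumes "diffop L"
  shows "\<exists>Q. \<forall>n. diag_coeff L n = poly Q (of_nat n)"
proof -
  obtain k b where L: "\<And>f. L f = (\<Sum>j<k. b j * (pderiv ^^ j) f)"
    using assms unfolding diffop_def by blast
  have "coeff (b j * (pderiv ^^ j) (monom 1 n)) n = coeff (b j) j * poly (falling j) (of_nat n)" for j n
  proof (cases "j \<le> n")
    case True
    then show ?thesis by (simp add: pderiv_funpow_monom mult.commute[of "b j"] coeff_monom_mult)
  next
    case False
    then have "poly (falling j) (of_nat n :: 'a) = 0"
      by (auto simp: falling_def poly_prod)
    then show ?thesis by (simp add: pderiv_funpow_monom)
  qed
  then have "diag_coeff L n = poly (\<Sum>j<k. smult (coeff (b j) j) (falling j)) (of_nat n)" for n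
    by (simp add: diag_coeff_def L coeff_sum poly_sum)
  then show ?thesis by blast
qed

text \<open>The principal symbol, read off from the action on functions vanishing to high order at a point.\<close>

definition has_symbol :: "('a::field_char_0 poly \<Rightarrow> 'a poly) \<Rightarrow> nat \<Rightarrow> 'a poly \<Rightarrow> bool" where
  "has_symbol L k b \<longleftrightarrow> (\<forall>t n g. \<exists>h. L ([:- t, 1:] ^ (n + k) * g) =
     [:- t, 1:] ^ n * (smult (fact (n + k) / fact n) (b * g) + [:- t, 1:] * h))"

lemma has_symbolE:
  assumes "has_symbol L k b"
  obtains h where "L ([:- t, 1:] ^ (n + k) * g) =
     [:- t, 1:] ^ n * (smult (fact (n + k) / fact n) (b * g) + [:- t, 1:] * h)"
  using assms unfolding has_symbol_def by blast

lemma has_symbol_mult_const: "has_symbol (\<lambda>f. c * f) 0 c"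
  unfolding has_symbol_def by (intro allI exI[of _ 0]) (simp add: algebra_simps)

lemma has_symbol_pderiv: "has_symbol pderiv 1 1"
proof -
  have "pderiv ([:- t, 1:] ^ (n + 1) * g) =
     [:- t, 1:] ^ n * (smult (fact (n + 1) / fact n) (1 * g) + [:- t, 1:] * pderiv g)" for t :: 'a and n g
  proof -
    have "pderiv ([:- t, 1:] ^ (n + 1)) = smult (of_nat (Suc n)) ([:- t, 1:] ^ n)"
      using pderiv_power_Suc[of "[:- t, 1:]" n] by (simp add: pderiv_pCons)
    moreover have "fact (n + 1) / fact n = (of_nat (Suc n) :: 'a)" by simp
    ultimately show ?thesis
      by (simp only: pderiv_mult) (simp add: algebra_simps smult_add_left del: mult_pCons_left mult_pCons_right)
  qed
  then show ?thesis unfolding has_symbol_def by blast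
qed

text \<open>The factorial ratios in \<open>has_symbol\<close> telescope under composition, so that
  the symbols simply multiply.\<close>

lemma has_symbol_comp:
  assumes L: "has_symbol L k b" and M: "has_symbol M l c" and lin: "poly_linear L"
  shows "has_symbol (\<lambda>f. L (M f)) (k + l) (b * c)"
  unfolding has_symbol_def
proof (intro allI)
  fix t :: 'a and n and g :: "'a poly"
  interpret L: module_hom smult smult L by (rule lin)
  let ?x = "[:- t, 1:]"
  obtain h where h: "M (?x ^ ((n + k) + l) * g) = ?x ^ (n + k) * (smult (fact (n + k + l) / fact (n + k)) (c * g) + ?x * h)"
    using M by (rule has_symbolE)
  obtain h' where h': "L (?x ^ (n + k) * (smult (fact (n + k + l) / fact (n + k)) (c * g) + ?x * h)) =
     ?x ^ n * (smult (fact (n + k) / fact n) (b * (smult (fact (n + k + l) / fact (n + k)) (c * g) + ?x * h)) + ?x * h')"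
    using L by (rule has_symbolE)
  have "L (M (?x ^ (n + (k + l)) * g)) = ?x ^ n * (smult (fact (n + (k + l)) / fact n) ((b * c) * g)
      + ?x * (smult (fact (n + k) / fact n) (b * h) + h'))"
    using h h' by (simp add: algebra_simps smult_add_right del: mult_pCons_left mult_pCons_right)
  then show "\<exists>h. L (M (?x ^ (n + (k + l)) * g)) = ?x ^ n * (smult (fact (n + (k + l)) / fact n) ((b * c) * g) + ?x * h)"
    by blast
qed

lemma has_symbol_add:
  assumes L: "has_symbol L k b" and M: "has_symbol M k c"
  shows "has_symbol (\<lambda>f. L f + M f) k (b + c)"
  unfolding has_symbol_def
proof (intro allI)
  fix t :: 'a and n and g :: "'a poly"
  let ?x = "[:- t, 1:]"
  obtain h where h: "L (?x ^ (n + k) * g) = ?x ^ n * (smult (fact (n + k) / fact n) (b * g) + ?x * h)"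
    using L by (rule has_symbolE)
  obtain h' where h': "M (?x ^ (n + k) * g) = ?x ^ n * (smult (fact (n + k) / fact n) (c * g) + ?x * h')"
    using M by (rule has_symbolE)
  have "L (?x ^ (n + k) * g) + M (?x ^ (n + k) * g) = ?x ^ n * (smult (fact (n + k) / fact n) ((b + c) * g) + ?x * (h + h'))"
    unfolding h h' by (simp add: algebra_simps smult_add_right del: mult_pCons_left mult_pCons_right)
  then show "\<exists>h. L (?x ^ (n + k) * g) + M (?x ^ (n + k) * g) = ?x ^ n * (smult (fact (n + k) / fact n) ((b + c) * g) + ?x * h)"
    by blast
qed

text \<open>A spare factor x - t can be moved into \<open>g\<close>, so an operator seen at a higher
  order than its own has symbol 0. Lower-order terms are discarded this way.\<close>

lemma has_symbol_raise_Suc: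
  assumes L: "has_symbol L k b"
  shows "has_symbol L (Suc k) 0"
  unfolding has_symbol_def
proof (intro allI)
  fix t :: 'a and n and g :: "'a poly"
  let ?x = "[:- t, 1:]"
  obtain h where h: "L (?x ^ (n + k) * (?x * g)) = ?x ^ n * (smult (fact (n + k) / fact n) (b * (?x * g)) + ?x * h)"
    using L by (rule has_symbolE)
  have "L (?x ^ (n + Suc k) * g) = ?x ^ n * (smult (fact (n + Suc k) / fact n) (0 * g) + ?x * (smult (fact (n + k) / fact n) (b * g) + h))"
    using h by (simp add: algebra_simps smult_add_right del: mult_pCons_left mult_pCons_right)
  then show "\<exists>h. L (?x ^ (n + Suc k) * g) = ?x ^ n * (smult (fact (n + Suc k) / fact n) (0 * g) + ?x * h)"
    by blast
qed

lemma has_symbol_raise: "k < l \<Longrightarrow> has_symbol L k b \<Longrightarrow> has_symbol L l 0"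
proof (induction l)
  case (Suc l)
  then show ?case by (cases "k = l") (auto intro: has_symbol_raise_Suc)
qed simp

lemma has_symbol_sum:
  "finite I \<Longrightarrow> (\<And>i. i \<in> I \<Longrightarrow> has_symbol (L i) k 0) \<Longrightarrow> has_symbol (\<lambda>f. \<Sum>i\<in>I. L i f) k 0"
proof (induction I rule: finite_induct)
  case empty
  then show ?case unfolding has_symbol_def by (intro allI exI[of _ 0]) simp
next
  case (insert x F)
  then show ?case using has_symbol_add[of "L x" k 0 "\<lambda>f. \<Sum>i\<in>F. L i f" 0] by simp
qed

text \<open>Taking n = 0, g = 1 and evaluating at \<open>t\<close> reads off k! times the value of
  the symbol at \<open>t\<close>.\<close>

lemma has_symbol_unique_0:
  assumes L: "has_symbol L k b" "has_symbol L k c"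
  shows "b = c"
proof -
  have "poly b t = poly c t" for t
  proof -
    let ?x = "[:- t, 1:]"
    obtain h where h: "L (?x ^ (0 + k) * 1) = ?x ^ 0 * (smult (fact (0 + k) / fact 0) (b * 1) + ?x * h)"
      using L(1) by (rule has_symbolE)
    obtain h' where h': "L (?x ^ (0 + k) * 1) = ?x ^ 0 * (smult (fact (0 + k) / fact 0) (c * 1) + ?x * h')"
      using L(2) by (rule has_symbolE)
    have "smult (fact k) b + ?x * h = smult (fact k) c + ?x * h'"
      using h h' by simp
    then have "poly (smult (fact k) b + ?x * h) t = poly (smult (fact k) c + ?x * h') t" by simp
    then show ?thesis by simp
  qed
  then show ?thesis by (simp add: poly_eq_poly_eq_iff[symmetric] ext)
qed

lemma has_symbol_unique:
  assumes L: "has_symbol L k b" "has_symbol L l c" and "b \<noteq> 0" "c \<noteq> 0"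
  shows "k = l \<and> b = c"
  using assms has_symbol_unique_0 has_symbol_raise by (metis linorder_neqE_nat)

lemma has_symbol_funpow:
  assumes L: "has_symbol L k b" and lin: "poly_linear L"
  shows "has_symbol (L ^^ n) (n * k) (b ^ n)"
proof (induction n)
  case 0
  then show ?case using has_symbol_mult_const[of 1] by (simp add: id_def)
next
  case (Suc n)
  then show ?case using has_symbol_comp[OF L Suc lin] by (simp add: o_def)
qed

lemma has_symbol_mult: "has_symbol L k b \<Longrightarrow> has_symbol (\<lambda>f. c * L f) k (c * b)"
  using has_symbol_comp[OF has_symbol_mult_const[of c], of L k b] by (simp add: poly_linearI algebra_simps)

lemma has_symbol_smult: "has_symbol L k b \<Longrightarrow> has_symbol (\<lambda>f. smult c (L f)) k (smult c b)"
  using has_symbol_mult[of L k b "[:c:]"] by simp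

lemma pderiv_linear: "poly_linear pderiv"
  by (simp add: poly_linearI pderiv_add pderiv_smult)

lemma has_symbol_sum_lead:
  fixes m :: nat
  assumes "\<And>j. j \<le> m \<Longrightarrow> has_symbol (L j) (d j) (b j)" "\<And>j. j < m \<Longrightarrow> d j < d m"
  shows "has_symbol (\<lambda>f. \<Sum>j\<le>m. L j f) (d m) (b m)"
proof -
  have "has_symbol (L j) (d m) 0" if "j < m" for j
    by (rule has_symbol_raise[OF assms(2)[OF that] assms(1)]) (use that in simp)
  then have "has_symbol (\<lambda>f. \<Sum>j<m. L j f) (d m) 0"
    by (intro has_symbol_sum) auto
  then have "has_symbol (\<lambda>f. (\<Sum>j<m. L j f) + L m f) (d m) (0 + b m)"
    using assms(1)[of m] by (intro has_symbol_add) auto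
  then show ?thesis by (simp add: lessThan_Suc_atMost[symmetric])
qed

lemma has_symbol_polyop:
  assumes L: "has_symbol L k b" and lin: "poly_linear L" and "k > 0"
  shows "has_symbol (polyop Q L) (degree Q * k) (smult (lead_coeff Q) (b ^ degree Q))"
  unfolding polyop_def[abs_def]
  by (rule has_symbol_sum_lead[where d = "\<lambda>j. j * k" and b = "\<lambda>j. smult (coeff Q j) (b ^ j)"])
    (use assms in \<open>auto intro!: has_symbol_smult has_symbol_funpow\<close>)

text \<open>The symbol is the last nonzero coefficient; \<open>L f \<noteq> 0\<close> ensures that
  there is one.\<close>

lemma diffop_has_symbol:
  assumes "diffop L" "L f \<noteq> 0"
  shows "\<exists>k b. b \<noteq> 0 \<and> has_symbol L k b"
proof -
  obtain k b where L: "\<And>f. L f = (\<Sum>j<k. b j * (pderiv ^^ j) f)"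
    using assms unfolding diffop_def by blast
  have "\<exists>j<k. b j \<noteq> 0"
  proof (rule ccontr)
    assume "\<not> (\<exists>j<k. b j \<noteq> 0)"
    then have "L f = 0" unfolding L by (intro sum.neutral) auto
    with assms(2) show False by simp
  qed
  define J where "J = {j. j < k \<and> b j \<noteq> 0}"
  define m where "m = Max J"
  have fin: "finite J" "J \<noteq> {}" using \<open>\<exists>j<k. b j \<noteq> 0\<close> by (auto simp: J_def)
  then have m: "m \<in> J" "\<And>j. j < k \<Longrightarrow> m < j \<Longrightarrow> b j = 0"
    unfolding m_def using Max_in[OF fin] Max_ge[OF fin(1)] by (auto simp: J_def linorder_not_le[symmetric])
  have eq: "L = (\<lambda>f. \<Sum>j\<le>m. b j * (pderiv ^^ j) f)"
  proof
    fix f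
    have "m < k" using m(1) by (simp add: J_def)
    then show "L f = (\<Sum>j\<le>m. b j * (pderiv ^^ j) f)"
      unfolding L using m(2) by (intro sum.mono_neutral_right) auto
  qed
  have "has_symbol (\<lambda>f. \<Sum>j\<le>m. b j * (pderiv ^^ j) f) m (b m)"
  proof (rule has_symbol_sum_lead[where d = "\<lambda>j. j"])
    fix j
    have "has_symbol (pderiv ^^ j) j (1 :: 'a poly)"
      using has_symbol_funpow[OF has_symbol_pderiv pderiv_linear, of j] by simp
    from has_symbol_mult[OF this] show "has_symbol (\<lambda>f. b j * (pderiv ^^ j) f) j (b j)" by simp
  qed
  then have "has_symbol L m (b m)" using eq by simp
  with m show ?thesis by (auto simp: J_def)
qed

section \<open>Pearson functionals\<close>

text \<open>The weak form of (\<rho> u)' = v u. The degree bounds are what makes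
  \<open>bochner\<close> preserve degrees.\<close>

locale pearson =
  fixes u :: "complex poly \<Rightarrow> complex" and \<rho> v :: "complex poly"
  assumes u_linear: "poly_functional u" and u_definite: "definite u"
    and pearson: "u (\<rho> * pderiv f + v * f) = 0"
    and degree_\<rho>: "degree \<rho> \<le> 2" and degree_v: "degree v \<le> 1"
begin

sublocale u: module_hom smult "(*)" u
  by (rule u_linear)

text \<open>In terms of a weight w this is (\<rho> w f')' / w, the second-order operator of a
  classical family.\<close>

definition bochner :: "complex poly \<Rightarrow> complex poly" where
  "bochner f = \<rho> * pderiv (pderiv f) + v * pderiv f"

lemma by_parts: "u (\<rho> * pderiv f * g) = - u (f * (v * g + \<rho> * pderiv g))"
proof -
  have "u (\<rho> * pderiv f * g) + u (f * (v * g + \<rho> * pderiv g)) = u (\<rho> * pderiv (f * g) + v * (f * g))"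
    by (simp add: u.add[symmetric] pderiv_mult algebra_simps)
  then show ?thesis using pearson by (simp add: eq_neg_iff_add_eq_0)
qed

text \<open>Both sides equal \<open>- u (\<rho> * pderiv f * pderiv g)\<close>, which is symmetric
  in \<open>f\<close> and \<open>g\<close>.\<close>

lemma bochner_symmetric: "u (bochner f * g) = u (f * bochner g)"
proof -
  have "u (bochner f * g) = - u (\<rho> * pderiv f * pderiv g)" for f g
  proof -
    have *: "bochner f * g = \<rho> * pderiv (pderiv f) * g + pderiv f * (v * g)"
      by (simp add: bochner_def algebra_simps)
    have **: "pderiv f * (v * g + \<rho> * pderiv g) = pderiv f * (v * g) + \<rho> * pderiv f * pderiv g"
      by (simp add: algebra_simps)
    show ?thesis using by_parts[of "pderiv f" g] unfolding * ** u.add by simp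
  qed
  from this[of f g] this[of g f] show ?thesis by (simp add: mult.commute mult.left_commute)
qed

lemma bochner_linear: "poly_linear bochner"
  by (rule poly_linearI) (auto simp: bochner_def pderiv_add pderiv_smult algebra_simps smult_add_right)

lemma diffop_bochner: "diffop bochner"
  unfolding bochner_def[abs_def]
  by (intro diffop_add diffop_mult diffop_pderiv diffop_mult_const[of 1, simplified])

lemma coeff_bochner:
  assumes "f \<in> below (Suc n)"
  shows "coeff (bochner f) n = (coeff \<rho> 2 * of_nat n * (of_nat n - 1) + coeff v 1 * of_nat n) * coeff f n"
proof -
  have \<rho>: "\<rho> = [:coeff \<rho> 0, coeff \<rho> 1, coeff \<rho> 2:]"
    by (rule poly_eqI) (use degree_\<rho> in \<open>auto simp: coeff_pCons coeff_eq_0 numeral_2_eq_2 split: nat.split\<close>)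
  have v: "v = [:coeff v 0, coeff v 1:]"
    by (rule poly_eqI) (use degree_v in \<open>auto simp: coeff_pCons coeff_eq_0 split: nat.split\<close>)
  have z: "coeff f (Suc n) = 0" "coeff f (Suc (Suc n)) = 0"
    using assms by (auto simp: below_def)
  show ?thesis
  proof (cases n)
    case 0
    show ?thesis
      unfolding bochner_def by (subst \<rho>, subst v) (use z 0 in \<open>simp add: coeff_pderiv\<close>)
  next
    case (Suc m)
    show ?thesis
      unfolding bochner_def
      by (subst \<rho>, subst v)
        (use z Suc in \<open>cases m; simp add: coeff_pderiv algebra_simps numeral_2_eq_2\<close>)
  qed
qed

lemma bochner_below: "f \<in> below n \<Longrightarrow> bochner f \<in> below n"
proof (cases n)
  case 0
  then show "f \<in> below n \<Longrightarrow> bochner f \<in> below n" by (simp add: bochner_def)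
next
  case (Suc m)
  assume f: "f \<in> below n"
  have "coeff (bochner f) i = 0" if "i \<ge> n" for i
  proof -
    have "f \<in> below (Suc i)" using below_mono[of n "Suc i"] that f by auto
    moreover have "coeff f i = 0" using f that by (auto simp: below_def)
    ultimately show ?thesis using coeff_bochner by simp
  qed
  then show ?thesis by (simp add: below_def)
qed

lemma good_op_bochner: "good_op u bochner"
  by (rule good_opI) (auto intro: bochner_linear bochner_below simp: bochner_symmetric)

text \<open>Integration by parts is available only for a derivative accompanied by a factor
  \<open>\<rho>\<close>. Feeding in \<open>\<rho> ^ M * f\<close> with \<open>M\<close> at least the
  number of derivatives supplies one factor for each of them.\<close>

lemma diffop_adjoint:
  assumes "diffop L"
  shows "\<exists>M. \<forall>g. \<exists>R. \<forall>f. u (L (\<rho> ^ M * f) * g) = u (f * R)"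
proof -
  obtain k b where L: "\<And>f. L f = (\<Sum>j<k. b j * (pderiv ^^ j) f)"
    using assms unfolding diffop_def by blast
  have ex: "\<exists>R. \<forall>f. u (h * (pderiv ^^ j) (\<rho> ^ M * f)) = u (f * R)" if "j \<le> M" for j M h
    using that
  proof (induction j arbitrary: M)
    case 0
    then show ?case by (intro exI[of _ "h * \<rho> ^ M"]) (simp add: algebra_simps)
  next
    case (Suc j)
    then obtain M' where M: "M = Suc M'" "j \<le> M'" by (cases M) auto
    with Suc.IH obtain R where R: "\<And>f. u (h * (pderiv ^^ j) (\<rho> ^ M' * f)) = u (f * R)" by blast
    have "u (h * (pderiv ^^ Suc j) (\<rho> ^ M * f)) =
      u (f * (smult (of_nat M) (pderiv \<rho>) * R - (v * R + \<rho> * pderiv R)))" for f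
    proof -
      \<comment> \<open>One power of \<open>\<rho>\<close> is spent here: the term with
        \<open>pderiv f\<close> keeps a factor \<open>\<rho>\<close> of its own, so
        \<open>by_parts\<close> can remove this last derivative.\<close>
      have "pderiv (\<rho> ^ M * f) = \<rho> ^ M' * (smult (of_nat M) (pderiv \<rho>) * f + \<rho> * pderiv f)"
        unfolding M pderiv_mult pderiv_power_Suc by (simp add: algebra_simps)
      then have "u (h * (pderiv ^^ Suc j) (\<rho> ^ M * f)) =
          u ((smult (of_nat M) (pderiv \<rho>) * f + \<rho> * pderiv f) * R)"
        by (simp add: funpow_swap1 R)
      also have "\<dots> = u (smult (of_nat M) (pderiv \<rho>) * f * R) + u (\<rho> * pderiv f * R)"
        by (simp only: distrib_right u.add)
      also have "\<dots> = u (f * (smult (of_nat M) (pderiv \<rho>) * R - (v * R + \<rho> * pderiv R)))"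
        unfolding by_parts by (simp add: right_diff_distrib u.diff mult_ac)
      finally show ?thesis .
    qed
    then show ?case by blast
  qed
  have "\<exists>R. \<forall>f. u (L (\<rho> ^ k * f) * g) = u (f * R)" for g
  proof -
    have "\<exists>R. \<forall>f. u (g * b j * (pderiv ^^ j) (\<rho> ^ k * f)) = u (f * R)" if "j < k" for j
      using ex[of j k "g * b j"] that by simp
    then obtain R where R: "\<And>j f. j < k \<Longrightarrow> u (g * b j * (pderiv ^^ j) (\<rho> ^ k * f)) = u (f * R j)"
      by metis
    have "u (L (\<rho> ^ k * f) * g) = u (f * (\<Sum>j<k. R j))" for f
      unfolding L sum_distrib_left sum_distrib_right u.sum
      by (intro sum.cong) (auto simp: R[symmetric] mult_ac)
    then show ?thesis by blast
  qed
  then show ?thesis by blast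
qed

end

section \<open>Quotients of Pearson functionals, and eigenvalues as polynomials in the classical
  ones\<close>

text \<open>Two Pearson functionals that agree up to polynomial factors \<open>R\<close>, \<open>S\<close> force
  \<open>(S / R)' / (S / R) = (v\<^sub>1 - v\<^sub>2) / \<rho>\<close>.\<close>

lemma pearson_proportional:
  assumes u1: "pearson u1 \<rho> v1" and u2: "pearson u2 \<rho> v2"
    and eq: "\<And>f. u1 (f * R) = u2 (f * S)"
  shows "\<rho> * (R * pderiv S - S * pderiv R) = R * S * (v1 - v2)"
proof -
  interpret u1: pearson u1 \<rho> v1 by (rule u1)
  interpret u2: pearson u2 \<rho> v2 by (rule u2)
  let ?X = "v2 * S + \<rho> * pderiv S" and ?Y = "v1 * R + \<rho> * pderiv R"
  \<comment> \<open>Testing the hypothesis with \<open>\<rho> * pderiv f\<close> gives a second pair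
    of coinciding multiples, which is then cross-multiplied with the first.\<close>
  have d: "u1 (f * ?Y) = u2 (f * ?X)" for f
    using eq[of "\<rho> * pderiv f"] by (simp add: u1.by_parts u2.by_parts)
  have "u1 (f * (R * ?X - S * ?Y)) = 0" for f
  proof -
    have "u1 (f * (R * ?X - S * ?Y)) = u1 (f * ?X * R) - u1 (f * S * ?Y)"
      by (simp add: right_diff_distrib u1.u.diff mult_ac)
    then show ?thesis using eq[of "f * ?X"] d[of "f * S"] by (simp add: mult_ac)
  qed
  then have "R * ?X - S * ?Y = 0" by (rule definiteD[OF u1.u_definite])
  then show ?thesis by (simp add: algebra_simps)
qed

text \<open>S / R would be a multiple of e^(c x). Differentiation lowers degrees, so the left side
  has no coefficient at \<open>degree R + degree S\<close>, where the right side has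
  \<open>c\<close> times the product of the leading coefficients.\<close>

lemma no_exponential_quotient:
  fixes R S :: "'a::field_char_0 poly"
  assumes "R * pderiv S - S * pderiv R = smult c (R * S)" "R \<noteq> 0" "S \<noteq> 0"
  shows "c = 0"
proof -
  have *: "coeff (P * pderiv Q) (degree P + degree Q) = 0" for P Q :: "'a poly"
  proof (cases "degree Q = 0")
    case True
    then have "pderiv Q = 0" by (simp add: pderiv_eq_0_iff)
    then show ?thesis by simp
  next
    case False
    have "degree (P * pderiv Q) \<le> degree P + (degree Q - 1)"
      using degree_mult_le[of P "pderiv Q"] by (simp add: degree_pderiv)
    with False show ?thesis by (intro coeff_eq_0) simp
  qed
  have "coeff (R * pderiv S - S * pderiv R) (degree R + degree S) = 0"
    using *[of R S] *[of S R] by (simp add: add.commute)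
  then have "c * (lead_coeff R * lead_coeff S) = 0"
    unfolding assms(1) by (simp add: coeff_mult_degree_sum)
  with assms show ?thesis by simp
qed

text \<open>A comparison of residues at \<open>t\<close> in (S/R)' / (S/R) = \<tau> / ((x - t)
  \<sigma>), cleared of denominators: the residue on the left is the order of \<open>S\<close> minus
  that of \<open>R\<close>.\<close>

lemma power_quotient_order:
  fixes R S :: "'a::field_char_0 poly"
  assumes eq: "[:- t, 1:] * \<sigma> * (R * pderiv S - S * pderiv R) = R * S * \<tau>" and nz: "R \<noteq> 0" "S \<noteq> 0"
  shows "poly \<tau> t = poly \<sigma> t * (of_nat (Polynomial.order t S) - of_nat (Polynomial.order t R))"
proof -
  let ?x = "[:- t, 1:]"
  define a b where "a = Polynomial.order t R" and "b = Polynomial.order t S"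
  obtain R1 where R: "R = ?x ^ a * R1" "\<not> ?x dvd R1"
    using order_decomp[OF nz(1)] unfolding a_def by blast
  obtain S1 where S: "S = ?x ^ b * S1" "\<not> ?x dvd S1"
    using order_decomp[OF nz(2)] unfolding b_def by blast
  have d: "?x * pderiv (?x ^ n * F) = ?x ^ n * (smult (of_nat n) F + ?x * pderiv F)" for n F
  proof (cases n)
    case (Suc m)
    have "pderiv (?x ^ n) = smult (of_nat n) (?x ^ m)"
      unfolding Suc pderiv_power_Suc by (simp add: pderiv_pCons)
    then show ?thesis
      unfolding pderiv_mult by (simp add: Suc algebra_simps del: mult_pCons_left mult_pCons_right)
  qed simp
  have "?x ^ (a + b) * (\<sigma> * (R1 * (smult (of_nat b) S1 + ?x * pderiv S1) - S1 * (smult (of_nat a) R1 + ?x * pderiv R1)))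
    = \<sigma> * (?x ^ a * R1 * (?x * pderiv (?x ^ b * S1)) - ?x ^ b * S1 * (?x * pderiv (?x ^ a * R1)))"
    unfolding d by (simp add: power_add algebra_simps del: mult_pCons_left mult_pCons_right)
  also have "\<dots> = ?x * \<sigma> * (R * pderiv S - S * pderiv R)"
    unfolding R(1)[symmetric] S(1)[symmetric] by (simp add: algebra_simps del: mult_pCons_left mult_pCons_right)
  also have "\<dots> = ?x ^ (a + b) * (R1 * S1 * \<tau>)"
    unfolding eq by (simp add: R(1) S(1) power_add mult_ac del: mult_pCons_left mult_pCons_right)
  finally have "\<sigma> * (R1 * (smult (of_nat b) S1 + ?x * pderiv S1) - S1 * (smult (of_nat a) R1 + ?x * pderiv R1)) = R1 * S1 * \<tau>"
    by (simp del: mult_pCons_left mult_pCons_right)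
  from arg_cong[OF this, of "\<lambda>p. poly p t"]
  have "poly R1 t * poly S1 t * (poly \<sigma> t * (of_nat b - of_nat a)) = poly R1 t * poly S1 t * poly \<tau> t"
    by (simp add: algebra_simps)
  moreover have "poly R1 t \<noteq> 0" "poly S1 t \<noteq> 0" using R(2) S(2) by (simp_all add: poly_eq_0_iff_dvd)
  ultimately show ?thesis by (simp add: a_def b_def)
qed

text \<open>\<open>\<nu>\<close> is invariant under the reflection x -> - c - x while 2 x + c
  changes sign, so these are the even and odd parts of \<open>P\<close>.\<close>

lemma poly_reflection_decomp:
  fixes P :: "'a::field_char_0 poly" and c :: 'a
  defines "\<nu> \<equiv> \<lambda>x. - x * (x + c)"
  shows "\<exists>Q1 Q2. \<forall>x. poly P x = poly Q1 (\<nu> x) + (2 * x + c) * poly Q2 (\<nu> x)"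
proof (induction P)
  case 0
  then show ?case by (intro exI[of _ 0]) simp
next
  case (pCons a P)
  then obtain Q1 Q2 where Q: "\<And>x. poly P x = poly Q1 (\<nu> x) + (2 * x + c) * poly Q2 (\<nu> x)" by blast
  \<comment> \<open>Multiplication by x is rewritten with x = ((2 x + c) - c) / 2, and the square of
    2 x + c is c^2 - 4 \<open>\<nu> x\<close>.\<close>
  define R1 where "R1 = [:a:] - smult (c / 2) Q1 + smult (1 / 2) ([:c ^ 2, -4:] * Q2)"
  define R2 where "R2 = smult (1 / 2) Q1 - smult (c / 2) Q2"
  have "poly (pCons a P) x = poly R1 (\<nu> x) + (2 * x + c) * poly R2 (\<nu> x)" for x
    unfolding R1_def R2_def
    by (simp add: Q) (simp add: \<nu>_def field_simps power2_eq_square)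
  then show ?case by blast
qed

lemma (in pearson) diag_coeff_bochner:
  "diag_coeff bochner n = coeff \<rho> 2 * of_nat n * (of_nat n - 1) + coeff v 1 * of_nat n"
  using coeff_bochner[OF monom_below[of n "Suc n" 1]] by (simp add: diag_coeff_def)

text \<open>The eigenvalue of \<open>bochner\<close> is here a nonzero multiple of \<open>n\<close>,
  so a polynomial in \<open>n\<close> only needs its variable rescaled.\<close>

lemma (in pearson) diag_coeff_polynomial_linear:
  assumes L: "diffop L" and \<rho>: "coeff \<rho> 2 = 0" and v: "coeff v 1 \<noteq> 0"
  shows "\<exists>Q. \<forall>n. diag_coeff L n = poly Q (diag_coeff bochner n)"
proof -
  obtain Q where Q: "\<And>n. diag_coeff L n = poly Q (of_nat n)" using diffop_diag_coeff[OF L] by blast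
  have "diag_coeff L n = poly (Q \<circ>\<^sub>p [:0, 1 / coeff v 1:]) (diag_coeff bochner n)" for n
    using v \<rho> by (simp add: Q poly_pcompose diag_coeff_bochner)
  then show ?thesis by blast
qed

text \<open>The diagonal part of \<open>L\<close> that is odd under the reflection fixing the eigenvalues of \<open>bochner\<close>
  would square to an operator with principal symbol a constant times an odd power of \<open>\<rho>\<close>,
  which is not a square.\<close>

lemma (in pearson) diag_coeff_polynomial_jacobi:
  assumes L: "diffop L" "good_op u L" and \<rho>: "\<rho> = [:1, 0, -1:]"
  shows "\<exists>Q. \<forall>n. diag_coeff L n = poly Q (diag_coeff bochner n)"
proof -
  \<comment> \<open>Chosen so that the n-th eigenvalue of \<open>bochner\<close> is - n (n + c); for
    a Jacobi weight c = \<alpha> + \<beta> + 1.\<close>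
  define c where "c = - 1 - coeff v 1"
  have diag: "diag_coeff bochner n = - of_nat n * (of_nat n + c)" for n
  proof -
    have "coeff \<rho> 2 = - 1" by (simp add: \<rho> numeral_2_eq_2)
    then show ?thesis by (simp add: diag_coeff_bochner c_def algebra_simps)
  qed
  obtain P where P: "\<And>n. diag_coeff L n = poly P (of_nat n)" using diffop_diag_coeff[OF L(1)] by blast
  obtain Q1 Q2 where Q: "\<And>x. poly P x = poly Q1 (- x * (x + c)) + (2 * x + c) * poly Q2 (- x * (x + c))"
    using poly_reflection_decomp[of P c] by blast
  define C where "C = (\<lambda>f. L f + smult (- 1) (polyop Q1 bochner f))"
  have C_diffop: "diffop C"
    unfolding C_def by (intro diffop_add diffop_smult diffop_polyop diffop_bochner L)
  have C_good: "good_op u C"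
    unfolding C_def by (intro good_op_add good_op_smult good_op_polyop good_op_bochner L u_linear)
  have "diag_coeff C n = diag_coeff L n - diag_coeff (polyop Q1 bochner) n" for n
    by (simp add: C_def diag_coeff_def)
  then have C_diag: "diag_coeff C n = (2 * of_nat n + c) * poly Q2 (diag_coeff bochner n)" for n
    by (simp add: diag_coeff_polyop[OF good_op_bochner] P Q diag)
  have "Q2 = 0"
  proof (rule ccontr)
    assume Q2: "Q2 \<noteq> 0"
    \<comment> \<open>The square of 2 n + c is c^2 minus 4 times the eigenvalue of
      \<open>bochner\<close>; this linear factor is what makes the degree of \<open>G\<close>
      odd.\<close>
    define G where "G = [:c ^ 2, -4:] * Q2 ^ 2"
    have deg: "degree G = 2 * degree Q2 + 1"
      using Q2 by (simp add: G_def degree_mult_eq degree_power_eq del: mult_pCons_left)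
    then have "G \<noteq> 0" by auto
    then have G: "lead_coeff G \<noteq> 0" by simp
    have "C (C f) = polyop G bochner f" for f
    proof (rule good_op_eqI[where L = "\<lambda>f. C (C f)", OF u_linear u_definite])
      show "good_op u (\<lambda>f. C (C f))" by (rule good_op_comp[OF C_good C_good])
      show "good_op u (polyop G bochner)" by (intro good_op_polyop good_op_bochner u_linear)
      show "diag_coeff (\<lambda>f. C (C f)) n = diag_coeff (polyop G bochner) n" for n
      proof -
        let ?d = "diag_coeff bochner n"
        have sq: "(2 * of_nat n + c) * (2 * of_nat n + c) = c ^ 2 - 4 * ?d"
          unfolding diag power2_eq_square by (simp add: ring_distribs)
        have "diag_coeff (\<lambda>f. C (C f)) n = (2 * of_nat n + c) * (2 * of_nat n + c) * poly Q2 ?d ^ 2"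
          unfolding diag_coeff_comp[OF C_good C_good] C_diag power2_eq_square by (simp only: mult_ac)
        also have "\<dots> = poly G ?d"
          unfolding sq G_def poly_mult poly_power by simp
        finally show ?thesis by (simp add: diag_coeff_polyop[OF good_op_bochner])
      qed
    qed
    then have CC: "(\<lambda>f. C (C f)) = polyop G bochner" by auto
    have "has_symbol (pderiv ^^ 2) (2 * 1) (1 ^ 2 :: complex poly)"
      by (rule has_symbol_funpow[OF has_symbol_pderiv pderiv_linear])
    then have "has_symbol (\<lambda>f. \<rho> * pderiv (pderiv f)) 2 \<rho>"
      using has_symbol_mult[of "pderiv ^^ 2" 2 1 \<rho>] by (simp add: numeral_2_eq_2)
    moreover have "has_symbol (\<lambda>f. v * pderiv f) 2 0"
      by (rule has_symbol_raise[OF _ has_symbol_mult[OF has_symbol_pderiv]]) simp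
    ultimately have "has_symbol bochner 2 \<rho>"
      using has_symbol_add[of "\<lambda>f. \<rho> * pderiv (pderiv f)" 2 \<rho> "\<lambda>f. v * pderiv f" 0]
      by (simp add: bochner_def[abs_def])
    then have sG: "has_symbol (polyop G bochner) (degree G * 2) (smult (lead_coeff G) (\<rho> ^ degree G))"
      by (rule has_symbol_polyop) (auto intro: bochner_linear)
    have "\<rho> \<noteq> 0" by (simp add: \<rho>)
    \<comment> \<open>If \<open>C\<close> vanished, so would \<open>polyop G bochner\<close>, whose
      symbol is nonzero.\<close>
    have "\<exists>f. C f \<noteq> 0"
    proof (rule ccontr)
      assume "\<not> (\<exists>f. C f \<noteq> 0)"
      then have "polyop G bochner = (\<lambda>f. 0)" using CC by auto
      with sG have "has_symbol (\<lambda>f. 0) (degree G * 2) (smult (lead_coeff G) (\<rho> ^ degree G))" by simp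
      moreover have "has_symbol (\<lambda>f. 0 :: complex poly) (degree G * 2) 0"
        using has_symbol_sum[of "{}"] by simp
      ultimately have "smult (lead_coeff G) (\<rho> ^ degree G) = 0" by (rule has_symbol_unique_0)
      then show False using G \<open>\<rho> \<noteq> 0\<close> by simp
    qed
    then obtain k b where b: "b \<noteq> 0" "has_symbol C k b"
      using diffop_has_symbol[OF C_diffop] by blast
    have "has_symbol (polyop G bochner) (k + k) (b * b)"
      using has_symbol_comp[OF b(2) b(2) diffop_linear[OF C_diffop]] CC by simp
    then have bb: "b * b = smult (lead_coeff G) (\<rho> ^ degree G)"
      using has_symbol_unique[OF _ sG] b G \<open>\<rho> \<noteq> 0\<close> by simp
    \<comment> \<open>Since 1 is a simple zero of \<open>\<rho>\<close>, the right side of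
      \<open>bb\<close> vanishes there to the odd order \<open>degree G\<close>, whereas a square
      vanishes to even order.\<close>
    have "Polynomial.order 1 \<rho> = 1"
    proof -
      have "\<rho> = [:- 1, 1:] ^ 1 * [:- 1, - 1:]" by (simp add: \<rho>)
      then have "Polynomial.order 1 \<rho> = Polynomial.order 1 ([:- 1, 1:] ^ 1 :: complex poly) + Polynomial.order 1 ([:- 1, - 1:] :: complex poly)"
        using \<open>\<rho> \<noteq> 0\<close> order_mult by metis
      also have "\<dots> = 1" by (subst order_power_n_n) (simp add: order_0I)
      finally show ?thesis .
    qed
    then have "Polynomial.order 1 (\<rho> ^ n) = n" for n
      using \<open>\<rho> \<noteq> 0\<close> by (induction n) (auto simp: order_mult)
    then have "Polynomial.order 1 (smult (lead_coeff G) (\<rho> ^ degree G)) = degree G"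
      using G by (simp add: order_smult)
    moreover have "Polynomial.order 1 (b * b) = 2 * Polynomial.order 1 b" using b by (simp add: order_mult)
    ultimately have "2 * Polynomial.order 1 b = 2 * degree Q2 + 1" using bb deg by simp
    then show False by presburger
  qed
  then have "diag_coeff L n = poly Q1 (diag_coeff bochner n)" for n
    by (simp add: P Q diag)
  then show ?thesis by blast
qed

section \<open>The conjugated operator is diagonal\<close>

text \<open>\<open>intertwine\<close> equates the eigenvalue in position \<open>c\<close> at degree
  n + 1 with that in position \<open>r\<close> at degree \<open>n\<close>; \<open>separated\<close>
  carries the hypothesis on the differences of the parameters; \<open>base_diag\<close> concerns
  position 0 only and spreads along the chain of nonzero entries of \<open>A\<close>.\<close>

locale darboux =
  fixes N :: nat and u :: "nat \<Rightarrow> complex poly \<Rightarrow> complex" and \<rho> :: "complex poly"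
    and v :: "nat \<Rightarrow> complex poly" and A :: "nat \<Rightarrow> nat \<Rightarrow> complex" and \<kappa> :: "nat \<Rightarrow> complex"
  assumes N_pos: "0 < N"
    and pearson_u: "k < N \<Longrightarrow> pearson (u k) \<rho> (v k)"
    and u_nonneg: "k < N \<Longrightarrow> Re (u k (f * pcnj f)) \<ge> 0"
    and u_cnj: "k < N \<Longrightarrow> u k (pcnj f) = cnj (u k f)"
    and A_parity: "A i j \<noteq> 0 \<Longrightarrow> even i \<and> odd j"
    and A_real: "cnj (A i j) = A i j"
    and A_chain_even: "Suc i < N \<Longrightarrow> even i \<Longrightarrow> A i (Suc i) \<noteq> 0"
    and A_chain_odd: "Suc i < N \<Longrightarrow> odd i \<Longrightarrow> A (Suc i) i \<noteq> 0"
    and intertwine: "A r c \<noteq> 0 \<Longrightarrow> r < N \<Longrightarrow> c < N \<Longrightarrow>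
      coeff \<rho> 2 * of_nat (Suc n) * of_nat n + coeff (v c) 1 * of_nat (Suc n) + \<kappa> c =
      coeff \<rho> 2 * of_nat n * (of_nat n - 1) + coeff (v r) 1 * of_nat n + \<kappa> r"
    and separated: "i < N \<Longrightarrow> j < N \<Longrightarrow> i \<noteq> j \<Longrightarrow>
      \<rho> * (R * pderiv S - S * pderiv R) = R * S * (v i - v j) \<Longrightarrow> R = 0 \<or> S = 0"
    and base_diag: "diffop L \<Longrightarrow> good_op (u 0) L \<Longrightarrow>
      \<exists>Q. \<forall>n. diag_coeff L n = poly Q (diag_coeff (pearson.bochner \<rho> (v 0)) n)"
    and \<kappa>_0: "\<kappa> 0 = 0"
begin

definition X :: "nat \<Rightarrow> nat \<Rightarrow> complex poly" where
  "X i j = [:0, A i j:]"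

definition T :: "(nat \<Rightarrow> complex poly) \<Rightarrow> nat \<Rightarrow> complex poly" where
  "T p k = p k + (\<Sum>r<N. X r k * p r)"

definition T' :: "(nat \<Rightarrow> complex poly) \<Rightarrow> nat \<Rightarrow> complex poly" where
  "T' p k = p k - (\<Sum>r<N. X r k * p r)"

text \<open>Bilinear: the inner product of rows p and q is \<open>form\<close> of p and the
  conjugate of q. Keeping the conjugation outside makes adjoints complex linear.\<close>

definition form :: "(nat \<Rightarrow> complex poly) \<Rightarrow> (nat \<Rightarrow> complex poly) \<Rightarrow> complex" where
  "form p q = (\<Sum>k<N. u k (T p k * T q k))"

definition rows_below :: "nat \<Rightarrow> (nat \<Rightarrow> complex poly) set" where
  "rows_below n = {p. \<forall>i<N. p i \<in> below n}"

definition unit :: "nat \<Rightarrow> complex poly \<Rightarrow> nat \<Rightarrow> complex poly" where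
  "unit i f = (\<lambda>k. if k = i then f else 0)"

text \<open>For the classical weights, the k-th diagonal entry of T^-1 D T.\<close>

definition M :: "nat \<Rightarrow> complex poly \<Rightarrow> complex poly" where
  "M k f = pearson.bochner \<rho> (v k) f + smult (\<kappa> k) f"

definition act :: "(nat \<Rightarrow> nat \<Rightarrow> complex poly \<Rightarrow> complex poly) \<Rightarrow> (nat \<Rightarrow> complex poly) \<Rightarrow> nat \<Rightarrow> complex poly" where
  "act E p j = (\<Sum>i<N. E i j (p i))"

section \<open>Algebra of rows and of the bilinear form\<close>

lemma u_linear: "k < N \<Longrightarrow> poly_functional (u k)"
  and u_definite: "k < N \<Longrightarrow> definite (u k)"
  using pearson_u by (auto simp: pearson_def)

lemma u_0: "k < N \<Longrightarrow> u k 0 = 0"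
  using module_hom.zero[OF u_linear] .

text \<open>This is A^2 = 0: the shared index \<open>r\<close> would have to be both even and odd.
  It makes \<open>T'\<close> the inverse of \<open>T\<close>.\<close>

lemma X_X: "X r k * X s r = 0"
  using A_parity[of r k] A_parity[of s r] by (auto simp: X_def)

lemma X_eq_0: "odd i \<or> even j \<Longrightarrow> X i j = 0"
  using A_parity[of i j] by (auto simp: X_def)

lemma X_self: "X i i = 0"
  by (rule X_eq_0) simp

lemma T'_T: "T' (T p) = p"
proof
  fix k
  have "(\<Sum>r<N. X r k * T p r) = (\<Sum>r<N. X r k * p r)"
    by (simp add: T_def distrib_left sum_distrib_left mult.assoc[symmetric] X_X)
  then show "T' (T p) k = p k" by (simp add: T'_def) (simp add: T_def)
qed

lemma T_T': "T (T' p) = p"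
proof
  fix k
  have "(\<Sum>r<N. X r k * T' p r) = (\<Sum>r<N. X r k * p r)"
    by (simp add: T'_def right_diff_distrib sum_distrib_left mult.assoc[symmetric] X_X)
  then show "T (T' p) k = p k" by (simp add: T_def) (simp add: T'_def)
qed

lemma T_cong: "(\<And>i. i < N \<Longrightarrow> p i = q i) \<Longrightarrow> k < N \<Longrightarrow> T p k = T q k"
  and T'_cong: "(\<And>i. i < N \<Longrightarrow> p i = q i) \<Longrightarrow> k < N \<Longrightarrow> T' p k = T' q k"
  and act_cong: "(\<And>i. i < N \<Longrightarrow> p i = q i) \<Longrightarrow> act E p k = act E q k"
  by (simp_all add: T_def T'_def act_def)

lemma act_sum:
  assumes "\<And>l. l < N \<Longrightarrow> poly_linear (E l m)"
  shows "act E (\<lambda>k. \<Sum>i\<in>I. P i k) m = (\<Sum>i\<in>I. act E (P i) m)"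
proof -
  have "act E (\<lambda>k. \<Sum>i\<in>I. P i k) m = (\<Sum>l<N. \<Sum>i\<in>I. E l m (P i l))"
    unfolding act_def by (intro sum.cong refl) (simp add: module_hom.sum[OF assms])
  then show ?thesis by (simp add: act_def sum.swap[of _ I])
qed

lemma act_smult:
  assumes "\<And>l. l < N \<Longrightarrow> poly_linear (E l m)"
  shows "act E (\<lambda>k. smult c (p k)) m = smult c (act E p m)"
  unfolding act_def smult_sum2 by (intro sum.cong refl) (simp add: module_hom.scale[OF assms])

lemma act_add:
  assumes "\<And>l. l < N \<Longrightarrow> poly_linear (E l m)"
  shows "act E (\<lambda>k. p k + q k) m = act E p m + act E q m"
  unfolding act_def sum.distrib[symmetric] by (intro sum.cong refl) (simp add: module_hom.add[OF assms])

lemma form_cong: "(\<And>i. i < N \<Longrightarrow> p i = p' i) \<Longrightarrow> (\<And>i. i < N \<Longrightarrow> q i = q' i) \<Longrightarrow> form p q = form p' q'"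
  unfolding form_def by (intro sum.cong arg_cong2[where f = "(*)"] arg_cong[where f = "u _"] T_cong) auto

lemma T_sum: "T (\<lambda>k. \<Sum>i\<in>I. P i k) k = (\<Sum>i\<in>I. T (P i) k)"
  by (simp add: T_def sum.distrib sum_distrib_left sum.swap[of _ I])

lemma T'_sum: "T' (\<lambda>k. \<Sum>i\<in>I. P i k) k = (\<Sum>i\<in>I. T' (P i) k)"
  by (simp add: T'_def sum_subtractf sum_distrib_left sum.swap[of _ I])

lemma T_unit: "i < N \<Longrightarrow> T (unit i f) k = (if k = i then f else X i k * f)"
  by (auto simp: T_def unit_def X_self if_distrib[of "\<lambda>x. _ * x"] cong: if_cong)

lemma T'_unit: "i < N \<Longrightarrow> T' (unit i f) k = (if k = i then f else - (X i k * f))"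
  by (auto simp: T'_def unit_def X_self if_distrib[of "\<lambda>x. _ * x"] cong: if_cong)

lemma sum_unit: "k < N \<Longrightarrow> (\<Sum>i<N. unit i (p i) k) = p k"
  by (simp add: unit_def)

lemma form_sum_left: "form (\<lambda>k. \<Sum>i\<in>I. P i k) q = (\<Sum>i\<in>I. form (P i) q)"
proof -
  have "form (\<lambda>k. \<Sum>i\<in>I. P i k) q = (\<Sum>k<N. \<Sum>i\<in>I. u k (T (P i) k * T q k))"
    unfolding form_def T_sum sum_distrib_right
    by (intro sum.cong refl) (simp add: module_hom.sum[OF u_linear])
  then show ?thesis by (simp add: form_def sum.swap[of _ I])
qed

lemma form_commute: "form p q = form q p"
  by (simp add: form_def mult.commute)

lemma form_sum_right: "form q (\<lambda>k. \<Sum>i\<in>I. P i k) = (\<Sum>i\<in>I. form q (P i))"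
  using form_sum_left by (simp add: form_commute[of q])

lemma T_smult: "T (\<lambda>k. smult c (p k)) k = smult c (T p k)"
  by (simp add: T_def smult_add_right smult_sum2)

lemma form_smult_left: "form (\<lambda>k. smult c (p k)) q = c * form p q"
  unfolding form_def sum_distrib_left T_smult
  by (intro sum.cong refl) (simp add: module_hom.scale[OF u_linear])

lemma form_smult_right: "form q (\<lambda>k. smult c (p k)) = c * form q p"
  using form_smult_left by (simp add: form_commute[of q])

lemma T_diff: "T (\<lambda>k. p k - q k) k = T p k - T q k"
  by (simp add: T_def right_diff_distrib sum_subtractf)

lemma form_diff_left: "form (\<lambda>k. p k - q k) r = form p r - form q r"
  unfolding form_def sum_subtractf[symmetric] T_diff
  by (intro sum.cong refl) (simp add: left_diff_distrib module_hom.diff[OF u_linear])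

lemma form_diff_right: "form r (\<lambda>k. p k - q k) = form r p - form r q"
  using form_diff_left by (simp add: form_commute[of r])

lemma form_add_left: "form (\<lambda>k. p k + q k) r = form p r + form q r"
  using form_diff_left[of p "\<lambda>k. smult (- 1) (q k)" r] form_smult_left[of "- 1" q r] by simp

lemma form_add_right: "form r (\<lambda>k. p k + q k) = form r p + form r q"
  using form_add_left by (simp add: form_commute[of r])

lemma T_pcnj: "T (\<lambda>k. pcnj (p k)) k = pcnj (T p k)"
proof -
  have "pcnj (X r k) = X r k" for r by (simp add: X_def pcnj_pCons A_real)
  then show ?thesis by (simp add: T_def pcnj_add pcnj_sum pcnj_mult)
qed

lemma form_pcnj: "form (\<lambda>k. pcnj (p k)) (\<lambda>k. pcnj (q k)) = cnj (form p q)"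
  unfolding form_def cnj_sum T_pcnj pcnj_mult[symmetric] by (intro sum.cong refl) (simp add: u_cnj)

text \<open>All summands are real and nonnegative, so each vanishes; \<open>T'\<close> carries the
  vanishing of \<open>T p\<close> back to \<open>p\<close>.\<close>

lemma form_definite:
  assumes "form p (\<lambda>k. pcnj (p k)) = 0" and "k < N"
  shows "p k = 0"
proof -
  have real: "Im (u k (f * pcnj f)) = 0" if "k < N" for k f
    using u_cnj[OF that, of "f * pcnj f"] by (simp add: pcnj_mult mult.commute complex_eq_iff)
  have "(\<Sum>k<N. Re (u k (T p k * pcnj (T p k)))) = 0"
    using arg_cong[OF assms(1), of Re] by (simp add: form_def T_pcnj)
  then have "\<forall>k\<in>{..<N}. Re (u k (T p k * pcnj (T p k))) = 0"
    by (subst (asm) sum_nonneg_eq_0_iff) (auto intro: u_nonneg)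
  then have "u k (T p k * pcnj (T p k)) = 0" if "k < N" for k
    using that real by (simp add: complex_eq_iff)
  then have "T p k = 0" if "k < N" for k using u_definite that by (simp add: definite_def)
  then have "T' (T p) k = T' (\<lambda>_. 0) k" using assms(2) by (intro T'_cong)
  then show ?thesis by (simp add: T'_T) (simp add: T'_def)
qed

lemma good_op_M:
  assumes k: "k < N"
  shows "good_op (u k) (M k)"
proof -
  interpret pearson "u k" \<rho> "v k" using pearson_u[OF k] .
  show ?thesis
    unfolding M_def[abs_def] by (intro good_op_add good_op_smult good_op_bochner good_op_id u_linear)
qed

lemma diag_coeff_M:
  assumes k: "k < N"
  shows "diag_coeff (M k) n = coeff \<rho> 2 * of_nat n * (of_nat n - 1) + coeff (v k) 1 * of_nat n + \<kappa> k"
proof -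
  interpret pearson "u k" \<rho> "v k" using pearson_u[OF k] .
  show ?thesis
    using diag_coeff_bochner[of n] by (simp add: M_def[abs_def] diag_coeff_def)
qed

lemma diag_coeff_M_shift:
  assumes "A r c \<noteq> 0" "r < N" "c < N"
  shows "diag_coeff (M c) (Suc n) = diag_coeff (M r) n"
  using intertwine[OF assms, of n] assms(2,3) by (simp add: diag_coeff_M)

lemma M_symmetric:
  assumes k: "k < N"
  shows "u k (M k f * g) = u k (f * M k g)"
proof -
  interpret pearson "u k" \<rho> "v k" using pearson_u[OF k] .
  show ?thesis
    by (simp add: M_def distrib_left distrib_right u.add u.scale bochner_symmetric)
qed

end

text \<open>What membership in D(W) provides: an operator matrix that respects the degree filtration
  of rows and has an adjoint doing the same.\<close>

locale darboux_operator = darboux +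
  fixes E :: "nat \<Rightarrow> nat \<Rightarrow> complex poly \<Rightarrow> complex poly"
  assumes E_diffop: "i < N \<Longrightarrow> j < N \<Longrightarrow> diffop (E i j)"
    and E_below: "p \<in> rows_below n \<Longrightarrow> act E p \<in> rows_below n"
    and E_adjoint: "q \<in> rows_below n \<Longrightarrow> \<exists>s\<in>rows_below n. \<forall>p. form (act E p) q = form p s"
begin

text \<open>Entry (i, j) of T^-1 E T, with operators acting on rows from the right.\<close>

definition B :: "nat \<Rightarrow> nat \<Rightarrow> complex poly \<Rightarrow> complex poly" where
  "B i j f = T (act E (T' (unit i f))) j"

lemma B_diffop:
  assumes i: "i < N" and j: "j < N"
  shows "diffop (B i j)"
proof -
  have d: "diffop (\<lambda>f. T' (unit i f) l)" for l
    using diffop_mult_const[of "if l = i then 1 else - X i l"] i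
    by (cases "l = i") (simp_all add: T'_unit)
  have "diffop (\<lambda>f. act E (T' (unit i f)) m)" if "m < N" for m
    unfolding act_def using that
    by (intro diffop_sum diffop_comp[OF E_diffop d]) auto
  then show ?thesis
    unfolding B_def[abs_def] T_def using j by (intro diffop_add diffop_sum diffop_mult) auto
qed

lemma conj_eq_sum:
  assumes j: "j < N"
  shows "T (act E (T' p)) j = (\<Sum>i<N. B i j (p i))"
proof -
  have "T' p k = (\<Sum>i<N. T' (unit i (p i)) k)" if "k < N" for k
    unfolding T'_sum[symmetric] by (rule T'_cong) (auto simp: sum_unit that)
  then have "act E (T' p) m = (\<Sum>i<N. act E (T' (unit i (p i))) m)" if "m < N" for m
    using that by (subst act_sum[symmetric]) (auto intro: act_cong diffop_linear E_diffop)
  then have "T (act E (T' p)) j = T (\<lambda>m. \<Sum>i<N. act E (T' (unit i (p i))) m) j"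
    using j by (intro T_cong) auto
  then show ?thesis by (simp add: T_sum B_def)
qed

text \<open>The adjoint relation of \<open>E\<close>, tested on unit rows transported by
  \<open>T'\<close>, becomes one for row \<open>i\<close> of \<open>B\<close>. Its values
  \<open>T s i\<close> are polynomials, but their degree may exceed that of the row
  \<open>s\<close>.\<close>

lemma conj_adjoint:
  assumes q: "q \<in> rows_below n"
  shows "\<exists>s\<in>rows_below n. \<forall>i<N. \<forall>f. (\<Sum>k<N. u k (B i k f * T q k)) = u i (f * T s i)"
proof -
  obtain s where s: "s \<in> rows_below n" "\<And>p. form (act E p) q = form p s"
    using E_adjoint[OF q] by blast
  have "(\<Sum>k<N. u k (B i k f * T q k)) = u i (f * T s i)" if i: "i < N" for i f
  proof -
    have "(\<Sum>k<N. u k (B i k f * T q k)) = form (act E (T' (unit i f))) q"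
      by (simp add: form_def B_def)
    also have "\<dots> = (\<Sum>k<N. u k (unit i f k * T s k))"
      unfolding s by (simp add: form_def T_T')
    also have "\<dots> = (\<Sum>k<N. if k = i then u i (f * T s i) else 0)"
      by (intro sum.cong refl) (auto simp: unit_def u_0)
    finally show ?thesis using i by simp
  qed
  with s show ?thesis by blast
qed

lemma B_offdiag:
  assumes i: "i < N" and j: "j < N" and "i \<noteq> j"
  shows "B i j f = 0"
proof -
  interpret ui: pearson "u i" \<rho> "v i" by (rule pearson_u[OF i])
  interpret uj: pearson "u j" \<rho> "v j" by (rule pearson_u[OF j])
  have "u j (f * B i j h) = 0" for f h
  proof -
    \<comment> \<open>\<open>T\<close> turns this row into the unit row at \<open>j\<close>, which
      isolates the single entry \<open>B i j\<close> in the adjoint relation.\<close>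
    obtain n where n: "T' (unit j f) \<in> rows_below n"
    proof -
      define n where "n = Suc (Max (degree ` T' (unit j f) ` {..<N}))"
      have "T' (unit j f) k \<in> below n" if "k < N" for k
        unfolding n_def below_Suc_iff using that by (intro Max_ge) auto
      then show ?thesis using that by (auto simp: rows_below_def)
    qed
    obtain s where s: "\<And>h. (\<Sum>k<N. u k (B i k h * T (T' (unit j f)) k)) = u i (h * T s i)"
      using conj_adjoint[OF n] i by blast
    have "(\<Sum>k<N. u k (B i k h * T (T' (unit j f)) k)) = (\<Sum>k<N. if k = j then u j (B i j h * f) else 0)" for h
      unfolding T_T' by (intro sum.cong refl) (auto simp: unit_def u_0)
    then have s': "u j (B i j h * f) = u i (h * T s i)" for h using s j by simp
    \<comment> \<open>The power of \<open>\<rho>\<close> lets the derivatives in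
      \<open>B i j\<close> be moved off \<open>h\<close>; this gives a second expression for the
      same functional, now in terms of \<open>u j\<close> alone.\<close>
    obtain m R where R: "\<And>h. u j (B i j (\<rho> ^ m * h) * f) = u j (h * R)"
      using uj.diffop_adjoint[OF B_diffop[OF i j]] by blast
    have eq: "u j (h * R) = u i (h * (\<rho> ^ m * T s i))" for h
      using R[of h] s'[of "\<rho> ^ m * h"] by (simp add: mult_ac)
    have "R = 0 \<or> \<rho> ^ m * T s i = 0"
      using separated[OF j i] pearson_proportional[OF pearson_u[OF j] pearson_u[OF i] eq] \<open>i \<noteq> j\<close> by blast
    moreover have "\<rho> ^ m * T s i = 0" if "R = 0"
      using that eq by (intro definiteD[OF ui.u_definite]) (simp add: uj.u.zero flip: eq)
    ultimately have "\<rho> ^ m * T s i = 0" by blast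
    \<comment> \<open>With \<open>\<rho> = 0\<close> both drifts would vanish, and the constants R =
      S = 1 would contradict \<open>separated\<close>.\<close>
    moreover have "\<rho> \<noteq> 0"
    proof
      assume "\<rho> = 0"
      then have "u j (f * v j) = 0" for f using uj.pearson[of f] by (simp add: mult.commute)
      then have vj: "v j = 0" by (rule definiteD[OF uj.u_definite])
      from \<open>\<rho> = 0\<close> have "u i (f * v i) = 0" for f using ui.pearson[of f] by (simp add: mult.commute)
      then have "v i = 0" by (rule definiteD[OF ui.u_definite])
      with vj \<open>\<rho> = 0\<close> separated[OF i j \<open>i \<noteq> j\<close>, of 1 1] show False by simp
    qed
    ultimately have "T s i = 0" by simp
    then show ?thesis using s'[of h] by (simp add: ui.u.zero mult.commute)
  qed
  then show ?thesis by (intro definiteD[OF uj.u_definite])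
qed

abbreviation L :: "nat \<Rightarrow> complex poly \<Rightarrow> complex poly" where
  "L i \<equiv> B i i"

lemma act_eq: "j < N \<Longrightarrow> act E p j = T' (\<lambda>k. L k (T p k)) j"
proof -
  assume j: "j < N"
  have "T (act E p) k = L k (T p k)" if k: "k < N" for k
  proof -
    have "T (act E (T' (T p))) k = (\<Sum>i<N. if i = k then L k (T p k) else 0)"
      unfolding conj_eq_sum[OF k] by (intro sum.cong refl) (auto simp: B_offdiag k)
    then show ?thesis using k by (simp add: T'_T)
  qed
  then have "T' (T (act E p)) j = T' (\<lambda>k. L k (T p k)) j" using j by (intro T'_cong)
  then show ?thesis by (simp add: T'_T)
qed

lemma L_linear: "i < N \<Longrightarrow> poly_linear (L i)"
  by (intro diffop_linear B_diffop)

lemma L_0: "i < N \<Longrightarrow> L i 0 = 0"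
  using module_hom.zero[OF L_linear] .

lemma unit_rows_below: "f \<in> below n \<Longrightarrow> unit i f \<in> rows_below n"
  by (simp add: rows_below_def unit_def)

text \<open>\<open>T\<close> and \<open>T'\<close> raise degrees, but by parity no path through
  \<open>X\<close> leads back to position \<open>i\<close>: entry \<open>i\<close> of
  \<open>E\<close> on the row \<open>unit i f\<close> is \<open>L i f\<close> itself.\<close>

lemma L_below:
  assumes i: "i < N" and f: "f \<in> below n"
  shows "L i f \<in> below n"
proof -
  have "X r i * L r (T (unit i f) r) = 0" if r: "r < N" for r
    using i r by (cases "even i") (auto simp: T_unit X_self X_eq_0 L_0)
  then have "(\<Sum>r<N. X r i * L r (T (unit i f) r)) = 0"
    by (intro sum.neutral) auto
  then have "act E (unit i f) i = L i f"
    unfolding act_eq[OF i] T'_def using i by (simp add: T_unit)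
  then show ?thesis
    using E_below[OF unit_rows_below[OF f, of i]] i by (auto simp: rows_below_def)
qed

text \<open>Entry \<open>c\<close> of \<open>E\<close> on the row \<open>unit r f\<close> is A_rc
  times this difference. \<open>E\<close> preserves degrees, so the degree gained from the factor x
  must cancel.\<close>

lemma L_intertwine_below:
  assumes A: "A r c \<noteq> 0" and r: "r < N" and c: "c < N" and f: "f \<in> below n"
  shows "L c ([:0, 1:] * f) - [:0, 1:] * L r f \<in> below n"
proof -
  interpret Lc: module_hom smult smult "L c" using L_linear[OF c] .
  have par: "even r" "odd c" using A_parity[OF A] by auto
  then have "c \<noteq> r" by auto
  have "X k c * L k (T (unit r f) k) = (if k = r then X r c * L r f else 0)" if k: "k < N" for k
    using r k par by (cases "even k") (auto simp: T_unit X_eq_0 L_0)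
  then have "act E (unit r f) c = L c (X r c * f) - X r c * L r f"
    using c r \<open>c \<noteq> r\<close> by (simp add: act_eq T'_def T_unit)
  moreover have "X r c * g = smult (A r c) ([:0, 1:] * g)" for g
    by (simp add: X_def)
  ultimately have "act E (unit r f) c = smult (A r c) (L c ([:0, 1:] * f) - [:0, 1:] * L r f)"
    by (simp only: Lc.scale smult_diff_right)
  then have "smult (A r c) (L c ([:0, 1:] * f) - [:0, 1:] * L r f) \<in> below n"
    using E_below[OF unit_rows_below[OF f, of r]] c by (auto simp: rows_below_def)
  from below_smult[OF this, of "1 / A r c"] show ?thesis using A by simp
qed

lemma diag_coeff_L_shift:
  assumes A: "A r c \<noteq> 0" and r: "r < N" and c: "c < N"
  shows "diag_coeff (L c) (Suc n) = diag_coeff (L r) n"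
proof -
  have "L c ([:0, 1:] * monom 1 n) - [:0, 1:] * L r (monom 1 n) \<in> below (Suc n)"
    by (rule L_intertwine_below[OF A r c]) (simp add: monom_below)
  then have "coeff (L c ([:0, 1:] * monom 1 n) - [:0, 1:] * L r (monom 1 n)) (Suc n) = 0"
    by (simp add: below_def)
  moreover have "[:0, 1:] * monom (1 :: complex) n = monom 1 (Suc n)"
    by (simp add: monom_Suc)
  ultimately have "coeff (L c (monom 1 (Suc n))) (Suc n) - coeff (L r (monom 1 n)) n = 0"
    by (simp only: coeff_diff) simp
  then show ?thesis by (simp add: diag_coeff_def)
qed

lemma L_good:
  assumes i: "i < N"
  shows "good_op (u i) (L i)"
proof (rule good_opI)
  fix n and g :: "complex poly" assume g: "g \<in> below n"
  obtain s where s: "s \<in> rows_below n" "\<And>l f. l < N \<Longrightarrow> (\<Sum>k<N. u k (B l k f * T (unit i g) k)) = u l (f * T s l)"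
    using conj_adjoint[OF unit_rows_below[OF g, of i]] by blast
  have s': "u l (L l f * T (unit i g) l) = u l (f * T s l)" if l: "l < N" for l f
  proof -
    have "(\<Sum>k<N. u k (B l k f * T (unit i g) k)) = (\<Sum>k<N. if k = l then u l (L l f * T (unit i g) l) else 0)"
      by (intro sum.cong refl) (auto simp: B_offdiag l u_0)
    then show ?thesis using s(2)[OF l, of f] l by simp
  qed
  \<comment> \<open>The adjoint value is \<open>T s i\<close>, but the degree bound is known for
    \<open>s i\<close>. For even \<open>i\<close> they agree by parity; for odd \<open>i\<close> the
    even entries of \<open>s\<close>, which \<open>T\<close> would feed into position
    \<open>i\<close>, vanish because \<open>T (unit i g)\<close> vanishes there.\<close>
  have "T s i = s i"
  proof (cases "even i")
    case True
    then show ?thesis by (simp add: T_def X_eq_0)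
  next
    case False
    have "s r = 0" if r: "r < N" "even r" for r
    proof (rule definiteD[OF u_definite[OF r(1)]])
      fix f
      have "T s r = s r" using r by (simp add: T_def X_eq_0)
      moreover have "T (unit i g) r = 0" using r False i by (auto simp: T_unit X_eq_0)
      ultimately show "u r (f * s r) = 0" using s'[OF r(1), of f] r by (simp add: u_0)
    qed
    then have "(\<Sum>r<N. X r i * s r) = 0"
      by (intro sum.neutral) (metis X_eq_0 lessThan_iff mult_eq_0_iff)
    then show ?thesis by (simp add: T_def)
  qed
  then show "\<exists>s\<in>below n. \<forall>f. u i (L i f * g) = u i (f * s)"
    using s'[OF i] s(1) i by (intro bexI[of _ "s i"]) (auto simp: T_unit rows_below_def)
qed (use i L_linear L_below in auto)

text \<open>Neighbouring positions are linked by an entry of \<open>A\<close>, so the relation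
  spreads from 0 upwards. From an odd \<open>i\<close> the link reaches every degree of
  \<open>Suc i\<close>; from an even \<open>i\<close> it reaches only positive degrees, and degree 0
  is recovered because two polynomials in \<open>n\<close> agree at infinitely many points.\<close>

lemma L_diag:
  assumes Q: "\<And>n. diag_coeff (L 0) n = poly Q (diag_coeff (M 0) n)" and i: "i < N"
  shows "diag_coeff (L i) n = poly Q (diag_coeff (M i) n)"
  using i
proof (induction i arbitrary: n)
  case 0
  then show ?case using Q by simp
next
  case (Suc i)
  show ?case
  proof (cases "even i")
    case True
    have A: "A i (Suc i) \<noteq> 0" using A_chain_even Suc.prems True by blast
    obtain P where P: "\<And>n. diag_coeff (L (Suc i)) n = poly P (of_nat n)"
      using diffop_diag_coeff[OF B_diffop] Suc.prems by blast
    define P' where "P' = Q \<circ>\<^sub>p ([:coeff \<rho> 2:] * [:0, 1:] * [:- 1, 1:] + [:\<kappa> (Suc i), coeff (v (Suc i)) 1:])"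
    have P': "poly P' (of_nat n) = poly Q (diag_coeff (M (Suc i)) n)" for n
      using Suc.prems by (simp add: P'_def poly_pcompose diag_coeff_M algebra_simps)
    have "poly P (of_nat (Suc n)) = poly P' (of_nat (Suc n))" for n
      using diag_coeff_L_shift[OF A] diag_coeff_M_shift[OF A] Suc by (simp add: P[symmetric] P' del: of_nat_Suc)
    then have "range (\<lambda>n. of_nat (Suc n) :: complex) \<subseteq> {x. poly (P - P') x = 0}"
      by (auto simp del: of_nat_Suc)
    moreover have "infinite (range (\<lambda>n. of_nat (Suc n) :: complex))"
      by (intro range_inj_infinite injI) (simp del: of_nat_Suc)
    ultimately have "P - P' = 0"
      using poly_roots_finite[of "P - P'"] finite_subset by blast
    then show ?thesis using P P' by simp
  next
    case False
    then have A: "A (Suc i) i \<noteq> 0" using A_chain_odd Suc.prems by blast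
    show ?thesis
      using diag_coeff_L_shift[OF A, of n] diag_coeff_M_shift[OF A, of n] Suc by simp
  qed
qed

text \<open>The polynomial found in position 0 serves all positions, since good operators are
  determined by their eigenvalues.\<close>

theorem act_eq_polyop: "\<exists>Q. \<forall>p. \<forall>j<N. act E p j = T' (\<lambda>k. polyop Q (M k) (T p k)) j"
proof -
  have M0: "M 0 = pearson.bochner \<rho> (v 0)" by (simp add: M_def[abs_def] \<kappa>_0)
  obtain Q where "\<And>n. diag_coeff (L 0) n = poly Q (diag_coeff (M 0) n)"
    using base_diag[OF B_diffop L_good] N_pos unfolding M0 by blast
  then have diag: "diag_coeff (L i) n = poly Q (diag_coeff (M i) n)" if "i < N" for i n
    using L_diag that by blast
  have "L i f = polyop Q (M i) f" if i: "i < N" for i f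
    by (rule good_op_eqI[where L = "L i", OF u_linear[OF i] u_definite[OF i] L_good[OF i]])
      (auto simp: good_op_polyop u_linear good_op_M i diag_coeff_polyop[OF good_op_M[OF i]] diag)
  then have "act E p j = T' (\<lambda>k. polyop Q (M k) (T p k)) j" if "j < N" for p j
    unfolding act_eq[OF that] using that by (intro T'_cong) auto
  then show ?thesis by blast
qed

end

section \<open>Matrix orthogonal polynomials\<close>

text \<open>Injectivity makes the determinant nonzero; an enumeration of \<open>I\<close> turns the
  system into a matrix.\<close>

lemma finite_linear_system:
  fixes G :: "'b \<Rightarrow> 'b \<Rightarrow> 'a::field"
  assumes I: "finite I"
    and inj: "\<And>c. (\<forall>i\<in>I. (\<Sum>j\<in>I. G i j * c j) = 0) \<Longrightarrow> \<forall>j\<in>I. c j = 0"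
  shows "\<exists>c. \<forall>i\<in>I. (\<Sum>j\<in>I. G i j * c j) = \<phi> i"
proof -
  define n where "n = card I"
  obtain e where e: "bij_betw e {0..<n} I"
    using ex_bij_betw_nat_finite[OF I] unfolding n_def by blast
  define e' where "e' = inv_into {0..<n} e"
  have e': "e' (e i) = i" if "i < n" for i
    using bij_betw_imp_inj_on[OF e] that by (simp add: e'_def)
  have eI: "e i \<in> I" if "i < n" for i using bij_betwE[OF e] that by simp
  have ex: "\<exists>i<n. x = e i" if "x \<in> I" for x
    using bij_betw_imp_surj_on[OF e] that by force
  define m where "m = mat n n (\<lambda>(i, j). G (e i) (e j))"
  have m: "m \<in> carrier_mat n n" by (simp add: m_def)
  have mv: "(m *\<^sub>v w) $ i = (\<Sum>j\<in>I. G (e i) j * w $ (e' j))" if "w \<in> carrier_vec n" "i < n" for w i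
  proof -
    have "(m *\<^sub>v w) $ i = (\<Sum>j\<in>{0..<n}. G (e i) (e j) * w $ (e' (e j)))"
      using that by (simp add: m_def scalar_prod_def e')
    also have "\<dots> = (\<Sum>j\<in>I. G (e i) j * w $ (e' j))"
      by (rule sum.reindex_bij_betw[OF e])
    finally show ?thesis .
  qed
  have "det m \<noteq> 0"
  proof
    assume "det m = 0"
    then obtain w where w: "w \<in> carrier_vec n" "w \<noteq> 0\<^sub>v n" "m *\<^sub>v w = 0\<^sub>v n"
      using det_0_iff_vec_prod_zero[OF m] by blast
    have "\<forall>i\<in>I. (\<Sum>j\<in>I. G i j * w $ (e' j)) = 0"
      using ex mv[OF w(1)] w(3) by (metis index_zero_vec(1))
    then have "\<forall>j\<in>I. w $ (e' j) = 0" by (rule inj)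
    then have "w = 0\<^sub>v n" using w(1) eI e' by (intro eq_vecI) force+
    with w(2) show False by simp
  qed
  then obtain b where b: "b \<in> carrier_mat n n" "m * b = 1\<^sub>m n"
    using det_non_zero_imp_unit[OF m] by (auto simp: Units_def ring_mat_def)
  define w where "w = b *\<^sub>v vec n (\<lambda>i. \<phi> (e i))"
  have w: "w \<in> carrier_vec n" using b by (simp add: w_def)
  have "m *\<^sub>v w = vec n (\<lambda>i. \<phi> (e i))"
    using b m by (simp add: w_def assoc_mult_mat_vec[symmetric, of _ n n _ n])
  then have "(\<Sum>j\<in>I. G (e i) j * w $ (e' j)) = \<phi> (e i)" if "i < n" for i
    using mv[OF w that] that by simp
  then have "\<forall>i\<in>I. (\<Sum>j\<in>I. G i j * w $ (e' j)) = \<phi> i" using ex by metis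
  then show ?thesis by (rule exI[of _ "\<lambda>j. w $ (e' j)"])
qed

lemma foldr_add_mat:
  assumes "\<And>j. j \<in> set xs \<Longrightarrow> F j \<in> carrier_mat n m"
  shows "foldr (\<lambda>j acc. F j + acc) xs (0\<^sub>m n m) = mat n m (\<lambda>(i, k). \<Sum>j\<leftarrow>xs. F j $$ (i, k))"
  using assms
proof (induction xs)
  case Nil
  then show ?case by (auto intro: eq_matI)
next
  case (Cons a xs)
  then have "F a \<in> carrier_mat n m" by simp
  with Cons show ?case by (intro eq_matI) auto
qed

definition dop_entry :: "dop \<Rightarrow> nat \<Rightarrow> nat \<Rightarrow> complex poly \<Rightarrow> complex poly" where
  "dop_entry D i j f = (\<Sum>l<length D. (D ! l) $$ (i, j) * (pderiv ^^ l) f)"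

lemma diffop_dop_entry: "diffop (dop_entry D i j)"
  by (rule diffopI) (rule dop_entry_def)

lemma sum_list_upt: "(\<Sum>j\<leftarrow>[0..<n]. f j) = (\<Sum>j<n. f j)" for f :: "nat \<Rightarrow> 'a::comm_monoid_add"
  by (simp add: interv_sum_list_conv_sum_set_nat atLeast0LessThan)

section \<open>Rows of matrix polynomials and duality in bounded degree\<close>

context darboux
begin

lemma dop_act_eq:
  assumes D: "wf_dop N D" and P: "P \<in> carrier_mat N N"
  shows "dop_act D P = mat N N (\<lambda>(i, j). act (dop_entry D) (\<lambda>k. P $$ (i, k)) j)"
proof -
  have Dl: "D ! l \<in> carrier_mat N N" if "l < length D" for l
    using D that by (simp add: wf_dop_def)
  have c: "pderiv_mat l P * D ! l \<in> carrier_mat N N" if "l \<in> set [0..<length D]" for l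
    using Dl[of l] that P by (auto simp: pderiv_mat_def)
  have "dop_act D P = mat N N (\<lambda>(i, k). \<Sum>j\<leftarrow>[0..<length D]. (pderiv_mat j P * D ! j) $$ (i, k))"
    unfolding dop_act_def using P
    by (simp only: carrier_matD) (rule foldr_add_mat[where F = "\<lambda>j. pderiv_mat j P * D ! j", OF c])
  also have "\<dots> = mat N N (\<lambda>(i, j). act (dop_entry D) (\<lambda>k. P $$ (i, k)) j)"
  proof (intro cong_mat refl, clarify)
    fix i k assume ik: "i < N" "k < N"
    have "(pderiv_mat l P * D ! l) $$ (i, k) = (\<Sum>r<N. (pderiv ^^ l) (P $$ (i, r)) * (D ! l) $$ (r, k))"
      if "l < length D" for l
      using Dl[OF that] P ik by (auto simp: pderiv_mat_def scalar_prod_def atLeast0LessThan)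
    then have "(\<Sum>j\<leftarrow>[0..<length D]. (pderiv_mat j P * D ! j) $$ (i, k)) =
        (\<Sum>l<length D. \<Sum>r<N. (pderiv ^^ l) (P $$ (i, r)) * (D ! l) $$ (r, k))"
      unfolding sum_list_upt by (intro sum.cong) auto
    then show "(\<Sum>j\<leftarrow>[0..<length D]. (pderiv_mat j P * D ! j) $$ (i, k)) = act (dop_entry D) (\<lambda>k. P $$ (i, k)) k"
      unfolding act_def dop_entry_def by (subst sum.swap) (simp add: mult.commute)
  qed
  finally show ?thesis .
qed

lemma rows_below_mono: "m \<le> n \<Longrightarrow> rows_below m \<subseteq> rows_below n"
  using below_mono by (fastforce simp: rows_below_def)

lemma ex_rows_below: "\<exists>n\<ge>m. p \<in> rows_below n"
proof -
  define n where "n = max m (Suc (Max (degree ` p ` {..<N})))"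
  have "degree (p k) \<le> Max (degree ` p ` {..<N})" if "k < N" for k
    using that by (intro Max_ge) auto
  then have "p \<in> rows_below (Suc (Max (degree ` p ` {..<N})))" by (simp add: rows_below_def below_Suc_iff)
  then have "p \<in> rows_below n" unfolding n_def by (rule subsetD[OF rows_below_mono, rotated]) simp
  then show ?thesis by (intro exI[of _ n]) (simp add: n_def)
qed

lemma rows_below_expand:
  assumes "p \<in> rows_below n" "k < N"
  shows "p k = (\<Sum>x\<in>{..<N} \<times> {..<n}. smult (coeff (p (fst x)) (snd x)) (unit (fst x) (monom 1 (snd x)) k))"
proof -
  have "(\<Sum>x\<in>{..<N} \<times> {..<n}. smult (coeff (p (fst x)) (snd x)) (unit (fst x) (monom 1 (snd x)) k))
    = (\<Sum>i<N. \<Sum>m<n. smult (coeff (p i) m) (unit i (monom 1 m) k))"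
    by (simp add: sum.cartesian_product case_prod_unfold)
  also have "\<dots> = (\<Sum>i<N. unit i (\<Sum>m<n. smult (coeff (p i) m) (monom 1 m)) k)"
    by (intro sum.cong refl) (auto simp: unit_def)
  also have "\<dots> = (\<Sum>m<n. smult (coeff (p k) m) (monom 1 m))" using assms(2) by (rule sum_unit)
  also have "\<dots> = p k" using assms by (intro below_eq_sum[symmetric]) (simp add: rows_below_def)
  finally show ?thesis by simp
qed

text \<open>The Gram matrix of \<open>form\<close> on monomial unit rows is invertible: a kernel
  vector gives a row orthogonal to its own conjugate, which obeys the same degree bound, so
  \<open>form_definite\<close> applies.\<close>

lemma riesz:
  assumes cong: "\<And>p q. (\<And>k. k < N \<Longrightarrow> p k = q k) \<Longrightarrow> \<phi> p = \<phi> q"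
    and lin: "\<And>(I :: (nat \<times> nat) set) c P. \<phi> (\<lambda>k. \<Sum>x\<in>I. smult (c x) (P x k)) = (\<Sum>x\<in>I. c x * \<phi> (P x))"
  shows "\<exists>s\<in>rows_below n. \<forall>p\<in>rows_below n. \<phi> p = form p s"
proof -
  define I where "I = {..<N} \<times> {..<n}"
  define e where "e = (\<lambda>x :: nat \<times> nat. unit (fst x) (monom 1 (snd x)))"
  define comb where "comb = (\<lambda>c k. \<Sum>x\<in>I. smult (c x) (e x k))"
  have comb_eq: "comb c = (\<lambda>k. \<Sum>x\<in>I. smult (c x) (e x k))" for c by (simp add: comb_def)
  have comb_below: "comb c \<in> rows_below n" for c
    by (auto simp: rows_below_def comb_def e_def I_def unit_def intro!: below_sum below_smult monom_below)
  have coeff_comb: "coeff (comb c i) m = c (i, m)" if "(i, m) \<in> I" for c i m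
  proof -
    have "coeff (comb c i) m = (\<Sum>x\<in>I. if x = (i, m) then c (i, m) else 0)"
      unfolding comb_def coeff_sum by (intro sum.cong refl) (auto simp: e_def unit_def)
    then show ?thesis using that by (simp add: I_def)
  qed
  have expand: "p k = comb (\<lambda>x. coeff (p (fst x)) (snd x)) k" if "p \<in> rows_below n" "k < N" for p k
    using rows_below_expand[OF that] by (simp add: comb_def e_def I_def)
  have "\<exists>c. \<forall>x\<in>I. (\<Sum>y\<in>I. form (e x) (e y) * c y) = \<phi> (e x)"
  proof (rule finite_linear_system)
    fix c assume c: "\<forall>x\<in>I. (\<Sum>y\<in>I. form (e x) (e y) * c y) = 0"
    have fc: "form (e x) (comb c) = (\<Sum>y\<in>I. form (e x) (e y) * c y)" for x
      by (simp add: comb_def form_sum_right form_smult_right mult.commute)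
    have "form (comb d) (comb c) = (\<Sum>x\<in>I. d x * form (e x) (comb c))" for d
      unfolding comb_eq[of d] by (simp add: form_sum_left form_smult_left)
    then have z: "form (comb d) (comb c) = 0" for d using c by (simp add: fc)
    have "(\<lambda>k. pcnj (comb c k)) \<in> rows_below n"
      using comb_below[of c] by (simp add: rows_below_def pcnj_below)
    then have "form (\<lambda>k. pcnj (comb c k)) (comb c) = 0"
      by (subst form_cong[OF expand refl]) (simp_all add: z)
    then have "comb c k = 0" if "k < N" for k
      using form_definite that by (simp add: form_commute)
    then show "\<forall>x\<in>I. c x = 0" using coeff_comb[of _ _ c] by (force simp: I_def)
  qed (simp add: I_def)
  then obtain c where c: "\<And>x. x \<in> I \<Longrightarrow> (\<Sum>y\<in>I. form (e x) (e y) * c y) = \<phi> (e x)" by blast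
  have "\<phi> p = form p (comb c)" if p: "p \<in> rows_below n" for p
  proof -
    have "\<phi> p = (\<Sum>x\<in>I. coeff (p (fst x)) (snd x) * \<phi> (e x))"
      using cong[OF expand[OF p]] by (simp add: comb_def lin)
    also have "\<dots> = (\<Sum>x\<in>I. coeff (p (fst x)) (snd x) * form (e x) (comb c))"
      by (intro sum.cong refl) (simp add: c[symmetric] comb_def form_sum_right form_smult_right mult.commute)
    also have "\<dots> = form (comb (\<lambda>x. coeff (p (fst x)) (snd x))) (comb c)"
      unfolding comb_eq[of "\<lambda>x. coeff (p (fst x)) (snd x)"] by (simp add: form_sum_left form_smult_left)
    also have "\<dots> = form p (comb c)" using expand[OF p] by (intro form_cong) auto
    finally show ?thesis .
  qed
  then show ?thesis using comb_below by blast
qed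

text \<open>The top coefficients of the rows of \<open>P\<close> form the identity matrix, so these
  rows can absorb any term of degree \<open>n\<close>.\<close>

lemma monic_decomp:
  assumes P: "monic_deg N n P" and p: "p \<in> rows_below (Suc n)"
  shows "(\<lambda>k. p k - (\<Sum>i<N. smult (coeff (p i) n) (P $$ (i, k)))) \<in> rows_below n"
proof -
  have "p k - (\<Sum>i<N. smult (coeff (p i) n) (P $$ (i, k))) \<in> below n" if k: "k < N" for k
  proof (rule below_SucD)
    have c: "P $$ (i, k) \<in> below (Suc n)" if "i < N" for i
      using P that k by (simp add: monic_deg_def below_Suc_iff)
    show "p k - (\<Sum>i<N. smult (coeff (p i) n) (P $$ (i, k))) \<in> below (Suc n)"
      using p k c by (intro below_diff below_sum below_smult) (auto simp: rows_below_def)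
    have "coeff (P $$ (i, k)) n = (if i = k then 1 else 0)" if "i < N" for i
    proof -
      have "P \<in> carrier_mat N N" "coeff_mat P n = 1\<^sub>m N" using P by (auto simp: monic_deg_def)
      then have "coeff (P $$ (i, k)) n = (1\<^sub>m N) $$ (i, k)"
        using that k by (metis (no_types, lifting) carrier_matD case_prod_conv coeff_mat_def index_mat(1))
      then show ?thesis using that k by simp
    qed
    then have "(\<Sum>i<N. coeff (p i) n * coeff (P $$ (i, k)) n) = (\<Sum>i<N. if i = k then coeff (p k) n else 0)"
      by (intro sum.cong) auto
    then show "coeff (p k - (\<Sum>i<N. smult (coeff (p i) n) (P $$ (i, k)))) n = 0"
      using k by (simp add: coeff_sum)
  qed
  then show ?thesis by (simp add: rows_below_def)
qed

section \<open>The second-order operator D = T diag(M) T^-1\<close>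

definition Dact :: "(nat \<Rightarrow> complex poly) \<Rightarrow> nat \<Rightarrow> complex poly" where
  "Dact p = T' (\<lambda>k. M k (T p k))"

lemma Dact_funpow: "(Dact ^^ m) p = T' (\<lambda>k. (M k ^^ m) (T p k))"
  by (induction m) (simp_all add: T'_T Dact_def T_T')

lemma Dact_cong: "(\<And>i. i < N \<Longrightarrow> p i = q i) \<Longrightarrow> k < N \<Longrightarrow> Dact p k = Dact q k"
  unfolding Dact_def using T_cong[of p q] by (intro T'_cong) auto

lemma M_linear: "k < N \<Longrightarrow> poly_linear (M k)"
  using good_op_M good_op_linear by blast

text \<open>Both terms have the same coefficient at degree \<open>n\<close>, thanks to the shifts
  \<open>\<kappa>\<close>; this is why D preserves degrees although \<open>T\<close> raises
  them.\<close>

lemma M_intertwine_below: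
  assumes r: "r < N" and c: "c < N" and f: "f \<in> below n"
  shows "M c (X r c * f) - X r c * M r f \<in> below n"
proof (cases "A r c = 0 \<or> f = 0")
  case True
  have "M k 0 = 0" if "k < N" for k using module_hom.zero[OF M_linear[OF that]] .
  with True r c show ?thesis by (auto simp: X_def)
next
  case False
  then obtain m where n: "n = Suc m" using f by (cases n) auto
  have Xf: "X r c * f \<in> below (Suc n)" unfolding X_def using f by (rule below_mult_linear)
  have XM: "X r c * M r f \<in> below (Suc n)"
    unfolding X_def using good_op_below[OF good_op_M[OF r] f] by (rule below_mult_linear)
  have "coeff (M c (X r c * f)) n = diag_coeff (M c) n * coeff (X r c * f) n"
    by (rule good_op_coeff[OF good_op_M[OF c] Xf])
  also have "\<dots> = A r c * (diag_coeff (M r) m * coeff f m)"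
    using False diag_coeff_M_shift[of r c m] r c by (simp add: n X_def)
  also have "\<dots> = A r c * coeff (M r f) m"
    using good_op_coeff[OF good_op_M[OF r] f[unfolded n]] by simp
  also have "\<dots> = coeff (X r c * M r f) n" by (simp add: n X_def)
  finally show ?thesis
    using XM good_op_below[OF good_op_M[OF c] Xf] by (intro below_SucD[OF below_diff]) auto
qed

lemma Dact_expand:
  assumes j: "j < N"
  shows "Dact p j = M j (p j) + (\<Sum>r<N. M j (X r j * p r) - X r j * M r (p r))"
proof -
  interpret Mj: module_hom smult smult "M j" by (rule M_linear[OF j])
  \<comment> \<open>If X_rj is nonzero then \<open>r\<close> is even, and \<open>T\<close> leaves
    even positions unchanged.\<close>
  have *: "X r j * M r (T p r) = X r j * M r (p r)" for r
    by (cases "even r") (simp_all add: X_eq_0 T_def)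
  have "Dact p j = M j (T p j) - (\<Sum>r<N. X r j * M r (p r))"
    by (simp only: Dact_def T'_def *)
  then show ?thesis by (simp add: T_def Mj.add Mj.sum sum_subtractf)
qed

lemma Dact_below:
  assumes p: "p \<in> rows_below n"
  shows "Dact p \<in> rows_below n"
  unfolding rows_below_def
proof (intro CollectI allI impI)
  fix j assume j: "j < N"
  then show "Dact p j \<in> below n"
    unfolding Dact_expand[OF j] using p good_op_below[OF good_op_M[OF j]]
    by (intro below_add below_sum M_intertwine_below) (auto simp: rows_below_def)
qed

text \<open>The coefficients of \<open>M j f\<close> on the diagonal plus
  \<open>M j (X i j * f) - X i j * M i f\<close>. The second derivatives cancel in the latter, so
  the leading coefficient is \<open>\<rho>\<close> times the identity.\<close>

definition Dlist :: dop where
  "Dlist = [mat N N (\<lambda>(i, j). (if i = j then [:\<kappa> j:] else 0) + smult (A i j) (v j) + X i j * [:\<kappa> j - \<kappa> i:]),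
            mat N N (\<lambda>(i, j). (if i = j then v j else 0) + smult (2 * A i j) \<rho> + X i j * (v j - v i)),
            mat N N (\<lambda>(i, j). if i = j then \<rho> else 0)]"

lemma wf_Dlist: "wf_dop N Dlist"
  by (auto simp: wf_dop_def Dlist_def)

lemma M_eq: "k < N \<Longrightarrow> M k f = \<rho> * pderiv (pderiv f) + v k * pderiv f + smult (\<kappa> k) f"
  using pearson.bochner_def[OF pearson_u] by (simp add: M_def)

lemma act_Dlist:
  assumes j: "j < N"
  shows "act (dop_entry Dlist) p j = Dact p j"
proof -
  have e: "dop_entry Dlist i j f = (if i = j then M j f else 0) + (M j (X i j * f) - X i j * M i f)"
    if i: "i < N" for i f
  proof -
    have d: "pderiv (X i j * f) = smult (A i j) f + X i j * pderiv f" for f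
      by (simp add: X_def pderiv_pCons pderiv_smult)
    have two: "smult (A i j * 2) (\<rho> * pderiv f) = smult (A i j) (\<rho> * (pderiv f * 2))"
      by (simp only: mult_2_right distrib_left smult_add_right smult_add_left)
    have "dop_entry Dlist i j f = ((if i = j then [:\<kappa> j:] else 0) + smult (A i j) (v j) + X i j * [:\<kappa> j - \<kappa> i:]) * f
      + ((if i = j then v j else 0) + smult (2 * A i j) \<rho> + X i j * (v j - v i)) * pderiv f
      + (if i = j then \<rho> else 0) * pderiv (pderiv f)"
      using i j by (simp add: dop_entry_def Dlist_def eval_nat_numeral lessThan_Suc)
    also have "\<dots> = (if i = j then M j f else 0) + (M j (X i j * f) - X i j * M i f)"
      unfolding M_eq[OF i] M_eq[OF j] d pderiv_add pderiv_smult
      by (simp add: algebra_simps smult_add_left smult_diff_left X_self two)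
    finally show ?thesis .
  qed
  have "act (dop_entry Dlist) p j = (\<Sum>i<N. (if i = j then M j (p j) else 0) + (M j (X i j * p i) - X i j * M i (p i)))"
    unfolding act_def by (intro sum.cong refl) (auto simp: e)
  then show ?thesis using j by (simp add: Dact_expand sum.distrib)
qed

lemma funpow_dop_act:
  assumes P: "P \<in> carrier_mat N N"
  shows "(dop_act Dlist ^^ m) P = mat N N (\<lambda>(i, j). (Dact ^^ m) (\<lambda>k. P $$ (i, k)) j)"
proof (induction m)
  case 0
  then show ?case using P by (auto intro: eq_matI)
next
  case (Suc m)
  show ?case
    using Suc by (auto simp: dop_act_eq[OF wf_Dlist] act_Dlist intro!: eq_matI Dact_cong)
qed

lemma poly_dop_act_eq:
  assumes P: "P \<in> carrier_mat N N"
  shows "poly_dop_act Q Dlist P = mat N N (\<lambda>(i, j). T' (\<lambda>k. polyop Q (M k) (T (\<lambda>k. P $$ (i, k)) k)) j)"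
proof -
  have "poly_dop_act Q Dlist P = mat N N (\<lambda>(i, k). \<Sum>m\<leftarrow>[0..<Suc (degree Q)]. ([:coeff Q m:] \<cdot>\<^sub>m (dop_act Dlist ^^ m) P) $$ (i, k))"
    unfolding poly_dop_act_def using P by (simp only: carrier_matD) (rule foldr_add_mat, simp add: funpow_dop_act)
  also have "\<dots> = mat N N (\<lambda>(i, j). T' (\<lambda>k. polyop Q (M k) (T (\<lambda>k. P $$ (i, k)) k)) j)"
  proof (intro cong_mat refl, clarify)
    fix i j assume ij: "i < N" "j < N"
    let ?p = "\<lambda>k. P $$ (i, k)"
    have "(\<Sum>m\<leftarrow>[0..<Suc (degree Q)]. ([:coeff Q m:] \<cdot>\<^sub>m (dop_act Dlist ^^ m) P) $$ (i, j)) =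
        (\<Sum>m\<le>degree Q. smult (coeff Q m) (T' (\<lambda>k. (M k ^^ m) (T ?p k)) j))"
      unfolding sum_list_upt lessThan_Suc_atMost
      using ij P by (intro sum.cong refl) (simp add: funpow_dop_act Dact_funpow)
    also have "\<dots> = T' (\<lambda>k. polyop Q (M k) (T ?p k)) j"
      unfolding polyop_def T'_sum by (intro sum.cong refl) (simp add: T'_def smult_diff_right smult_sum2)
    finally show "(\<Sum>m\<leftarrow>[0..<Suc (degree Q)]. ([:coeff Q m:] \<cdot>\<^sub>m (dop_act Dlist ^^ m) P) $$ (i, j)) =
      T' (\<lambda>k. polyop Q (M k) (T ?p k)) j" .
  qed
  finally show ?thesis .
qed

lemma polyop_rows_below:
  assumes p: "p \<in> rows_below n"
  shows "T' (\<lambda>k. polyop Q (M k) (T p k)) \<in> rows_below n"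
proof -
  have "(Dact ^^ m) p \<in> rows_below n" for m
    by (induction m) (auto intro: p Dact_below)
  moreover have "T' (\<lambda>k. polyop Q (M k) (T p k)) j = (\<Sum>m\<le>degree Q. smult (coeff Q m) ((Dact ^^ m) p j))" for j
    unfolding polyop_def T'_sum Dact_funpow by (intro sum.cong refl) (simp add: T'_def smult_diff_right smult_sum2)
  ultimately show ?thesis by (auto simp: rows_below_def intro!: below_sum below_smult)
qed

lemma polyop_M_symmetric:
  assumes k: "k < N"
  shows "u k (polyop Q (M k) f * g) = u k (f * polyop Q (M k) g)"
proof -
  interpret u: module_hom smult "(*)" "u k" by (rule u_linear[OF k])
  have "u k ((M k ^^ m) f * g) = u k (f * (M k ^^ m) g)" for m
  proof (induction m arbitrary: g)
    case (Suc m)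
    have "u k ((M k ^^ Suc m) f * g) = u k ((M k ^^ m) f * M k g)" by (simp add: M_symmetric[OF k])
    also have "\<dots> = u k (f * (M k ^^ m) (M k g))" by (rule Suc)
    finally show ?case by (simp add: funpow_swap1)
  qed simp
  then show ?thesis
    by (simp add: polyop_def sum_distrib_left sum_distrib_right u.sum u.scale)
qed

end

section \<open>Orthogonal polynomials and the algebra D(W)\<close>

locale darboux_weight = darboux +
  fixes W :: "real \<Rightarrow> complex mat" and S :: "real set"
  assumes mip_eq: "P \<in> carrier_mat N N \<Longrightarrow> Q \<in> carrier_mat N N \<Longrightarrow>
    mip N W S P Q = mat N N (\<lambda>(i, j). form (\<lambda>k. P $$ (i, k)) (\<lambda>k. pcnj (Q $$ (j, k))))"
begin

text \<open>\<open>DW\<close> quantifies over all such sequences and would hold of everything if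
  there were none. Row \<open>i\<close> of the n-th polynomial is x^n in position \<open>i\<close>
  minus its projection to lower degrees.\<close>

lemma ex_monic_OPS: "\<exists>Ps. monic_OPS N W S Ps"
proof -
  have "\<exists>s\<in>rows_below n. \<forall>p\<in>rows_below n. form p (unit i (monom 1 n)) = form p s" for n i
    by (rule riesz) (auto intro: form_cong simp: form_sum_left form_smult_left)
  then obtain s where s: "\<And>n i. s n i \<in> rows_below n"
    "\<And>n i p. p \<in> rows_below n \<Longrightarrow> form p (unit i (monom 1 n)) = form p (s n i)"
    by metis
  define R where "R = (\<lambda>n i k. unit i (monom 1 n) k - s n i k)"
  have orth: "form p (R n i) = 0" if "p \<in> rows_below n" for p n i
    using s(2)[OF that] by (simp add: R_def form_diff_right)
  have R_below: "R n i \<in> rows_below (Suc n)" for n i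
  proof -
    have "s n i \<in> rows_below (Suc n)" using s(1)[of n i] rows_below_mono[of n "Suc n"] by auto
    then show ?thesis
      unfolding R_def rows_below_def
      by (intro CollectI allI impI below_diff) (auto simp: unit_def intro: monom_below)
  qed
  have R_coeff: "coeff (R n i k) n = (if i = k then 1 else 0)" if "k < N" for n i k
    using s(1)[of n i] that by (simp add: R_def unit_def rows_below_def below_def)
  define Ps where "Ps = (\<lambda>n. mat N N (\<lambda>(i, k). R n i k))"
  have carr: "Ps n \<in> carrier_mat N N" for n by (simp add: Ps_def)
  have "monic_deg N n (Ps n)" for n
    using R_below[of n] by (auto simp: monic_deg_def Ps_def coeff_mat_def R_coeff rows_below_def below_Suc_iff intro!: eq_matI)
  moreover have "mip N W S (Ps n) (Ps m) = 0\<^sub>m N N" if "n \<noteq> m" for n m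
  proof -
    have "form (\<lambda>k. Ps n $$ (i, k)) (\<lambda>k. pcnj (Ps m $$ (j, k))) = 0" if ij: "i < N" "j < N" for i j
    proof -
      have "form (\<lambda>k. Ps n $$ (i, k)) (\<lambda>k. pcnj (Ps m $$ (j, k))) = form (R n i) (\<lambda>k. pcnj (R m j k))"
        using ij by (intro form_cong) (auto simp: Ps_def)
      also have "\<dots> = 0"
      proof (cases "m < n")
        case True
        then have "R m j \<in> rows_below n" using R_below[of m j] rows_below_mono[of "Suc m" n] by auto
        then have "(\<lambda>k. pcnj (R m j k)) \<in> rows_below n" by (simp add: rows_below_def pcnj_below)
        from orth[OF this] show ?thesis by (simp add: form_commute[of "R n i"])
      next
        case False
        with \<open>n \<noteq> m\<close> have "R n i \<in> rows_below m" using R_below[of n i] rows_below_mono[of "Suc n" m] by auto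
        then have "(\<lambda>k. pcnj (R n i k)) \<in> rows_below m" by (simp add: rows_below_def pcnj_below)
        from orth[OF this, of j] show ?thesis
          using form_pcnj[of "\<lambda>k. pcnj (R n i k)" "R m j"] by simp
      qed
      finally show ?thesis .
    qed
    then show ?thesis unfolding mip_eq[OF carr carr] by (auto intro!: eq_matI)
  qed
  ultimately show ?thesis by (auto simp: monic_OPS_def)
qed

lemma OPS_orthogonal:
  assumes Ps: "monic_OPS N W S Ps" and i: "i < N"
  shows "q \<in> rows_below n \<Longrightarrow> n \<le> m \<Longrightarrow> form (\<lambda>k. Ps m $$ (i, k)) q = 0"
proof (induction n arbitrary: q)
  case 0
  then have "form (\<lambda>k. Ps m $$ (i, k)) q = form (\<lambda>k. Ps m $$ (i, k)) (\<lambda>k. \<Sum>x\<in>({} :: nat set). 0)"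
    by (intro form_cong) (auto simp: rows_below_def)
  then show ?case by (simp only: form_sum_right) simp
next
  case (Suc n)
  have carr: "Ps l \<in> carrier_mat N N" for l using Ps by (simp add: monic_OPS_def monic_deg_def)
  have orth: "form (\<lambda>k. Ps m $$ (i, k)) (\<lambda>k. pcnj (Ps n $$ (l, k))) = 0" if "l < N" for l
  proof -
    have "mip N W S (Ps m) (Ps n) = 0\<^sub>m N N" using Ps Suc.prems by (simp add: monic_OPS_def)
    then have "mip N W S (Ps m) (Ps n) $$ (i, l) = 0" using i that by simp
    then show ?thesis unfolding mip_eq[OF carr carr] using i that by simp
  qed
  \<comment> \<open>\<open>mip\<close> conjugates its second argument, so the conjugate of
    \<open>q\<close> is expanded in the rows of \<open>Ps n\<close> and the expansion is conjugated
    back.\<close>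
  define p where "p = (\<lambda>k. pcnj (q k))"
  have "p \<in> rows_below (Suc n)" using Suc.prems by (simp add: p_def rows_below_def pcnj_below)
  then have "(\<lambda>k. p k - (\<Sum>l<N. smult (coeff (p l) n) (Ps n $$ (l, k)))) \<in> rows_below n"
    using Ps by (intro monic_decomp) (auto simp: monic_OPS_def)
  then have "(\<lambda>k. pcnj (p k - (\<Sum>l<N. smult (coeff (p l) n) (Ps n $$ (l, k))))) \<in> rows_below n" (is "?r \<in> _")
    by (simp add: rows_below_def pcnj_below)
  then have r: "form (\<lambda>k. Ps m $$ (i, k)) ?r = 0" using Suc by simp
  have "q k = ?r k + (\<Sum>l<N. smult (coeff (q l) n) (pcnj (Ps n $$ (l, k))))" for k
    by (simp add: p_def poly_eq_iff coeff_sum)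
  then have "form (\<lambda>k. Ps m $$ (i, k)) q = form (\<lambda>k. Ps m $$ (i, k)) (\<lambda>k. ?r k + (\<Sum>l<N. smult (coeff (q l) n) (pcnj (Ps n $$ (l, k)))))"
    by (rule form_cong[OF refl])
  also have "\<dots> = 0"
    unfolding form_add_right form_sum_right form_smult_right r using orth by simp
  finally show ?case .
qed

text \<open>Subtracting from P_n E the combination of rows of P_n with the same top coefficients
  leaves rows of lower degree. By symmetry these are orthogonal to their own conjugates, hence
  zero.\<close>

lemma DW_I:
  assumes wf: "wf_dop N E"
    and below: "\<And>p n. p \<in> rows_below n \<Longrightarrow> act (dop_entry E) p \<in> rows_below n"
    and sym: "\<And>p q. form (act (dop_entry E) p) q = form p (act (dop_entry E) q)"
  shows "E \<in> DW N W S"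
proof -
  have "\<exists>\<Lambda>\<in>carrier_mat N N. dop_act E (Ps n) = const_pmat \<Lambda> * Ps n" if Ps: "monic_OPS N W S Ps" for Ps n
  proof -
    have md: "monic_deg N n (Ps n)" using Ps by (simp add: monic_OPS_def)
    then have carr: "Ps n \<in> carrier_mat N N" by (simp add: monic_deg_def)
    define Z where "Z = (\<lambda>i. act (dop_entry E) (\<lambda>k. Ps n $$ (i, k)))"
    define \<Lambda> where "\<Lambda> = mat N N (\<lambda>(i, l). coeff (Z i l) n)"
    have eq: "Z i k = (\<Sum>l<N. smult (coeff (Z i l) n) (Ps n $$ (l, k)))" if i: "i < N" and k: "k < N" for i k
    proof -
      define x where "x = (\<lambda>k. Z i k - (\<Sum>l<N. smult (coeff (Z i l) n) (Ps n $$ (l, k))))"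
      have "(\<lambda>k. Ps n $$ (i, k)) \<in> rows_below (Suc n)"
        using md i by (simp add: monic_deg_def rows_below_def below_Suc_iff)
      then have "Z i \<in> rows_below (Suc n)" unfolding Z_def by (rule below)
      then have "x \<in> rows_below n" unfolding x_def by (rule monic_decomp[OF md])
      then have x': "(\<lambda>k. pcnj (x k)) \<in> rows_below n" by (simp add: rows_below_def pcnj_below)
      have "form (Z i) (\<lambda>k. pcnj (x k)) = 0"
        unfolding Z_def sym using OPS_orthogonal[OF Ps i below[OF x']] by simp
      moreover have "form (\<lambda>k. \<Sum>l<N. smult (coeff (Z i l) n) (Ps n $$ (l, k))) (\<lambda>k. pcnj (x k)) = 0"
        unfolding form_sum_left form_smult_left using OPS_orthogonal[OF Ps _ x'] by simp
      ultimately have "form x (\<lambda>k. pcnj (x k)) = 0"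
        unfolding x_def form_diff_left by simp
      then have "x k = 0" using k by (rule form_definite)
      then show ?thesis by (simp add: x_def)
    qed
    have "dop_act E (Ps n) = const_pmat \<Lambda> * Ps n"
    proof (rule eq_matI)
      fix i k assume "i < dim_row (const_pmat \<Lambda> * Ps n)" "k < dim_col (const_pmat \<Lambda> * Ps n)"
      then have ik: "i < N" "k < N" using carr by (auto simp: const_pmat_def \<Lambda>_def)
      have "dop_act E (Ps n) $$ (i, k) = Z i k"
        using ik by (simp add: dop_act_eq[OF wf carr] Z_def)
      also have "\<dots> = (\<Sum>l<N. smult (coeff (Z i l) n) (Ps n $$ (l, k)))" by (rule eq[OF ik])
      also have "\<dots> = (const_pmat \<Lambda> * Ps n) $$ (i, k)"
        using ik carr by (simp add: \<Lambda>_def const_pmat_def scalar_prod_def atLeast0LessThan)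
      finally show "dop_act E (Ps n) $$ (i, k) = (const_pmat \<Lambda> * Ps n) $$ (i, k)" .
    qed (use carr in \<open>auto simp: dop_act_eq[OF wf carr] const_pmat_def \<Lambda>_def\<close>)
    then show ?thesis by (intro bexI[of _ \<Lambda>]) (auto simp: \<Lambda>_def)
  qed
  with wf show ?thesis by (simp add: DW_def)
qed

lemma DW_operator:
  assumes E: "E \<in> DW N W S"
  shows "darboux_operator N u \<rho> v A \<kappa> (dop_entry E)"
proof -
  obtain Ps where Ps: "monic_OPS N W S Ps" using ex_monic_OPS by blast
  have wf: "wf_dop N E" using E by (simp add: DW_def)
  have md: "monic_deg N n (Ps n)" for n using Ps by (simp add: monic_OPS_def)
  then have carr: "Ps n \<in> carrier_mat N N" for n by (simp add: monic_deg_def)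
  have lin: "poly_linear (dop_entry E i j)" for i j by (intro diffop_linear diffop_dop_entry)
  let ?a = "act (dop_entry E)"
  have "\<forall>n. \<exists>\<Lambda>\<in>carrier_mat N N. dop_act E (Ps n) = const_pmat \<Lambda> * Ps n"
    using E Ps by (simp add: DW_def)
  then obtain \<Lambda> where \<Lambda>: "\<And>n. \<Lambda> n \<in> carrier_mat N N" "\<And>n. dop_act E (Ps n) = const_pmat (\<Lambda> n) * Ps n"
    by metis
  have row: "?a (\<lambda>k. Ps n $$ (i, k)) j = (\<Sum>l<N. smult (\<Lambda> n $$ (i, l)) (Ps n $$ (l, j)))" if "i < N" "j < N" for n i j
  proof -
    have "?a (\<lambda>k. Ps n $$ (i, k)) j = dop_act E (Ps n) $$ (i, j)"
      unfolding dop_act_eq[OF wf carr] using that by simp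
    also have "\<dots> = (\<Sum>l<N. smult (\<Lambda> n $$ (i, l)) (Ps n $$ (l, j)))"
      unfolding \<Lambda>(2) using \<Lambda>(1)[of n] carr[of n] that
      by (simp add: const_pmat_def scalar_prod_def atLeast0LessThan)
    finally show ?thesis .
  qed
  have decomp: "\<exists>r\<in>rows_below n. \<forall>k. p k = r k + (\<Sum>i<N. smult (coeff (p i) n) (Ps n $$ (i, k)))"
    if "p \<in> rows_below (Suc n)" for p n
    using monic_decomp[OF md that]
    by (intro bexI[of _ "\<lambda>k. p k - (\<Sum>i<N. smult (coeff (p i) n) (Ps n $$ (i, k)))"]) auto
  have act_decomp: "?a p j = ?a r j + (\<Sum>i<N. smult (c i) (?a (\<lambda>k. Ps n $$ (i, k)) j))"
    if "\<forall>k. p k = r k + (\<Sum>i<N. smult (c i) (Ps n $$ (i, k)))" for p r n c j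
  proof -
    have "p = (\<lambda>k. r k + (\<Sum>i<N. smult (c i) (Ps n $$ (i, k))))" using that by auto
    then show ?thesis by (simp only: act_add[OF lin] act_sum[OF lin] act_smult[OF lin])
  qed
  have below: "?a p \<in> rows_below n" if "p \<in> rows_below n" for p n
    using that
  proof (induction n arbitrary: p)
    case 0
    then show ?case by (simp add: rows_below_def act_def module_hom.zero[OF lin])
  next
    case (Suc n)
    obtain r where r: "r \<in> rows_below n" "\<forall>k. p k = r k + (\<Sum>i<N. smult (coeff (p i) n) (Ps n $$ (i, k)))"
      using decomp[OF Suc.prems] by blast
    have "?a r \<in> rows_below (Suc n)" using Suc.IH[OF r(1)] rows_below_mono[of n "Suc n"] by auto
    moreover have "?a (\<lambda>k. Ps n $$ (i, k)) j \<in> below (Suc n)" if "i < N" "j < N" for i j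
      unfolding row[OF that] using md[of n] that
      by (intro below_sum below_smult) (auto simp: monic_deg_def below_Suc_iff)
    ultimately show ?case
      unfolding rows_below_def using act_decomp[OF r(2)]
      by (auto intro!: below_add below_sum below_smult)
  qed
  have adj: "\<exists>s\<in>rows_below n. \<forall>p. form (?a p) q = form p s" if q: "q \<in> rows_below n" for q n
  proof -
    \<comment> \<open>In bounded degree the adjoint exists by duality; the identity is extended to
      all degrees afterwards.\<close>
    have "\<exists>s\<in>rows_below n. \<forall>p\<in>rows_below n. form (?a p) q = form p s"
    proof (rule riesz)
      show "form (?a p) q = form (?a p') q" if "\<And>k. k < N \<Longrightarrow> p k = p' k" for p p'
        by (rule form_cong) (auto intro: act_cong that)
      show "form (?a (\<lambda>k. \<Sum>x\<in>I. smult (c x) (P x k))) q = (\<Sum>x\<in>I. c x * form (?a (P x)) q)" for I :: "(nat \<times> nat) set" and c P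
      proof -
        have "?a (\<lambda>k. \<Sum>x\<in>I. smult (c x) (P x k)) = (\<lambda>m. \<Sum>x\<in>I. smult (c x) (?a (P x) m))"
          by (simp add: fun_eq_iff act_sum[OF lin] act_smult[OF lin])
        then show ?thesis by (simp only: form_sum_left form_smult_left)
      qed
    qed
    then obtain s where s: "s \<in> rows_below n" "\<And>p. p \<in> rows_below n \<Longrightarrow> form (?a p) q = form p s" by blast
    have "form (?a p) q = form p s" if "p \<in> rows_below m" "n \<le> m" for p m
      using that(2,1)
    proof (induction m arbitrary: p rule: dec_induct)
      case base
      then show ?case using s by simp
    next
      case (step m)
      obtain r where r: "r \<in> rows_below m" "\<forall>k. p k = r k + (\<Sum>i<N. smult (coeff (p i) m) (Ps m $$ (i, k)))"
        using decomp[OF step.prems] by blast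
      have o: "form (\<lambda>k. Ps m $$ (i, k)) t = 0" if "i < N" "t \<in> rows_below n" for i t
        using OPS_orthogonal[OF Ps that \<open>n \<le> m\<close>] .
      \<comment> \<open>\<open>E\<close> maps rows of \<open>Ps m\<close> to combinations of rows of
        \<open>Ps m\<close>, which remain orthogonal to \<open>q\<close>; they contribute to neither
        side.\<close>
      have z: "form (?a (\<lambda>k. Ps m $$ (i, k))) q = 0" if i: "i < N" for i
      proof -
        have "form (?a (\<lambda>k. Ps m $$ (i, k))) q = form (\<lambda>j. \<Sum>l<N. smult (\<Lambda> m $$ (i, l)) (Ps m $$ (l, j))) q"
          using i by (intro form_cong) (auto simp: row)
        then show ?thesis by (simp add: form_sum_left form_smult_left o q)
      qed
      have "form (?a p) q = form (\<lambda>j. ?a r j + (\<Sum>i<N. smult (coeff (p i) m) (?a (\<lambda>k. Ps m $$ (i, k)) j))) q"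
        by (rule form_cong[OF act_decomp[OF r(2)] refl])
      also have "\<dots> = form (?a r) q"
        unfolding form_add_left form_sum_left form_smult_left using z by simp
      also have "\<dots> = form r s" by (rule step.IH[OF r(1)])
      also have "\<dots> = form p s"
      proof -
        have "form p s = form (\<lambda>k. r k + (\<Sum>i<N. smult (coeff (p i) m) (Ps m $$ (i, k)))) s"
          by (rule form_cong[OF r(2)[rule_format] refl])
        also have "\<dots> = form r s"
          unfolding form_add_left form_sum_left form_smult_left using o s by simp
        finally show ?thesis by simp
      qed
      finally show ?case .
    qed
    then have "form (?a p) q = form p s" for p using ex_rows_below[of n p] by blast
    with s show ?thesis by blast
  qed
  show ?thesis
    by unfold_locales (use below adj diffop_dop_entry in auto)
qed

text \<open>Each \<open>M k\<close> is symmetric for \<open>u k\<close>, so a polynomial in D is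
  symmetric for \<open>form\<close> and \<open>DW_I\<close> applies.\<close>

lemma polyop_in_DW:
  assumes wf: "wf_dop N E" and E: "\<And>p j. j < N \<Longrightarrow> act (dop_entry E) p j = T' (\<lambda>k. polyop Q (M k) (T p k)) j"
  shows "E \<in> DW N W S"
proof (rule DW_I[OF wf])
  show "act (dop_entry E) p \<in> rows_below n" if "p \<in> rows_below n" for p n
    using polyop_rows_below[OF that, of Q] by (simp add: rows_below_def E)
  have f: "form (act (dop_entry E) p) q = (\<Sum>k<N. u k (polyop Q (M k) (T p k) * T q k))" for p q
  proof -
    have "form (act (dop_entry E) p) q = form (T' (\<lambda>k. polyop Q (M k) (T p k))) q"
      by (intro form_cong) (auto simp: E)
    then show ?thesis by (simp add: form_def T_T')
  qed
  show "form (act (dop_entry E) p) q = form p (act (dop_entry E) q)" for p q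
    unfolding form_commute[of p] f
    by (intro sum.cong refl, subst polyop_M_symmetric) (simp_all add: mult.commute)
qed

lemma Dlist_in_DW: "Dlist \<in> DW N W S"
  by (rule polyop_in_DW[OF wf_Dlist, of "[:0, 1:]"])
    (simp add: act_Dlist Dact_def polyop_def)

theorem DW_eq_poly_algebra: "DW N W S = poly_algebra N Dlist"
proof (intro equalityI subsetI)
  fix E assume E: "E \<in> DW N W S"
  interpret darboux_operator N u \<rho> v A \<kappa> "dop_entry E" by (rule DW_operator[OF E])
  have wf: "wf_dop N E" using E by (simp add: DW_def)
  obtain Q where Q: "\<And>p j. j < N \<Longrightarrow> act (dop_entry E) p j = T' (\<lambda>k. polyop Q (M k) (T p k)) j"
    using act_eq_polyop by blast
  have "dop_act E P = poly_dop_act Q Dlist P" if "P \<in> carrier_mat N N" for P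
    unfolding dop_act_eq[OF wf that] poly_dop_act_eq[OF that] by (intro cong_mat) (auto simp: Q)
  with wf show "E \<in> poly_algebra N Dlist" by (auto simp: poly_algebra_def)
next
  fix E assume "E \<in> poly_algebra N Dlist"
  then obtain Q where wf: "wf_dop N E" and Q: "\<And>P. P \<in> carrier_mat N N \<Longrightarrow> dop_act E P = poly_dop_act Q Dlist P"
    by (auto simp: poly_algebra_def)
  show "E \<in> DW N W S"
  proof (rule polyop_in_DW[OF wf])
    fix p j assume j: "j < N"
    \<comment> \<open>Every row of this matrix is \<open>p\<close>, so an identity between matrices
      yields one for an arbitrary row.\<close>
    define P where "P = mat N N (\<lambda>(i :: nat, k). p k :: complex poly)"
    have P: "P \<in> carrier_mat N N" by (simp add: P_def)
    have "dop_act E P $$ (0, j) = poly_dop_act Q Dlist P $$ (0, j)" using Q[OF P] by simp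
    then have "act (dop_entry E) (\<lambda>k. P $$ (0, k)) j = T' (\<lambda>k. polyop Q (M k) (T (\<lambda>k. P $$ (0, k)) k)) j"
      unfolding dop_act_eq[OF wf P] poly_dop_act_eq[OF P] using j N_pos by simp
    moreover have "act (dop_entry E) (\<lambda>k. P $$ (0, k)) j = act (dop_entry E) p j"
      using N_pos by (intro act_cong) (simp add: P_def)
    moreover have "T (\<lambda>k. P $$ (0, k)) k = T p k" if "k < N" for k
      using N_pos that by (intro T_cong) (auto simp: P_def)
    then have "T' (\<lambda>k. polyop Q (M k) (T (\<lambda>k. P $$ (0, k)) k)) j = T' (\<lambda>k. polyop Q (M k) (T p k)) j"
      using j by (intro T'_cong) auto
    ultimately show "act (dop_entry E) p j = T' (\<lambda>k. polyop Q (M k) (T p k)) j" by simp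
  qed
qed

end

section \<open>The classical weights\<close>

definition weight_functional :: "real set \<Rightarrow> (real \<Rightarrow> real) \<Rightarrow> complex poly \<Rightarrow> complex" where
  "weight_functional S w f = integral S (\<lambda>x. poly f (complex_of_real x) * complex_of_real (w x))"

text \<open>For each family \<open>t\<close> is a point about which the moments have a closed form.
  The interval from \<open>c\<close> to \<open>d\<close> serves to obtain definiteness from
  continuity and positivity.\<close>

locale weight_moments =
  fixes S :: "real set" and w :: "real \<Rightarrow> real" and t :: real and \<mu> :: "nat \<Rightarrow> real" and c d :: real
  assumes moments: "((\<lambda>x. (x - t) ^ n * w x) has_integral \<mu> n) S"
    and w_pos: "x \<in> S \<Longrightarrow> w x > 0" and w_cont: "continuous_on S w"
    and interval: "c < d" "{c..d} \<subseteq> S"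
begin

abbreviation "U \<equiv> weight_functional S w"

text \<open>The extra power makes the induction close: x = (x - t) + t raises or keeps the exponent
  \<open>n\<close>.\<close>

lemma integrable_shifted:
  "(\<lambda>x. complex_of_real ((x - t) ^ n * w x) * poly f (complex_of_real x)) integrable_on S"
proof (induction f arbitrary: n)
  case 0
  then show ?case by (simp add: integrable_0)
next
  case (pCons a f)
  have 1: "(\<lambda>x. a * complex_of_real ((x - t) ^ n * w x)) integrable_on S"
    using has_integral_of_real[OF moments[of n], where 'b = complex]
    by (intro integrable_on_mult_right) (auto simp: integrable_on_def)
  have 2: "(\<lambda>x. complex_of_real ((x - t) ^ Suc n * w x) * poly f (complex_of_real x)) integrable_on S"
    by (rule pCons)
  have 3: "(\<lambda>x. complex_of_real t * (complex_of_real ((x - t) ^ n * w x) * poly f (complex_of_real x))) integrable_on S"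
    by (intro integrable_on_mult_right pCons)
  show ?case
    using integrable_add[OF integrable_add[OF 1 2] 3] by (rule integrable_eq) (simp add: algebra_simps)
qed

lemma integrable: "(\<lambda>x. poly f (complex_of_real x) * complex_of_real (w x)) integrable_on S"
  using integrable_shifted[of 0 f] by (simp add: mult.commute)

lemma U_linear: "poly_functional U"
proof (rule poly_functionalI)
  show "U (f + g) = U f + U g" for f g
    unfolding weight_functional_def
    by (subst integral_add[OF integrable integrable, symmetric]) (simp add: distrib_right)
  show "U (smult a f) = a * U f" for a f
    by (simp add: weight_functional_def mult.assoc)
qed

sublocale U: module_hom smult "(*)" U
  by (rule U_linear)

lemma U_moment: "U ([:- complex_of_real t, 1:] ^ n) = complex_of_real (\<mu> n)"
proof -
  have "((\<lambda>x. complex_of_real ((x - t) ^ n * w x)) has_integral complex_of_real (\<mu> n)) S"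
    by (rule has_integral_of_real[OF moments])
  then have "integral S (\<lambda>x. complex_of_real ((x - t) ^ n * w x)) = complex_of_real (\<mu> n)"
    by (rule integral_unique)
  then show ?thesis by (simp add: weight_functional_def)
qed

lemma U_cnj: "U (pcnj f) = cnj (U f)"
  by (simp add: weight_functional_def integral_cnj poly_pcnj)

lemma U_norm: "U (f * pcnj f) = complex_of_real (integral S (\<lambda>x. (cmod (poly f (complex_of_real x)))\<^sup>2 * w x))"
    (is "_ = complex_of_real (integral S ?g)")
  and integrable_norm: "(\<lambda>x. (cmod (poly f (complex_of_real x)))\<^sup>2 * w x) integrable_on S"
proof -
  have eq: "poly (f * pcnj f) (complex_of_real x) * complex_of_real (w x) = complex_of_real (?g x)" for x
    unfolding poly_mult poly_pcnj of_real_mult complex_norm_square ..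
  have "(\<lambda>x. complex_of_real (?g x)) integrable_on S" using integrable[of "f * pcnj f"] unfolding eq .
  from integrable_linear[OF this bounded_linear_Re] show int: "?g integrable_on S" by (simp add: o_def)
  show "U (f * pcnj f) = complex_of_real (integral S ?g)"
    unfolding weight_functional_def eq
    using has_integral_of_real[OF integrable_integral[OF int], where 'b = complex] by (rule integral_unique)
qed

lemma U_nonneg: "Re (U (f * pcnj f)) \<ge> 0"
  unfolding U_norm using w_pos by (auto intro!: integral_nonneg integrable_norm simp: less_imp_le)

lemma U_definite: "definite U"
  unfolding definite_def
proof (intro allI impI)
  fix f assume "U (f * pcnj f) = 0"
  let ?g = "\<lambda>x. (cmod (poly f (complex_of_real x)))\<^sup>2 * w x"
  have z: "integral S ?g = 0" using \<open>U (f * pcnj f) = 0\<close> by (simp add: U_norm)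
  have cont: "continuous_on {c..d} ?g"
    by (intro continuous_intros continuous_on_subset[OF w_cont interval(2)])
  have nonneg: "?g x \<ge> 0" if "x \<in> S" for x using w_pos[OF that] by simp
  have "integral {c..d} ?g \<le> integral S ?g"
    using interval nonneg cont by (intro integral_subset_le integrable_norm integrable_continuous_real) auto
  moreover have "integral {c..d} ?g \<ge> 0"
    using interval nonneg cont by (intro integral_nonneg integrable_continuous_real) auto
  ultimately have "integral {c..d} ?g = 0" using z by simp
  moreover have "integral {c..d} ?g = 0 \<longleftrightarrow> (\<forall>x\<in>{c..d}. ?g x = 0)"
    by (rule integral_eq_0_iff[OF cont interval(1)]) (use nonneg interval(2) in auto)
  ultimately have "\<forall>x\<in>{c..d}. ?g x = 0" by simp
  then have "poly f (complex_of_real x) = 0" if "x \<in> {c..d}" for x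
    using w_pos[of x] that interval(2) by force
  then have "complex_of_real ` {c..d} \<subseteq> {x. poly f x = 0}" by auto
  moreover have "infinite (complex_of_real ` {c..d})"
    using interval(1) by (subst finite_image_iff) (auto intro: inj_onI)
  ultimately show "f = 0" using poly_roots_finite finite_subset by blast
qed

text \<open>Powers of x - t span all polynomials, so the Pearson identity reduces to a recursion for
  moments.\<close>

lemma pearsonI:
  assumes "\<And>n. U (\<rho> * pderiv ([:- complex_of_real t, 1:] ^ n) + v * [:- complex_of_real t, 1:] ^ n) = 0"
    and "degree \<rho> \<le> 2" "degree v \<le> 1"
  shows "pearson U \<rho> v"
proof
  let ?x = "[:- complex_of_real t, 1:]"
  define \<Lambda> where "\<Lambda> = (\<lambda>f. U (\<rho> * pderiv f + v * f))"
  have add: "\<Lambda> (f + g) = \<Lambda> f + \<Lambda> g" for f g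
    unfolding \<Lambda>_def U.add[symmetric] by (simp add: pderiv_add algebra_simps)
  have scale: "\<Lambda> (smult a f) = a * \<Lambda> f" for a f
    unfolding \<Lambda>_def U.scale[symmetric] by (simp add: pderiv_smult smult_add_right)
  have "\<Lambda> (?x ^ n * f) = 0" for n f
  proof (induction f arbitrary: n)
    case 0
    then show ?case using scale[of 0 0] by simp
  next
    case (pCons a f)
    have e: "pCons a f = smult a 1 + ?x * f + smult (complex_of_real t) f" by simp
    have "?x ^ n * pCons a f = smult a (?x ^ n) + ?x ^ Suc n * f + smult (complex_of_real t) (?x ^ n * f)"
      unfolding e distrib_left power_Suc mult_smult_right mult_1_right by (simp only: mult_ac)
    then show ?case
      by (simp only: add scale pCons.IH) (simp add: \<Lambda>_def assms(1))
  qed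
  from this[of 0] show "U (\<rho> * pderiv f + v * f) = 0" for f by (simp add: \<Lambda>_def)
qed (use assms U_linear U_definite in auto)

end

lemma pderiv_linear_power: "pderiv ([:- a, 1:] ^ n) = smult (of_nat n) ([:- a, 1:] ^ (n - 1))"
  for a :: "'a::field_char_0"
proof (cases n)
  case (Suc m)
  then show ?thesis using pderiv_power_Suc[of "[:- a, 1:]" m] by (simp add: pderiv_pCons)
qed simp

section \<open>Moments and Pearson identities of the three families\<close>

fun rho_poly :: "family \<Rightarrow> complex poly" where
  "rho_poly Hermite = 1"
| "rho_poly Laguerre = [:0, 1:]"
| "rho_poly Jacobi = [:1, 0, -1:]"

text \<open>This is (\<rho> w)' / w for the respective weight w.\<close>

fun drift_poly :: "family \<Rightarrow> real \<Rightarrow> real \<Rightarrow> complex poly" where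
  "drift_poly Hermite b _ = [:complex_of_real (2 * b), - 2:]"
| "drift_poly Laguerre \<alpha> _ = [:complex_of_real (\<alpha> + 1), - 1:]"
| "drift_poly Jacobi \<alpha> \<beta> = [:complex_of_real (\<beta> - \<alpha>), - complex_of_real (\<alpha> + \<beta> + 2):]"

fun valid_parameter :: "family \<Rightarrow> real \<Rightarrow> real \<Rightarrow> bool" where
  "valid_parameter Hermite _ _ \<longleftrightarrow> True"
| "valid_parameter Laguerre \<alpha> _ \<longleftrightarrow> \<alpha> > -1"
| "valid_parameter Jacobi \<alpha> \<beta> \<longleftrightarrow> \<alpha> > -1 \<and> \<beta> > -1"

text \<open>Completing the square turns the weight into e^(b^2) sqrt(pi) times the normal density
  with mean \<open>b\<close> and variance 1/2, whose central moments appear here.\<close>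

definition hermite_moment :: "real \<Rightarrow> nat \<Rightarrow> real" where
  "hermite_moment b n = exp (b\<^sup>2) * sqrt pi * (if even n then fact n / (4 ^ (n div 2) * fact (n div 2)) else 0)"

lemma hermite_moments:
  "((\<lambda>x. (x - b) ^ n * scalar_weight Hermite b q x) has_integral hermite_moment b n) UNIV"
proof -
  have w: "(x - b) ^ n * scalar_weight Hermite b q x =
      exp (b\<^sup>2) * sqrt pi * (normal_density b (1 / sqrt 2) x * (x - b) ^ n)" for x
  proof -
    have "normal_density b (1 / sqrt 2) x = 1 / sqrt pi * exp (- (x - b)\<^sup>2)"
      by (simp add: normal_density_def power_divide)
    moreover have "exp (- x\<^sup>2 + 2 * b * x) = exp (b\<^sup>2) * exp (- (x - b)\<^sup>2)"
      by (simp add: power2_diff flip: exp_add)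
    ultimately show ?thesis by simp
  qed
  have "has_bochner_integral lborel (\<lambda>x. normal_density b (1 / sqrt 2) x * (x - b) ^ n)
      (if even n then fact n / (4 ^ (n div 2) * fact (n div 2)) else 0)"
  proof (cases "even n")
    case True
    then obtain k where "n = 2 * k" by blast
    then show ?thesis using normal_moment_even[of "1 / sqrt 2" b k] by (simp add: power_divide)
  next
    case False
    then obtain k where "n = 2 * k + 1" using oddE by blast
    then show ?thesis using normal_moment_odd[of "1 / sqrt 2" b k] by simp
  qed
  then have "((\<lambda>x. normal_density b (1 / sqrt 2) x * (x - b) ^ n) has_integral
      (if even n then fact n / (4 ^ (n div 2) * fact (n div 2)) else 0)) UNIV"
    using has_integral_integral_real[of "\<lambda>x. normal_density b (1 / sqrt 2) x * (x - b) ^ n"]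
    by (simp only: has_bochner_integral_iff)
  then show ?thesis unfolding w hermite_moment_def by (rule has_integral_mult_right)
qed

lemma hermite_moment_rec: "of_nat n * hermite_moment b (n - 1) = 2 * hermite_moment b (Suc n)"
proof (cases "even n")
  case True
  then show ?thesis by (cases n) (auto simp: hermite_moment_def)
next
  case False
  then obtain k where n: "n = 2 * k + 1" using oddE by blast
  have "fact (2 * k + 2) = (2 * real k + 2) * (2 * real k + 1) * fact (2 * k)"
    by (simp add: algebra_simps)
  then show ?thesis
    by (simp add: n hermite_moment_def field_simps del: fact_Suc) (simp add: field_simps)
qed

lemma weight_moments_hermite:
  "weight_moments UNIV (scalar_weight Hermite b q) b (hermite_moment b) 0 1"
proof
  show "((\<lambda>x. (x - b) ^ n * scalar_weight Hermite b q x) has_integral hermite_moment b n) UNIV" for n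
    by (rule hermite_moments)
qed (auto intro!: continuous_intros)

lemma laguerre_moments:
  assumes "\<alpha> > -1"
  shows "((\<lambda>x. (x - 0) ^ n * scalar_weight Laguerre \<alpha> q x) has_integral Gamma (\<alpha> + 1 + of_nat n)) {0<..}"
proof -
  have "((\<lambda>t. t powr (\<alpha> + 1 + of_nat n - 1) / exp t) has_integral Gamma (\<alpha> + 1 + of_nat n)) {0..}"
    using assms by (intro Gamma_integral_real) linarith
  then have "((\<lambda>t. t powr (\<alpha> + of_nat n) / exp t) has_integral Gamma (\<alpha> + 1 + of_nat n)) {0<..}"
    by (subst has_integral_spike_set_eq[where T = "{0..}"])
      (auto intro: negligible_subset[of "{0}"] simp: algebra_simps)
  moreover have "t powr (\<alpha> + of_nat n) / exp t = (t - 0) ^ n * scalar_weight Laguerre \<alpha> q t" if "t \<in> {0<..}" for t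
    using that by (simp add: powr_add powr_realpow exp_minus field_simps)
  ultimately show ?thesis by (rule has_integral_eq[rotated])
qed

lemma weight_moments_laguerre:
  assumes "\<alpha> > -1"
  shows "weight_moments {0<..} (scalar_weight Laguerre \<alpha> q) 0 (\<lambda>n. Gamma (\<alpha> + 1 + of_nat n)) 1 2"
proof
  show "((\<lambda>x. (x - 0) ^ n * scalar_weight Laguerre \<alpha> q x) has_integral Gamma (\<alpha> + 1 + of_nat n)) {0<..}" for n
    by (rule laguerre_moments[OF assms])
qed (auto intro!: continuous_intros)

text \<open>The substitution x = 2 t - 1 gives a Beta integral; the powers of 2 come from 1 + x = 2
  t, 1 - x = 2 (1 - t) and dx = 2 dt.\<close>

definition jacobi_moment :: "real \<Rightarrow> real \<Rightarrow> nat \<Rightarrow> real" where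
  "jacobi_moment \<alpha> \<beta> n = 2 powr (\<alpha> + \<beta> + 1) * 2 ^ n * Beta (\<alpha> + 1) (\<beta> + 1 + of_nat n)"

lemma jacobi_moments:
  assumes "\<alpha> > -1" "\<beta> > -1"
  shows "((\<lambda>x. (x - (- 1)) ^ n * scalar_weight Jacobi \<alpha> \<beta> x) has_integral jacobi_moment \<alpha> \<beta> n) {-1<..<1}"
proof -
  let ?a = "\<beta> + 1 + of_nat n" and ?b = "\<alpha> + 1"
  let ?f = "\<lambda>t::real. t powr (?a - 1) * (1 - t) powr (?b - 1)"
  have "(?f has_integral Beta ?a ?b) (cbox 0 1)"
    using has_integral_Beta_real[of ?a ?b] assms by simp
  from has_integral_affinity'[OF this, of "1 / 2" "1 / 2"]
  have "((\<lambda>x. ?f ((x + 1) / 2)) has_integral 2 * Beta ?a ?b) {-1..1}"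
    by (simp add: field_simps)
  then have "((\<lambda>x. ?f ((x + 1) / 2)) has_integral 2 * Beta ?a ?b) {-1<..<1}"
    by (simp only: has_integral_Icc_iff_Ioo)
  then have "((\<lambda>x. (2 powr (\<alpha> + \<beta>) * 2 ^ n) * ?f ((x + 1) / 2)) has_integral (2 powr (\<alpha> + \<beta>) * 2 ^ n) * (2 * Beta ?a ?b)) {-1<..<1}"
    by (rule has_integral_mult_right)
  moreover have "(2 powr (\<alpha> + \<beta>) * 2 ^ n) * ?f ((x + 1) / 2) = (x - (- 1)) ^ n * scalar_weight Jacobi \<alpha> \<beta> x"
    if "x \<in> {-1<..<1}" for x
  proof -
    have x: "1 + x > 0" "1 - x > 0" using that by auto
    have h: "1 - (x + 1) / 2 = (1 - x) / 2" by (simp add: field_simps)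
    have "?f ((x + 1) / 2) = ((1 + x) powr (\<beta> + of_nat n) / 2 powr (\<beta> + of_nat n)) * ((1 - x) powr \<alpha> / 2 powr \<alpha>)"
      unfolding h using x by (simp add: powr_divide add.commute)
    moreover have "2 powr (\<alpha> + \<beta>) * 2 ^ n = 2 powr (\<beta> + of_nat n) * 2 powr \<alpha>"
      by (simp add: powr_add powr_realpow)
    moreover have "(1 + x) powr (\<beta> + of_nat n) = (x - (- 1)) ^ n * (1 + x) powr \<beta>"
      using x by (simp add: powr_add powr_realpow add.commute)
    ultimately show ?thesis by simp
  qed
  ultimately have "((\<lambda>x. (x - (- 1)) ^ n * scalar_weight Jacobi \<alpha> \<beta> x) has_integral (2 powr (\<alpha> + \<beta>) * 2 ^ n) * (2 * Beta ?a ?b)) {-1<..<1}"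
    by (rule has_integral_eq[rotated])
  moreover have "(2 powr (\<alpha> + \<beta>) * 2 ^ n) * (2 * Beta ?a ?b) = jacobi_moment \<alpha> \<beta> n"
    by (simp add: jacobi_moment_def powr_add Beta_commute)
  ultimately show ?thesis by simp
qed

lemma jacobi_moment_rec:
  assumes "\<alpha> > -1" "\<beta> > -1"
  shows "2 * (of_nat n + \<beta> + 1) * jacobi_moment \<alpha> \<beta> n = (of_nat n + \<alpha> + \<beta> + 2) * jacobi_moment \<alpha> \<beta> (Suc n)"
proof -
  let ?y = "\<beta> + 1 + of_nat n"
  have "?y > 0" using assms by linarith
  then have "?y \<notin> \<int>\<^sub>\<le>\<^sub>0" by (auto elim!: nonpos_Ints_cases)
  from Beta_plus1_right[OF this, of "\<alpha> + 1"]
  have B: "(of_nat n + \<alpha> + \<beta> + 2) * Beta (\<alpha> + 1) (\<beta> + 1 + of_nat (Suc n)) = (of_nat n + \<beta> + 1) * Beta (\<alpha> + 1) ?y"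
    by (simp add: algebra_simps)
  have "(of_nat n + \<alpha> + \<beta> + 2) * jacobi_moment \<alpha> \<beta> (Suc n) =
      2 powr (\<alpha> + \<beta> + 1) * 2 ^ Suc n * ((of_nat n + \<alpha> + \<beta> + 2) * Beta (\<alpha> + 1) (\<beta> + 1 + of_nat (Suc n)))"
    by (simp only: jacobi_moment_def mult_ac)
  also have "\<dots> = 2 * (of_nat n + \<beta> + 1) * jacobi_moment \<alpha> \<beta> n"
    unfolding B jacobi_moment_def by (simp add: mult_ac)
  finally show ?thesis by simp
qed

lemma weight_moments_jacobi:
  assumes "\<alpha> > -1" "\<beta> > -1"
  shows "weight_moments {-1<..<1} (scalar_weight Jacobi \<alpha> \<beta>) (- 1) (jacobi_moment \<alpha> \<beta>) 0 (1 / 2)"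
proof
  show "((\<lambda>x. (x - (- 1)) ^ n * scalar_weight Jacobi \<alpha> \<beta> x) has_integral jacobi_moment \<alpha> \<beta> n) {-1<..<1}" for n
    by (rule jacobi_moments[OF assms])
qed (auto intro!: continuous_intros)

lemma ex_weight_moments:
  "valid_parameter fam p q \<Longrightarrow> \<exists>t \<mu> c d. weight_moments (support fam) (scalar_weight fam p q) t \<mu> c d"
  using weight_moments_hermite weight_moments_laguerre weight_moments_jacobi
  by (cases fam) (simp; blast)+

text \<open>On powers of x - t this is a two-term recursion for the moments, which comes from the
  functional equation of Gamma or Beta, or from the factorials in the Hermite case.\<close>

lemma pearson_weight:
  assumes "valid_parameter fam p q"
  shows "pearson (weight_functional (support fam) (scalar_weight fam p q)) (rho_poly fam) (drift_poly fam p q)"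
proof (cases fam)
  case Hermite
  interpret weight_moments UNIV "scalar_weight Hermite p q" p "hermite_moment p" 0 1
    by (rule weight_moments_hermite)
  let ?x = "[:- complex_of_real p, 1:]"
  have "pearson U (rho_poly Hermite) (drift_poly Hermite p q)"
  proof (rule pearsonI)
    fix n
    have d: "drift_poly Hermite p q = smult (- 2) ?x" by simp
    have "rho_poly Hermite * pderiv (?x ^ n) + drift_poly Hermite p q * ?x ^ n =
        smult (of_nat n) (?x ^ (n - 1)) - smult 2 (?x ^ Suc n)"
      unfolding d pderiv_linear_power by (simp del: mult_pCons_left mult_pCons_right smult_pCons)
    also have "U \<dots> = complex_of_real (of_nat n * hermite_moment p (n - 1) - 2 * hermite_moment p (Suc n))"
      unfolding U.diff U.scale U_moment by simp
    also have "\<dots> = 0" by (simp only: hermite_moment_rec) simp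
    finally show "U (rho_poly Hermite * pderiv (?x ^ n) + drift_poly Hermite p q * ?x ^ n) = 0" .
  qed auto
  then show ?thesis by (simp add: Hermite)
next
  case Laguerre
  then have \<alpha>: "p > -1" using assms by simp
  interpret weight_moments "{0<..}" "scalar_weight Laguerre p q" 0 "\<lambda>n. Gamma (p + 1 + of_nat n)" 1 2
    by (rule weight_moments_laguerre[OF \<alpha>])
  let ?x = "[:- complex_of_real 0, 1:]"
  have "pearson U (rho_poly Laguerre) (drift_poly Laguerre p q)"
  proof (rule pearsonI)
    fix n
    have "rho_poly Laguerre * pderiv (?x ^ n) = smult (of_nat n) (?x ^ n)"
      unfolding pderiv_linear_power by (cases n) simp_all
    moreover have "drift_poly Laguerre p q * ?x ^ n = smult (complex_of_real (p + 1)) (?x ^ n) - ?x ^ Suc n"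
      by (simp add: algebra_simps)
    ultimately have "rho_poly Laguerre * pderiv (?x ^ n) + drift_poly Laguerre p q * ?x ^ n =
        smult (complex_of_real (p + 1 + of_nat n)) (?x ^ n) - ?x ^ Suc n"
      by (simp add: smult_add_left)
    also have "U \<dots> = complex_of_real ((p + 1 + of_nat n) * Gamma (p + 1 + of_nat n) - Gamma (p + 1 + of_nat (Suc n)))"
      unfolding U.diff U.scale U_moment by simp
    also have "Gamma (p + 1 + of_nat (Suc n)) = (p + 1 + of_nat n) * Gamma (p + 1 + of_nat n)"
    proof -
      have "p + 1 + of_nat n \<notin> \<int>\<^sub>\<le>\<^sub>0" using \<alpha> by (auto elim!: nonpos_Ints_cases)
      then show ?thesis using Gamma_plus1[of "p + 1 + of_nat n"] by (simp add: algebra_simps)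
    qed
    finally show "U (rho_poly Laguerre * pderiv (?x ^ n) + drift_poly Laguerre p q * ?x ^ n) = 0"
      by (simp only: diff_self of_real_0)
  qed auto
  then show ?thesis by (simp add: Laguerre)
next
  case Jacobi
  then have \<alpha>\<beta>: "p > -1" "q > -1" using assms by auto
  interpret weight_moments "{-1<..<1}" "scalar_weight Jacobi p q" "- 1" "jacobi_moment p q" 0 "1 / 2"
    by (rule weight_moments_jacobi[OF \<alpha>\<beta>])
  let ?x = "[:- complex_of_real (- 1), 1:]"
  have "pearson U (rho_poly Jacobi) (drift_poly Jacobi p q)"
  proof (rule pearsonI)
    fix n
    \<comment> \<open>In terms of y = 1 + x, \<open>\<rho>\<close> is (2 - y) y and the drift is a
      combination of 2 - y and y, so only the moments \<open>n\<close> and n + 1 occur.\<close>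
    have "rho_poly Jacobi = (2 - ?x) * ?x" by (simp add: numeral_poly)
    then have r: "rho_poly Jacobi * pderiv (?x ^ n) = smult (of_nat n) ((2 - ?x) * ?x ^ n)"
      unfolding pderiv_linear_power by (cases n) (simp_all add: mult_ac del: mult_pCons_left mult_pCons_right)
    have d: "drift_poly Jacobi p q = smult (complex_of_real (q + 1)) (2 - ?x) - smult (complex_of_real (p + 1)) ?x"
      by (simp add: numeral_poly algebra_simps)
    have d': "drift_poly Jacobi p q * ?x ^ n =
        smult (complex_of_real (q + 1)) ((2 - ?x) * ?x ^ n) - smult (complex_of_real (p + 1)) (?x ^ Suc n)"
      unfolding d by (simp only: left_diff_distrib mult_smult_left power_Suc)
    have comb: "smult (of_nat n) g + (smult (complex_of_real (q + 1)) g - h) = smult (complex_of_real (of_nat n + q + 1)) g - h" for g h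
      by (simp add: smult_add_left)
    have "rho_poly Jacobi * pderiv (?x ^ n) + drift_poly Jacobi p q * ?x ^ n =
        smult (complex_of_real (of_nat n + q + 1)) ((2 - ?x) * ?x ^ n) - smult (complex_of_real (p + 1)) (?x ^ Suc n)"
      unfolding r d' comb ..
    also have "(2 - ?x) * ?x ^ n = smult 2 (?x ^ n) - ?x ^ Suc n"
      by (simp add: algebra_simps numeral_poly del: mult_pCons_right)
    also have "U (smult (complex_of_real (of_nat n + q + 1)) (smult 2 (?x ^ n) - ?x ^ Suc n) - smult (complex_of_real (p + 1)) (?x ^ Suc n)) =
        complex_of_real (2 * (of_nat n + q + 1) * jacobi_moment p q n - (of_nat n + p + q + 2) * jacobi_moment p q (Suc n))"
      unfolding U.diff U.scale U_moment by (simp add: algebra_simps)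
    also have "\<dots> = 0" using jacobi_moment_rec[OF \<alpha>\<beta>, of n] by simp
    finally show "U (rho_poly Jacobi * pderiv (?x ^ n) + drift_poly Jacobi p q * ?x ^ n) = 0" .
  qed auto
  then show ?thesis by (simp add: Jacobi)
qed

section \<open>The main theorem\<close>

text \<open>The entries of \<open>Amat\<close> counted from 0 and continued to all indices, so that
  parity needs no range condition.\<close>

definition edge :: "(nat \<Rightarrow> real) \<Rightarrow> nat \<Rightarrow> nat \<Rightarrow> complex" where
  "edge a i j = (if even i \<and> j = Suc i then complex_of_real (a (Suc i))
     else if odd j \<and> i = Suc j then complex_of_real (a (Suc j)) else 0)"

fun shift :: "family \<Rightarrow> (nat \<Rightarrow> real) \<Rightarrow> (nat \<Rightarrow> real) \<Rightarrow> complex" where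
  "shift Hermite _ _ = 2"
| "shift Laguerre _ _ = 1"
| "shift Jacobi \<alpha> \<beta> = complex_of_real (\<alpha> 1 + \<beta> 1)"

lemma Amat_index: "i < N \<Longrightarrow> j < N \<Longrightarrow> Amat N a $$ (i, j) = edge a i j"
  by (auto simp: Amat_def edge_def Let_def)

lemma Ktilde_eq: "Ktilde fam N p q = mat N N (\<lambda>(i, j). if i = j \<and> odd i then shift fam p q else 0)"
  by (cases fam) (auto simp: Kmat_def intro!: eq_matI)

text \<open>Hermite: S / R would be exponential. Laguerre: the residue at 0 makes the difference of
  the \<alpha>'s an integer. Jacobi: the residues at 1 and - 1 make both differences
  integers.\<close>

lemma weights_separated:
  assumes adm: "admissible fam N p q" and ij: "i < N" "j < N" "i \<noteq> j"
    and eq: "rho_poly fam * (R * pderiv S - S * pderiv R) =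
      R * S * (drift_poly fam (p (Suc i)) (q (Suc i)) - drift_poly fam (p (Suc j)) (q (Suc j)))"
  shows "R = 0 \<or> S = 0"
proof (rule ccontr)
  assume "\<not> (R = 0 \<or> S = 0)"
  then have nz: "R \<noteq> 0" "S \<noteq> 0" by auto
  have ij': "Suc i \<in> {1..N}" "Suc j \<in> {1..N}" "Suc i \<noteq> Suc j" using ij by auto
  have int: "y \<in> \<int>" if "complex_of_real y = of_nat m - of_nat n" for y m n
  proof -
    have "complex_of_real y = complex_of_real (of_nat m - of_nat n)" using that by simp
    then have "y = of_nat m - of_nat n" by (simp only: of_real_eq_iff)
    then show ?thesis by simp
  qed
  show False
  proof (cases fam)
    case Hermite
    have "R * pderiv S - S * pderiv R = smult (complex_of_real (2 * p (Suc i) - 2 * p (Suc j))) (R * S)"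
      using eq by (simp add: Hermite mult.commute)
    then have "complex_of_real (2 * p (Suc i) - 2 * p (Suc j)) = 0" using nz by (rule no_exponential_quotient)
    then have "p (Suc i) = p (Suc j)" by (simp only: of_real_eq_0_iff)
    then show False using adm ij' by (simp add: Hermite)
  next
    case Laguerre
    have "[:- 0, 1:] * 1 * (R * pderiv S - S * pderiv R) = R * S * [:complex_of_real (p (Suc i) - p (Suc j)):]"
      using eq by (simp add: Laguerre)
    from power_quotient_order[OF this nz] have "p (Suc i) - p (Suc j) \<in> \<int>"
      by (intro int[of _ "Polynomial.order 0 S" "Polynomial.order 0 R"]) simp
    then show False using adm ij' by (auto simp: Laguerre)
  next
    case Jacobi
    let ?\<tau> = "drift_poly Jacobi (p (Suc i)) (q (Suc i)) - drift_poly Jacobi (p (Suc j)) (q (Suc j))"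
    \<comment> \<open>The cofactor of x - 1 has the value - 2 at 1, where the drift is - 2 (\<alpha>
      + 1).\<close>
    have "[:1, 0, -1:] = [:- 1, 1:] * [:- 1, - 1 :: complex:]" by simp
    then have "[:- 1, 1:] * [:- 1, - 1:] * (R * pderiv S - S * pderiv R) = R * S * ?\<tau>"
      using eq by (simp only: Jacobi rho_poly.simps)
    from power_quotient_order[OF this nz]
    have "- 2 * complex_of_real (p (Suc i) - p (Suc j)) = - 2 * (of_nat (Polynomial.order 1 S) - of_nat (Polynomial.order 1 R))"
      by (simp add: algebra_simps)
    then have 1: "p (Suc i) - p (Suc j) \<in> \<int>" by (intro int) (simp only: mult_cancel_left, simp)
    have "[:1, 0, -1:] = [:- (- 1), 1:] * [:1, - 1 :: complex:]" by simp
    then have "[:- (- 1), 1:] * [:1, - 1:] * (R * pderiv S - S * pderiv R) = R * S * ?\<tau>"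
      using eq by (simp only: Jacobi rho_poly.simps)
    from power_quotient_order[OF this nz]
    have "2 * complex_of_real (q (Suc i) - q (Suc j)) = 2 * (of_nat (Polynomial.order (- 1) S) - of_nat (Polynomial.order (- 1) R))"
      by (simp add: algebra_simps)
    then have "q (Suc i) - q (Suc j) \<in> \<int>" by (intro int) (simp only: mult_cancel_left, simp)
    with 1 show False using adm ij' by (auto simp: Jacobi)
  qed
qed

lemma edge_intertwine:
  assumes adm: "admissible fam N p q" and e: "edge a r c \<noteq> 0" and rc: "r < N" "c < N"
  shows "coeff (rho_poly fam) 2 * of_nat (Suc n) * of_nat n
      + coeff (drift_poly fam (p (Suc c)) (q (Suc c))) 1 * of_nat (Suc n) + (if odd c then shift fam p q else 0) =
    coeff (rho_poly fam) 2 * of_nat n * (of_nat n - 1)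
      + coeff (drift_poly fam (p (Suc r)) (q (Suc r))) 1 * of_nat n + (if odd r then shift fam p q else 0)"
proof -
  have par: "even r" "odd c" using e by (auto simp: edge_def split: if_splits)
  show ?thesis
  proof (cases fam)
    case Jacobi
    have "Suc c \<in> {1..N}" "Suc r \<in> {1..N}" using rc by auto
    then have "p 1 + q 1 = p (Suc c) + q (Suc c) + 1 + (-1) ^ Suc c" "p 1 + q 1 = p (Suc r) + q (Suc r) + 1 + (-1) ^ Suc r"
      using adm unfolding Jacobi admissible.simps by blast+
    \<comment> \<open>The sign in the Jacobi hypothesis makes \<alpha> + \<beta> smaller by 2 at odd
      positions (counted from 0) than at even ones; this offsets the step from \<open>n\<close> to n
      + 1.\<close>
    then have s: "p (Suc c) + q (Suc c) = p 1 + q 1 - 2" "p (Suc r) + q (Suc r) = p 1 + q 1"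
      using par by simp_all
    have "coeff (drift_poly fam (p (Suc c)) (q (Suc c))) 1 = - complex_of_real (p (Suc c) + q (Suc c) + 2)"
      "coeff (drift_poly fam (p (Suc r)) (q (Suc r))) 1 = - complex_of_real (p (Suc r) + q (Suc r) + 2)"
      by (simp_all add: Jacobi)
    then have d: "coeff (drift_poly fam (p (Suc c)) (q (Suc c))) 1 = - complex_of_real (p 1 + q 1)"
      "coeff (drift_poly fam (p (Suc r)) (q (Suc r))) 1 = - complex_of_real (p 1 + q 1 + 2)"
      unfolding s by simp_all
    have "coeff (rho_poly fam) 2 = - 1" by (simp add: Jacobi numeral_2_eq_2)
    then show ?thesis unfolding d using par by (simp add: Jacobi algebra_simps)
  qed (use par in \<open>auto simp: numeral_2_eq_2 algebra_simps\<close>)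
qed

lemma darboux_classical:
  assumes N: "N \<ge> 2" and a: "\<forall>j\<in>{1..N-1}. a j \<noteq> 0" and adm: "admissible fam N p q"
  shows "darboux N (\<lambda>k. weight_functional (support fam) (scalar_weight fam (p (Suc k)) (q (Suc k))))
    (rho_poly fam) (\<lambda>k. drift_poly fam (p (Suc k)) (q (Suc k))) (edge a) (\<lambda>k. if odd k then shift fam p q else 0)"
proof -
  have valid: "valid_parameter fam (p (Suc k)) (q (Suc k))" if "k < N" for k
    using adm that by (cases fam) auto
  let ?u = "\<lambda>k. weight_functional (support fam) (scalar_weight fam (p (Suc k)) (q (Suc k)))"
  have u: "Re (?u k (f * pcnj f)) \<ge> 0 \<and> ?u k (pcnj f) = cnj (?u k f)" if k: "k < N" for k f
  proof -
    obtain t \<mu> c d where "weight_moments (support fam) (scalar_weight fam (p (Suc k)) (q (Suc k))) t \<mu> c d"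
      using ex_weight_moments[OF valid[OF k]] by blast
    then interpret weight_moments "support fam" "scalar_weight fam (p (Suc k)) (q (Suc k))" t \<mu> c d .
    show ?thesis using U_nonneg U_cnj by blast
  qed
  have base: "\<exists>Q. \<forall>n. diag_coeff L n = poly Q (diag_coeff (pearson.bochner (rho_poly fam) (drift_poly fam (p (Suc 0)) (q (Suc 0)))) n)"
    if L: "diffop L" "good_op (?u 0) L" for L
  proof -
    interpret pearson "?u 0" "rho_poly fam" "drift_poly fam (p (Suc 0)) (q (Suc 0))"
      using valid[of 0] N by (intro pearson_weight) simp
    show ?thesis
    proof (cases fam)
      case Hermite
      then show ?thesis
        by (intro diag_coeff_polynomial_linear[OF L(1)]) (simp_all add: numeral_2_eq_2)
    next
      case Laguerre
      then show ?thesis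
        by (intro diag_coeff_polynomial_linear[OF L(1)]) (simp_all add: numeral_2_eq_2)
    next
      case Jacobi
      then show ?thesis
        by (intro diag_coeff_polynomial_jacobi[OF L]) simp
    qed
  qed
  have chain: "edge a i (Suc i) \<noteq> 0" if "Suc i < N" "even i" for i
    using a that by (auto simp: edge_def)
  have chain': "edge a (Suc i) i \<noteq> 0" if "Suc i < N" "odd i" for i
    using a that by (auto simp: edge_def)
  have parity: "even i \<and> odd j" if "edge a i j \<noteq> 0" for i j
    using that by (auto simp: edge_def split: if_splits)
  show ?thesis
  proof (rule darboux.intro)
    show "0 < N" using N by simp
    show "pearson (?u k) (rho_poly fam) (drift_poly fam (p (Suc k)) (q (Suc k)))" if "k < N" for k
      by (rule pearson_weight[OF valid[OF that]])
    show "0 \<le> Re (?u k (f * pcnj f))" if "k < N" for k f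
      using u[OF that] by blast
    show "?u k (pcnj f) = cnj (?u k f)" if "k < N" for k f
      using u[OF that] by blast
    show "cnj (edge a i j) = edge a i j" for i j by (simp add: edge_def)
    show "(if odd (0 :: nat) then shift fam p q else 0) = 0" by simp
  qed (fact parity chain chain' base weights_separated[OF adm] edge_intertwine[OF adm])+
qed

section \<open>From rows and entries back to matrices\<close>

lemma eval_pmat_carrier: "P \<in> carrier_mat n m \<Longrightarrow> eval_pmat P x \<in> carrier_mat n m"
  by (simp add: eval_pmat_def)

lemma eval_pmat_mult:
  assumes "P \<in> carrier_mat n m" "Q \<in> carrier_mat m l"
  shows "eval_pmat (P * Q) x = eval_pmat P x * eval_pmat Q x"
  using assms by (intro eq_matI) (auto simp: eval_pmat_def scalar_prod_def poly_sum)

lemma mat_adjoint_index: "i < dim_col A \<Longrightarrow> j < dim_row A \<Longrightarrow> mat_adjoint A $$ (i, j) = cnj (A $$ (j, i))"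
  by (simp add: mat_adjoint_def mat_of_rows_index)

lemma dim_mat_adjoint: "dim_row (mat_adjoint A) = dim_col A" "dim_col (mat_adjoint A) = dim_row A"
  by (simp_all add: mat_adjoint_def)

lemma mat_adjoint_mult_complex:
  fixes P Q :: "complex mat"
  assumes "P \<in> carrier_mat n m" "Q \<in> carrier_mat m l"
  shows "mat_adjoint (P * Q) = mat_adjoint Q * mat_adjoint P"
  using assms by (intro eq_matI) (auto simp: mat_adjoint_index dim_mat_adjoint scalar_prod_def mult.commute)

lemma mult_diagonal_index:
  fixes P :: "'a::comm_ring_1 mat"
  assumes "P \<in> carrier_mat n m" "i < n" "j < m"
  shows "(P * mat m m (\<lambda>(i, j). if i = j then d i else 0)) $$ (i, j) = P $$ (i, j) * d j"
  using assms by (simp add: scalar_prod_def if_distrib[of "\<lambda>x. _ * x"] cong: if_cong)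

lemma Tpoly_carrier: "Tpoly N a \<in> carrier_mat N N"
  by (simp add: Tpoly_def Amat_def)

lemma Tpoly_index: "i < N \<Longrightarrow> j < N \<Longrightarrow> Tpoly N a $$ (i, j) = (if i = j then 1 else 0) + [:0, edge a i j:]"
  using Amat_index[of i N j a] by (simp add: Tpoly_def Amat_def)

text \<open>\<open>minv\<close> is \<open>the\<close> of an option: \<open>None\<close> must be
  excluded first, then uniqueness of inverses identifies the value.\<close>

lemma minv_inverse:
  assumes "M \<in> carrier_mat n n" "M' \<in> carrier_mat n n" "M * M' = 1\<^sub>m n" "M' * M = 1\<^sub>m n"
  shows "minv M = M'"
proof -
  have "mat_inverse M \<noteq> None"
    using mat_inverse(1)[OF assms(1)] assms by (auto simp: Units_def ring_mat_def)
  then obtain B where "mat_inverse M = Some B" by auto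
  then have B: "M * B = 1\<^sub>m n" "B \<in> carrier_mat n n" "minv M = B"
    using mat_inverse(2)[OF assms(1)] by (auto simp: minv_def)
  have "B = (M' * M) * B" using B assms by simp
  also have "\<dots> = M' * (M * B)" using B assms by (intro assoc_mult_mat) auto
  finally show ?thesis using B assms by simp
qed

text \<open>The pointwise Pearson equation. It identifies the first-order coefficient of D with the
  drift, whereas the functional version rests on moments.\<close>

lemma weight_derivative:
  assumes x: "x \<in> support fam"
  shows "((\<lambda>t. rho fam t * scalar_weight fam b c t) has_real_derivative
      Re (poly (drift_poly fam b c) (complex_of_real x)) * scalar_weight fam b c x) (at x)"
proof (cases fam)
  case Hermite
  then show ?thesis by (auto intro!: derivative_eq_intros simp: algebra_simps)
next
  case Laguerre
  then have "x > 0" using x by simp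
  then have "x * x powr (b - 1) = x powr b" using powr_mult_base[of x "b - 1"] by simp
  then show ?thesis
    using \<open>x > 0\<close> unfolding Laguerre
    by (auto intro!: derivative_eq_intros simp: algebra_simps)
next
  case Jacobi
  then have y: "1 - x > 0" "1 + x > 0" using x by auto
  have e: "(1 - x) powr (b - 1) = (1 - x) powr b / (1 - x)" "(1 + x) powr (c - 1) = (1 + x) powr c / (1 + x)"
    using y by (simp_all add: powr_diff)
  have 1: "((\<lambda>t. (1 - t) powr b) has_real_derivative - (b * ((1 - x) powr b / (1 - x)))) (at x)"
    using y unfolding e[symmetric] by (auto intro!: derivative_eq_intros)
  have 2: "((\<lambda>t. (1 + t) powr c) has_real_derivative c * ((1 + x) powr c / (1 + x))) (at x)"
    using y unfolding e[symmetric] by (auto intro!: derivative_eq_intros)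
  have 0: "((\<lambda>t. 1 - t\<^sup>2) has_real_derivative - 2 * x) (at x)"
    by (auto intro!: derivative_eq_intros)
  have D: "((\<lambda>t. (1 - t\<^sup>2) * ((1 - t) powr b * (1 + t) powr c)) has_real_derivative
      (- 2 * x) * ((1 - x) powr b * (1 + x) powr c) +
      (1 - x\<^sup>2) * (- (b * ((1 - x) powr b / (1 - x))) * (1 + x) powr c + (1 - x) powr b * (c * ((1 + x) powr c / (1 + x))))) (at x)"
    by (rule DERIV_cong[OF DERIV_mult[OF 0 DERIV_mult[OF 1 2]]]) (simp add: algebra_simps)
  have E: "(1 - x\<^sup>2) * (- (b * ((1 - x) powr b / (1 - x))) * (1 + x) powr c + (1 - x) powr b * (c * ((1 + x) powr c / (1 + x))))
      = (- b * (1 + x) + c * (1 - x)) * ((1 - x) powr b * (1 + x) powr c)"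
  proof -
    have sq: "1 - x\<^sup>2 = (1 - x) * (1 + x)" by (simp add: power2_eq_square algebra_simps)
    have "y * z * (- (b * (Y / y)) * Z + Y * (c * (Z / z))) = (- b * z + c * y) * (Y * Z)"
      if "y \<noteq> 0" "z \<noteq> 0" for y z Y Z :: real
      using that by (simp add: field_simps)
    then show ?thesis unfolding sq using y by simp
  qed
  show ?thesis
    unfolding Jacobi rho.simps scalar_weight.simps
    by (rule DERIV_cong[OF D[unfolded E]]) (simp add: algebra_simps)
qed

lemma drift_poly_real: "poly (drift_poly fam b c) (complex_of_real x) = complex_of_real (Re (poly (drift_poly fam b c) (complex_of_real x)))"
  by (cases fam) (simp_all add: complex_eq_iff)

lemma rho_poly_eval: "poly (rho_poly fam) (complex_of_real x) = complex_of_real (rho fam x)"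
  by (cases fam) (simp_all add: power2_eq_square)

lemma scalar_weight_pos: "x \<in> support fam \<Longrightarrow> scalar_weight fam b c x > 0"
  by (cases fam) auto

lemma log_derivative_matrix:
  assumes x: "x \<in> support fam"
  shows "mat_vderiv N (\<lambda>t. complex_of_real (rho fam t) \<cdot>\<^sub>m Wtilde fam N p q t) x * minv (Wtilde fam N p q x)
    = mat N N (\<lambda>(i, j). if i = j then poly (drift_poly fam (p (Suc i)) (q (Suc i))) (complex_of_real x) else 0)"
    (is "?D * _ = ?V")
proof -
  define w where "w = (\<lambda>i. complex_of_real (scalar_weight fam (p (Suc i)) (q (Suc i)) x))"
  have W: "Wtilde fam N p q x = mat N N (\<lambda>(i, j). if i = j then w i else 0)"
    by (auto simp: Wtilde_def w_def intro!: eq_matI)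
  have w: "w i \<noteq> 0" for i using scalar_weight_pos[OF x, of "p (Suc i)" "q (Suc i)"] by (simp add: w_def)
  have prod: "mat N N (\<lambda>(i, j). if i = j then f i else 0) * mat N N (\<lambda>(i, j). if i = j then g i else 0) =
      mat N N (\<lambda>(i, j). if i = j then f i * g i else (0 :: complex))" for f g
  proof (rule eq_matI)
    fix i j
    assume "i < dim_row (mat N N (\<lambda>(i, j). if i = j then f i * g i else 0))"
      "j < dim_col (mat N N (\<lambda>(i, j). if i = j then f i * g i else 0))"
    then have "i < N" "j < N" by auto
    then show "(mat N N (\<lambda>(i, j). if i = j then f i else 0) * mat N N (\<lambda>(i, j). if i = j then g i else 0)) $$ (i, j) =
        mat N N (\<lambda>(i, j). if i = j then f i * g i else 0) $$ (i, j)"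
      by (subst mult_diagonal_index[where n = N]) auto
  qed auto
  have one: "1\<^sub>m N = mat N N (\<lambda>(i, j). if i = j then 1 else (0 :: complex))" by (auto intro!: eq_matI)
  have inv: "minv (Wtilde fam N p q x) = mat N N (\<lambda>(i, j). if i = j then 1 / w i else 0)"
    by (rule minv_inverse[where n = N]) (auto simp: W prod one w)
  have "?D = mat N N (\<lambda>(i, j). if i = j then poly (drift_poly fam (p (Suc i)) (q (Suc i))) (complex_of_real x) * w i else 0)"
    unfolding mat_vderiv_def
  proof (intro cong_mat refl, clarify)
    fix i j assume ij: "i < N" "j < N"
    let ?s = "scalar_weight fam (p (Suc i)) (q (Suc i))"
    let ?d = "Re (poly (drift_poly fam (p (Suc i)) (q (Suc i))) (complex_of_real x))"
    show "vector_derivative (\<lambda>t. (complex_of_real (rho fam t) \<cdot>\<^sub>m Wtilde fam N p q t) $$ (i, j)) (at x) =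
      (if i = j then poly (drift_poly fam (p (Suc i)) (q (Suc i))) (complex_of_real x) * w i else 0)"
    proof (cases "i = j")
      case True
      have "((\<lambda>t. rho fam t * ?s t) has_vector_derivative ?d * ?s x) (at x)"
        using weight_derivative[OF x] by (simp add: has_real_derivative_iff_has_vector_derivative)
      then have "((\<lambda>t. complex_of_real (rho fam t * ?s t)) has_vector_derivative complex_of_real (?d * ?s x)) (at x)"
        by (rule bounded_linear.has_vector_derivative[OF bounded_linear_of_real])
      moreover have "(\<lambda>t. (complex_of_real (rho fam t) \<cdot>\<^sub>m Wtilde fam N p q t) $$ (i, j)) = (\<lambda>t. complex_of_real (rho fam t * ?s t))"
        using ij True by (simp add: Wtilde_def)
      moreover have "complex_of_real (?d * ?s x) = poly (drift_poly fam (p (Suc i)) (q (Suc i))) (complex_of_real x) * w i"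
        by (simp only: of_real_mult drift_poly_real[symmetric] w_def)
      ultimately show ?thesis using True by (simp only: if_True vector_derivative_at refl)
    next
      case False
      then show ?thesis using ij by (simp add: Wtilde_def)
    qed
  qed
  then show ?thesis unfolding inv by (simp only: prod) (auto intro!: eq_matI simp: w)
qed

lemma mult_Tpoly_index:
  assumes "darboux N u \<rho> v (edge a) \<kappa>" and "P \<in> carrier_mat N N" "i < N" "k < N"
  shows "(P * Tpoly N a) $$ (i, k) = darboux.T N (edge a) (\<lambda>l. P $$ (i, l)) k"
proof -
  interpret darboux N u \<rho> v "edge a" \<kappa> by fact
  show ?thesis
    using assms(2-) Tpoly_carrier[of N a]
    by (simp add: scalar_prod_def Tpoly_index T_def X_def distrib_left sum.distrib atLeast0LessThan
        if_distrib[of "\<lambda>x. _ * x"] mult.commute cong: if_cong)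
qed

lemma darboux_weight_classical:
  assumes "N \<ge> 2" "\<forall>j\<in>{1..N-1}. a j \<noteq> 0" and adm: "admissible fam N p q"
  shows "darboux_weight N (\<lambda>k. weight_functional (support fam) (scalar_weight fam (p (Suc k)) (q (Suc k))))
    (rho_poly fam) (\<lambda>k. drift_poly fam (p (Suc k)) (q (Suc k))) (edge a) (\<lambda>k. if odd k then shift fam p q else 0)
    (Wmat fam N a p q) (support fam)"
proof -
  let ?u = "\<lambda>k. weight_functional (support fam) (scalar_weight fam (p (Suc k)) (q (Suc k)))"
  interpret darboux N ?u "rho_poly fam" "\<lambda>k. drift_poly fam (p (Suc k)) (q (Suc k))" "edge a"
    "\<lambda>k. if odd k then shift fam p q else 0"
    by (rule darboux_classical[OF assms])
  have valid: "valid_parameter fam (p (Suc k)) (q (Suc k))" if "k < N" for k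
    using adm that by (cases fam) auto
  note PT = mult_Tpoly_index[OF darboux_axioms]
  show ?thesis
  proof
    fix P Q :: pmat assume P: "P \<in> carrier_mat N N" and Q: "Q \<in> carrier_mat N N"
    have "integral (support fam) (\<lambda>x. (eval_pmat P x * Wmat fam N a p q x * mat_adjoint (eval_pmat Q x)) $$ (i, j)) =
        form (\<lambda>k. P $$ (i, k)) (\<lambda>k. pcnj (Q $$ (j, k)))" if ij: "i < N" "j < N" for i j
    proof -
      let ?f = "\<lambda>k. T (\<lambda>l. P $$ (i, l)) k * T (\<lambda>l. pcnj (Q $$ (j, l))) k"
      let ?w = "\<lambda>k x. complex_of_real (scalar_weight fam (p (Suc k)) (q (Suc k)) x)"
      have entry: "(eval_pmat P x * Wmat fam N a p q x * mat_adjoint (eval_pmat Q x)) $$ (i, j) =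
          (\<Sum>k<N. poly (?f k) (complex_of_real x) * ?w k x)" for x
      proof -
        define E F Tx Wx where "E = eval_pmat P x" and "F = eval_pmat Q x" and "Tx = eval_pmat (Tpoly N a) x"
          and "Wx = Wtilde fam N p q x"
        have carr: "E \<in> carrier_mat N N" "F \<in> carrier_mat N N" "Tx \<in> carrier_mat N N" "Wx \<in> carrier_mat N N"
          using P Q Tpoly_carrier by (auto simp: E_def F_def Tx_def Wx_def Wtilde_def intro: eval_pmat_carrier)
        then have adj: "mat_adjoint Tx \<in> carrier_mat N N" "mat_adjoint F \<in> carrier_mat N N"
          by (auto intro!: carrier_matI simp: dim_mat_adjoint)
        \<comment> \<open>Attaching \<open>Tx\<close> to each argument leaves only the diagonal
          weight in the middle.\<close>
        have "E * (Tx * Wx * mat_adjoint Tx) * mat_adjoint F = (E * Tx * Wx) * mat_adjoint (F * Tx)"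
          using carr adj by (simp add: mat_adjoint_mult_complex[of F N N Tx N] assoc_mult_mat[of _ N N _ N _ N])
        moreover have "(E * Tx * Wx) $$ (i, k) = (E * Tx) $$ (i, k) * ?w k x" if "k < N" for k
        proof -
          have "Wx = mat N N (\<lambda>(i, j). if i = j then ?w i x else 0)"
            by (auto simp: Wx_def Wtilde_def intro!: eq_matI)
          then show ?thesis using mult_diagonal_index[of "E * Tx" N N i k "\<lambda>i. ?w i x"] carr ij that by simp
        qed
        moreover have "mat_adjoint (F * Tx) $$ (k, j) = cnj ((F * Tx) $$ (j, k))" if "k < N" for k
          using carr ij that by (simp add: mat_adjoint_index)
        moreover have "(E * Tx) $$ (i, k) = poly (T (\<lambda>l. P $$ (i, l)) k) (complex_of_real x)" if "k < N" for k
          using PT[OF P ij(1) that] P Tpoly_carrier[of N a] ij that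
          by (simp add: E_def Tx_def eval_pmat_mult[OF P Tpoly_carrier, symmetric]) (simp add: eval_pmat_def)
        moreover have "(F * Tx) $$ (j, k) = poly (T (\<lambda>l. Q $$ (j, l)) k) (complex_of_real x)" if "k < N" for k
          using PT[OF Q ij(2) that] Q Tpoly_carrier[of N a] ij that
          by (simp add: F_def Tx_def eval_pmat_mult[OF Q Tpoly_carrier, symmetric]) (simp add: eval_pmat_def)
        moreover have "((E * Tx * Wx) * mat_adjoint (F * Tx)) $$ (i, j) =
            (\<Sum>k<N. (E * Tx * Wx) $$ (i, k) * mat_adjoint (F * Tx) $$ (k, j))"
          using carr ij by (simp add: scalar_prod_def dim_mat_adjoint atLeast0LessThan)
        ultimately have "(E * (Tx * Wx * mat_adjoint Tx) * mat_adjoint F) $$ (i, j) =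
            (\<Sum>k<N. poly (?f k) (complex_of_real x) * ?w k x)"
          by (simp add: T_pcnj poly_pcnj mult_ac)
        then show ?thesis by (simp add: Wmat_def E_def F_def Tx_def Wx_def)
      qed
      have "(\<lambda>x. poly (?f k) (complex_of_real x) * ?w k x) integrable_on support fam" if k: "k < N" for k
      proof -
        obtain t \<mu> c d where "weight_moments (support fam) (scalar_weight fam (p (Suc k)) (q (Suc k))) t \<mu> c d"
          using ex_weight_moments[OF valid[OF k]] by blast
        then show ?thesis by (rule weight_moments.integrable)
      qed
      then show ?thesis
        unfolding entry form_def weight_functional_def by (intro integral_sum) auto
    qed
    then show "mip N (Wmat fam N a p q) (support fam) P Q =
        mat N N (\<lambda>(i, j). form (\<lambda>k. P $$ (i, k)) (\<lambda>k. pcnj (Q $$ (j, k))))"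
      unfolding mip_def by (intro cong_mat) auto
  qed
qed

lemma minv_Tpoly:
  shows "eval_pmat (Tpoly N a) x * minv (eval_pmat (Tpoly N a) x) = 1\<^sub>m N"
    and "minv (eval_pmat (Tpoly N a) x) \<in> carrier_mat N N"
proof -
  define Z where "Z = mat N N (\<lambda>(i, j). edge a i j * complex_of_real x)"
  have Z: "Z \<in> carrier_mat N N" by (simp add: Z_def)
  have "edge a i k * edge a k j = 0" for i j k by (auto simp: edge_def)
  then have "edge a i k * complex_of_real x * (edge a k j * complex_of_real x) = 0" for i j k
    by (metis mult.assoc mult.commute mult_zero_left)
  then have ZZ: "Z * Z = 0\<^sub>m N N"
    by (intro eq_matI) (simp_all add: Z_def scalar_prod_def)
  have T: "eval_pmat (Tpoly N a) x = 1\<^sub>m N + Z"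
    using Tpoly_carrier[of N a]
    by (intro eq_matI) (auto simp: eval_pmat_def Tpoly_index Z_def mult.commute)
  have "(1\<^sub>m N + Z) * (1\<^sub>m N - Z) = 1\<^sub>m N * (1\<^sub>m N - Z) + Z * (1\<^sub>m N - Z)"
    using Z by (intro add_mult_distrib_mat) auto
  also have "Z * (1\<^sub>m N - Z) = Z * 1\<^sub>m N - Z * Z"
    using Z by (intro mult_minus_distrib_mat) auto
  finally have inv1: "(1\<^sub>m N + Z) * (1\<^sub>m N - Z) = 1\<^sub>m N"
    unfolding ZZ using Z by (auto intro!: eq_matI)
  have "(1\<^sub>m N - Z) * (1\<^sub>m N + Z) = 1\<^sub>m N * (1\<^sub>m N + Z) - Z * (1\<^sub>m N + Z)"
    using Z by (intro minus_mult_distrib_mat) auto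
  also have "Z * (1\<^sub>m N + Z) = Z * 1\<^sub>m N + Z * Z"
    using Z by (intro mult_add_distrib_mat) auto
  finally have inv2: "(1\<^sub>m N - Z) * (1\<^sub>m N + Z) = 1\<^sub>m N"
    unfolding ZZ using Z by (auto intro!: eq_matI)
  note inv = inv1 inv2
  have "minv (eval_pmat (Tpoly N a) x) = 1\<^sub>m N - Z"
    unfolding T using Z inv by (intro minv_inverse) auto
  then show "eval_pmat (Tpoly N a) x * minv (eval_pmat (Tpoly N a) x) = 1\<^sub>m N"
    "minv (eval_pmat (Tpoly N a) x) \<in> carrier_mat N N"
    using T inv Z by auto
qed

theorem theorem4p3:
  fixes fam :: family and N :: nat and a p q :: "nat \<Rightarrow> real"
  assumes "N \<ge> 2"
    and "\<forall>j\<in>{1..N-1}. a j \<noteq> 0"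
    and "admissible fam N p q"
  shows "\<exists>D. wf_dop N D \<and> length D = 3 \<and> D ! 2 \<noteq> 0\<^sub>m N N
          \<and> (\<forall>P\<in>carrier_mat N N. \<forall>x\<in>support fam.
                eval_pmat (dop_act D P) x = paper_D_action fam N a p q P x)
          \<and> D \<in> DW N (Wmat fam N a p q) (support fam)
          \<and> DW N (Wmat fam N a p q) (support fam) = poly_algebra N D"
proof -
  let ?\<kappa> = "\<lambda>k. if odd k then shift fam p q else 0"
  let ?v = "\<lambda>k. drift_poly fam (p (Suc k)) (q (Suc k))"
  interpret darboux_weight N "\<lambda>k. weight_functional (support fam) (scalar_weight fam (p (Suc k)) (q (Suc k)))"
    "rho_poly fam" ?v "edge a" ?\<kappa> "Wmat fam N a p q" "support fam"
    by (rule darboux_weight_classical[OF assms])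
  note PT = mult_Tpoly_index[OF darboux_axioms]
  have "eval_pmat (dop_act Dlist P) x = paper_D_action fam N a p q P x"
    if P: "P \<in> carrier_mat N N" and x: "x \<in> support fam" for P x
  proof -
    define R where "R = P * Tpoly N a"
    define Tx where "Tx = eval_pmat (Tpoly N a) x"
    have R: "R \<in> carrier_mat N N" using P Tpoly_carrier by (auto simp: R_def)
    have Tx: "Tx \<in> carrier_mat N N" using Tpoly_carrier by (simp add: Tx_def eval_pmat_carrier)
    define V where "V = mat N N (\<lambda>(i, j). if i = j then poly (?v i) (complex_of_real x) else 0)"
    define K where "K = mat N N (\<lambda>(i, j). if i = j then ?\<kappa> i else 0)"
    have K: "Ktilde fam N p q = K" by (auto simp: Ktilde_eq K_def intro!: eq_matI)
    define B where "B = complex_of_real (rho fam x) \<cdot>\<^sub>m eval_pmat (pderiv_mat 2 R) x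
        + eval_pmat (pderiv_mat 1 R) x * V + eval_pmat R x * K"
    have paper: "paper_D_action fam N a p q P x = B * minv Tx"
      using log_derivative_matrix[OF x, of N p q]
      by (simp add: paper_D_action_def Let_def B_def R_def Tx_def V_def K)
    have D: "dop_act Dlist P \<in> carrier_mat N N" by (simp add: dop_act_eq[OF wf_Dlist P])
    \<comment> \<open>Multiplying by \<open>Tx\<close> first keeps inverses out of the computation:
      \<open>T\<close> cancels the \<open>T'\<close> in \<open>Dact\<close> and leaves
      \<open>M k\<close> on each entry of P T.\<close>
    have "eval_pmat (dop_act Dlist P) x * Tx = B"
    proof (rule eq_matI)
      fix i k assume "i < dim_row B" "k < dim_col B"
      then have ik: "i < N" "k < N" using R by (auto simp: B_def K_def eval_pmat_def)
      let ?r = "\<lambda>l. P $$ (i, l)"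
      have "(dop_act Dlist P * Tpoly N a) $$ (i, k) = T (\<lambda>l. dop_act Dlist P $$ (i, l)) k"
        by (rule PT[OF D ik])
      also have "\<dots> = T (Dact ?r) k"
        using ik by (intro T_cong) (auto simp: dop_act_eq[OF wf_Dlist P] act_Dlist)
      also have "\<dots> = M k (R $$ (i, k))"
        unfolding Dact_def T_T' R_def PT[OF P ik] ..
      finally have e: "(dop_act Dlist P * Tpoly N a) $$ (i, k) = M k (R $$ (i, k))" .
      have "(eval_pmat (dop_act Dlist P) x * Tx) $$ (i, k) = poly (M k (R $$ (i, k))) (complex_of_real x)"
        unfolding Tx_def eval_pmat_mult[OF D Tpoly_carrier, symmetric] e[symmetric]
        using D Tpoly_carrier[of N a] ik by (simp add: eval_pmat_def)
      also have "\<dots> = complex_of_real (rho fam x) * poly (pderiv (pderiv (R $$ (i, k)))) (complex_of_real x)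
          + poly (pderiv (R $$ (i, k))) (complex_of_real x) * poly (?v k) (complex_of_real x)
          + poly (R $$ (i, k)) (complex_of_real x) * ?\<kappa> k"
        unfolding M_eq[OF ik(2)] by (simp add: rho_poly_eval)
      also have "\<dots> = B $$ (i, k)"
      proof -
        have E: "eval_pmat (pderiv_mat 1 R) x \<in> carrier_mat N N" "eval_pmat R x \<in> carrier_mat N N"
          using R by (auto simp: eval_pmat_def pderiv_mat_def)
        have "(eval_pmat (pderiv_mat 1 R) x * V) $$ (i, k) = eval_pmat (pderiv_mat 1 R) x $$ (i, k) * poly (?v k) (complex_of_real x)"
          unfolding V_def by (rule mult_diagonal_index[OF E(1) ik])
        moreover have "(eval_pmat R x * K) $$ (i, k) = eval_pmat R x $$ (i, k) * ?\<kappa> k"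
          unfolding K_def by (rule mult_diagonal_index[OF E(2) ik])
        moreover have "B $$ (i, k) = complex_of_real (rho fam x) * eval_pmat (pderiv_mat 2 R) x $$ (i, k)
            + (eval_pmat (pderiv_mat 1 R) x * V) $$ (i, k) + (eval_pmat R x * K) $$ (i, k)"
        proof -
          have "dim_row K = N" "dim_col K = N" "dim_row V = N" "dim_col V = N" by (simp_all add: K_def V_def)
          then show ?thesis
            using ik R by (simp add: B_def eval_pmat_def pderiv_mat_def del: index_mult_mat(1))
        qed
        ultimately show ?thesis
          using ik R by (simp add: eval_pmat_def pderiv_mat_def numeral_2_eq_2 del: index_mult_mat(1))
      qed
      finally show "(eval_pmat (dop_act Dlist P) x * Tx) $$ (i, k) = B $$ (i, k)" .
    qed (use D R Tx in \<open>auto simp: B_def K_def eval_pmat_def\<close>)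
    then have "B * minv Tx = eval_pmat (dop_act Dlist P) x * Tx * minv Tx" by simp
    also have "\<dots> = eval_pmat (dop_act Dlist P) x * (Tx * minv Tx)"
      by (rule assoc_mult_mat[OF eval_pmat_carrier[OF D] Tx minv_Tpoly(2)[of N a x, folded Tx_def]])
    also have "\<dots> = eval_pmat (dop_act Dlist P) x"
      using minv_Tpoly(1)[of N a x] right_mult_one_mat[OF eval_pmat_carrier[OF D]] by (simp add: Tx_def)
    finally show ?thesis using paper by simp
  qed
  moreover have "Dlist ! 2 \<noteq> 0\<^sub>m N N"
  proof
    assume "Dlist ! 2 = 0\<^sub>m N N"
    then have "(Dlist ! 2) $$ (0, 0) = 0" using N_pos by simp
    then have "rho_poly fam = 0" using N_pos by (simp add: Dlist_def)
    then show False by (cases fam) auto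
  qed
  moreover have "length Dlist = 3" by (simp add: Dlist_def)
  ultimately show ?thesis
    using wf_Dlist Dlist_in_DW DW_eq_poly_algebra by (intro exI[of _ Dlist]) blast
qed

end
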